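(* Let $a,b\ge2$ and $r\ge0$ be integers, and let $$\mathfrak p_{a,b,r}=\mathfrak q\bigl((2ab+4r)\mid(a(b-1),\,a-1,\,2^{[r]},\,1,\,2^{[r]},\,ab)\bigr)\subseteq\mathfrak{sl}_{2ab+4r}.$$ Then $\mathfrak p_{a,b,r}$ is Frobenius, and, with $D=a+b-2$ and $V=z^{D-1}+z^{D}$, its Ooms multiplicity polynomial is $$H_{a,b,r}=B_{a-1}+C_aB_{b-1}+2r(1+z)+(1+z)\bigl(I_aI_b+rV\bigr)\bigl(I_a^{\vee}I_b^{\vee}+rV^{\vee}\bigr).$$ Its support (the set of exponents with nonzero coefficient) is $[-D,D+1]$ (all integers in this interval), and $$\dim\mathfrak p_{a,b,r}=8r^2+(8ab+4)r+a(a-1)+a^2b(3b-1).$$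
   Context: All Lie algebras are finite-dimensional over $\mathbb C$. A Lie algebra $\mathfrak g$ is Frobenius if there is $F\in\mathfrak g^*$ whose Kirillov form $B_F(x,y)=F([x,y])$ is nondegenerate; the principal element $\widehat F$ is the unique element with $F([\widehat F,x])=F(x)$ for all $x$. For the seaweeds considered here $\operatorname{ad}\widehat F$ is semisimple with integral eigenvalues; $\mathfrak g_k=\{x:[\widehat F,x]=kx\}$, the dimensions $\dim\mathfrak g_k$ are independent of $F$, and the Ooms multiplicity polynomial is the Laurent polynomial $H_{\mathfrak g}(z)=\sum_{k\in\mathbb Z}(\dim\mathfrak g_k)z^k$. For compositions $A,B$ of $n$ (cutting $1,\ldots,n$ into consecutive blocks), with $\alpha(i),\beta(i)$ the $A$-block and $B$-block containing $i$, the seaweed is $$\mathfrak q(A\mid B)=\mathfrak h\oplus\bigoplus_{i>j,\ \alpha(i)=\alpha(j)}\mathbb C E_{ij}\oplus\bigoplus_{i<j,\ \beta(i)=\beta(j)}\mathbb C E_{ij}\subseteq\mathfrak{sl}_n,$$ where $\mathfrak h$ is the trace-zero diagonal subalgebra. It is a parabolic when $A=(n)$. The notation $2^{[r]}$ means a list of $r$ parts equal to $2$. For a Laurent polynomial $P(z)$, $P^{\vee}(z)=P(z^{-1})$. For $m\ge1$: $I_m=1+z+\cdots+z^{m-1}$, $C_m=I_mI_m^{\vee}$, $B_m=C_m+zI_m$. *)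

theory Defs
  imports Complex_Main "HOL-Library.Poly_Mapping" "Jordan_Normal_Form.VS_Connect"
begin

section \<open>Frobenius Lie algebras of complex matrices\<close>

text \<open>Lie algebras are represented as complex Lie subalgebras of \<open>gl_n\<close>, i.e. as sets of
  \<open>n \<times> n\<close> matrices.\<close>

definition lie_bracket :: "complex mat \<Rightarrow> complex mat \<Rightarrow> complex mat" where
  "lie_bracket x y = x * y - y * x"

definition lie_subalgebra :: "nat \<Rightarrow> complex mat set \<Rightarrow> bool" where
  "lie_subalgebra n g \<longleftrightarrow>
     VectorSpace.subspace class_ring g (module_mat TYPE(complex) n n) \<and>
     (\<forall>x\<in>g. \<forall>y\<in>g. lie_bracket x y \<in> g)"

definition mat_subspace_dim :: "nat \<Rightarrow> complex mat set \<Rightarrow> nat" where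
  "mat_subspace_dim n W =
     vectorspace.dim class_ring (module_mat TYPE(complex) n n \<lparr>carrier := W\<rparr>)"

text \<open>An element of the dual of \<open>g\<close> is given by any function on matrices that is linear on
  \<open>g\<close>; its values outside \<open>g\<close> play no role.\<close>

definition linear_functional :: "complex mat set \<Rightarrow> (complex mat \<Rightarrow> complex) \<Rightarrow> bool" where
  "linear_functional g F \<longleftrightarrow>
     (\<forall>x\<in>g. \<forall>y\<in>g. F (x + y) = F x + F y) \<and> (\<forall>c. \<forall>x\<in>g. F (c \<cdot>\<^sub>m x) = c * F x)"

definition kirillov_form :: "(complex mat \<Rightarrow> complex) \<Rightarrow> complex mat \<Rightarrow> complex mat \<Rightarrow> complex"
  where "kirillov_form F x y = F (lie_bracket x y)"

text \<open>The Kirillov form is alternating, so it is nondegenerate as soon as its left radical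
  is zero.\<close>

definition frobenius_functional ::
    "nat \<Rightarrow> complex mat set \<Rightarrow> (complex mat \<Rightarrow> complex) \<Rightarrow> bool" where
  "frobenius_functional n g F \<longleftrightarrow>
     linear_functional g F \<and>
     (\<forall>x\<in>g. (\<forall>y\<in>g. kirillov_form F x y = 0) \<longrightarrow> x = 0\<^sub>m n n)"

definition frobenius :: "nat \<Rightarrow> complex mat set \<Rightarrow> bool" where
  "frobenius n g \<longleftrightarrow> lie_subalgebra n g \<and> (\<exists>F. frobenius_functional n g F)"

definition principal_element :: "complex mat set \<Rightarrow> (complex mat \<Rightarrow> complex) \<Rightarrow> complex mat" where
  "principal_element g F = (THE p. p \<in> g \<and> (\<forall>x\<in>g. F (lie_bracket p x) = F x))"

definition principal_eigenspace ::
    "complex mat set \<Rightarrow> (complex mat \<Rightarrow> complex) \<Rightarrow> int \<Rightarrow> complex mat set" where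
  "principal_eigenspace g F k =
     {x \<in> g. lie_bracket (principal_element g F) x = of_int k \<cdot>\<^sub>m x}"


section \<open>Laurent polynomials\<close>

text \<open>Finitely supported maps from the exponents to the coefficients; the multiplication of
  \<^typ>\<open>int \<Rightarrow>\<^sub>0 int\<close> is convolution, so this is the ring of integral Laurent polynomials. The
  support is given by \<^const>\<open>Poly_Mapping.keys\<close>.\<close>

type_synonym laurent_poly = "int \<Rightarrow>\<^sub>0 int"

definition zpow :: "int \<Rightarrow> laurent_poly" where
  "zpow k = Poly_Mapping.single k 1"

definition lp_vee :: "laurent_poly \<Rightarrow> laurent_poly" where
  "lp_vee P = Poly_Mapping.map_key uminus P"

definition lp_I :: "nat \<Rightarrow> laurent_poly" where
  "lp_I m = (\<Sum>i<m. zpow (int i))"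

definition lp_C :: "nat \<Rightarrow> laurent_poly" where
  "lp_C m = lp_I m * lp_vee (lp_I m)"

definition lp_B :: "nat \<Rightarrow> laurent_poly" where
  "lp_B m = lp_C m + zpow 1 * lp_I m"

text \<open>The polynomial computed from one particular Frobenius functional \<open>F\<close>. As
  \<open>g\<close> is finite-dimensional, only finitely many summands are nonzero.\<close>

definition ooms_polynomial ::
    "nat \<Rightarrow> complex mat set \<Rightarrow> (complex mat \<Rightarrow> complex) \<Rightarrow> laurent_poly" where
  "ooms_polynomial n g F =
     Sum_any (\<lambda>k. of_nat (mat_subspace_dim n (principal_eigenspace g F k)) * zpow k)"


section \<open>Seaweed algebras\<close>

text \<open>Compositions are lists of positive parts. Matrix indices and blocks are numbered from 0:
  \<open>block_of A i\<close> is the number of the block of \<open>A\<close> containing \<open>i\<close>, for \<open>i < sum_list A\<close>.\<close>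

fun block_of :: "nat list \<Rightarrow> nat \<Rightarrow> nat" where
  "block_of [] i = 0"
| "block_of (p # ps) i = (if i < p then 0 else Suc (block_of ps (i - p)))"

definition seaweed :: "nat \<Rightarrow> nat list \<Rightarrow> nat list \<Rightarrow> complex mat set" where
  "seaweed n A B =
     {x \<in> carrier_mat n n.
        (\<Sum>i<n. x $$ (i, i)) = 0 \<and>
        (\<forall>i<n. \<forall>j<n.
           (i > j \<and> block_of A i \<noteq> block_of A j \<longrightarrow> x $$ (i, j) = 0) \<and>
           (i < j \<and> block_of B i \<noteq> block_of B j \<longrightarrow> x $$ (i, j) = 0))}"

end

theory Submission
  imports Defs "HOL-Computational_Algebra.Fundamental_Theorem_Algebra"
    "HOL-Analysis.Continuum_Not_Denumerable"
    "Jordan_Normal_Form.Jordan_Normal_Form_Existence"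
    "Jordan_Normal_Form.Jordan_Normal_Form_Uniqueness"
begin

text \<open>The algebra consists of the traceless matrices that are supported on a preorder of positions
  (row, column): those on or below the diagonal and those in a diagonal block. The proof has three
  parts, which concern one good functional, all other functionals, and the counting.

  \<^bold>\<open>A Frobenius functional.\<close> Let \<open>m = ab + 2r\<close> be half the size of the matrices. The functional sums the entries
  at the edges of a tree on the indices: the antidiagonal, which pairs every index with its mirror
  image, and a tree on the first half. An element of the radical satisfies one linear equation for
  each position. The antidiagonal makes the two diagonal quadrants equal up to reflection and
  reduces the question to a seaweed of \<open>gl\<close> of size \<open>m\<close> (\<open>folding_radical\<close>). In that seaweed
  the blocks of size two interlock to a path, which can be stripped from its free end
  (\<open>seaweed_radical_scalar\<close>); on the remaining \<open>ab\<close> indices, arranged as \<open>b\<close> groups of \<open>a\<close>, the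
  equations are Toeplitz relations, first between the groups and then inside one group
  (\<open>core_radical_scalar\<close>). Along every edge the potential \<open>wt\<close> on the indices drops by one, so
  the principal element is, up to a scalar matrix, the diagonal matrix of the potential, and the
  multiplicities count the positions by differences of the potential.

  \<^bold>\<open>All functionals.\<close> Let \<open>p\<close> be the principal element of any Frobenius functional \<open>F\<close>. Then
  \<open>F(f(p) y) = F(y f(p + 1))\<close> for every polynomial \<open>f\<close>, so a polynomial in \<open>p\<close> that does not change
  under \<open>p \<mapsto> p + 1\<close> lies in the radical modulo scalars and hence is a scalar
  (\<open>shift_invariant_scalar\<close>). Applied to a polynomial that near each eigenvalue \<open>z\<close> agrees to high
  order with \<open>z - \<lfloor>Re z\<rfloor>\<close>, this shows that \<open>p\<close> is diagonalizable and that its eigenvalues differ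
  by integers (\<open>principal_annihilated\<close>). Now join two Frobenius functionals by a line with
  parameter \<open>t\<close>. At an integer argument the characteristic polynomial of \<open>ad p\<close> is a rational
  function of \<open>t\<close> with integer values, and it is constant because integers are countable while the
  parameters are not (\<open>char_poly_ad_independent\<close>). For semisimple \<open>ad p\<close> this polynomial determines the
  dimensions of the eigenspaces.

  \<^bold>\<open>Counting.\<close> Let \<open>W\<close> be the sum of \<open>z\<close> to the potential over the first half. The lower left
  quadrant contributes \<open>z W W\<^sup>\<or>\<close>. Of the two diagonal quadrants, one reflected onto the other, the
  union is the whole square and the intersection is the seaweed, so that together they contribute
  \<open>W W\<^sup>\<or>\<close> plus the sum over the seaweed (\<open>sum_positions\<close>). The identity holds for any character in
  place of \<open>z\<close>; the trivial character gives the dimension.\<close>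

section \<open>Polynomials in a square matrix\<close>

text \<open>Horner's scheme rather than a sum of powers: then evaluation is seen to be a ring homomorphism by
  induction along \<^const>\<open>pCons\<close>.\<close>

definition mat_poly :: "nat \<Rightarrow> complex poly \<Rightarrow> complex mat \<Rightarrow> complex mat" where
  "mat_poly n f p = fold_coeffs (\<lambda>c X. c \<cdot>\<^sub>m 1\<^sub>m n + p * X) f (0\<^sub>m n n)"

context
  fixes n :: nat and p :: "complex mat"
  assumes p: "p \<in> carrier_mat n n"
begin

lemma mat_poly_0 [simp]: "mat_poly n 0 p = 0\<^sub>m n n"
  by (simp add: mat_poly_def)

lemma mat_poly_pCons: "mat_poly n (pCons c f) p = c \<cdot>\<^sub>m 1\<^sub>m n + p * mat_poly n f p"
proof (cases "c = 0 \<and> f = 0")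
  case True
  have "0 \<cdot>\<^sub>m 1\<^sub>m n + p * 0\<^sub>m n n = 0\<^sub>m n n" using p by (intro eq_matI) auto
  then show ?thesis using True by (simp add: mat_poly_def)
next
  case False
  then show ?thesis by (auto simp: mat_poly_def fold_coeffs_pCons_not_0_0_eq fold_coeffs_pCons_coeff_not_0_eq)
qed

lemma mat_poly_carrier [simp, intro]: "mat_poly n f p \<in> carrier_mat n n"
  by (induction f) (use p in \<open>auto simp: mat_poly_pCons\<close>)

lemma dim_mat_poly [simp]: "dim_row (mat_poly n f p) = n" "dim_col (mat_poly n f p) = n"
  using carrier_matD[OF mat_poly_carrier[of f]] by simp_all

lemma mat_poly_const: "mat_poly n [:c:] p = c \<cdot>\<^sub>m 1\<^sub>m n"
  using p by (simp add: mat_poly_pCons)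

lemma mat_poly_linear: "mat_poly n [:c, 1:] p = c \<cdot>\<^sub>m 1\<^sub>m n + p"
proof -
  have "p * (1 \<cdot>\<^sub>m 1\<^sub>m n) = p" using p by (subst mult_smult_distrib[of _ n n _ n]) auto
  moreover have "c \<cdot>\<^sub>m 1\<^sub>m n + p * 0\<^sub>m n n = c \<cdot>\<^sub>m 1\<^sub>m n" for c :: complex
    using p by (intro eq_matI) auto
  ultimately show ?thesis by (simp only: mat_poly_pCons mat_poly_0)
qed

lemma mat_poly_smult: "mat_poly n (Polynomial.smult c f) p = c \<cdot>\<^sub>m mat_poly n f p"
proof (induction f)
  case 0
  then show ?case by simp
next
  case (pCons a f)
  have "mat_poly n (Polynomial.smult c (pCons a f)) p = (c * a) \<cdot>\<^sub>m 1\<^sub>m n + p * (c \<cdot>\<^sub>m mat_poly n f p)"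
    by (simp add: mat_poly_pCons pCons)
  also have "p * (c \<cdot>\<^sub>m mat_poly n f p) = c \<cdot>\<^sub>m (p * mat_poly n f p)"
    using p by (simp add: mult_smult_distrib[of _ n n _ n])
  also have "(c * a) \<cdot>\<^sub>m 1\<^sub>m n = c \<cdot>\<^sub>m (a \<cdot>\<^sub>m 1\<^sub>m n)" by (intro eq_matI) auto
  also have "c \<cdot>\<^sub>m (a \<cdot>\<^sub>m 1\<^sub>m n) + c \<cdot>\<^sub>m (p * mat_poly n f p) = c \<cdot>\<^sub>m (a \<cdot>\<^sub>m 1\<^sub>m n + p * mat_poly n f p)"
    using p by (intro add_smult_distrib_left_mat[symmetric, of _ n n]) auto
  finally show ?case by (simp add: mat_poly_pCons)
qed

lemma mat_poly_add: "mat_poly n (f + g) p = mat_poly n f p + mat_poly n g p"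
proof (induction f g rule: poly_induct2)
  case 0
  then show ?case by simp
next
  case (pCons a f b g)
  let ?F = "mat_poly n f p" and ?G = "mat_poly n g p"
  have d: "p * (?F + ?G) = p * ?F + p * ?G" using p by (intro mult_add_distrib_mat) auto
  have e: "(a + b) \<cdot>\<^sub>m (1\<^sub>m n :: complex mat) = a \<cdot>\<^sub>m 1\<^sub>m n + b \<cdot>\<^sub>m 1\<^sub>m n"
    by (intro add_smult_distrib_right_mat) auto
  have c: "p * ?F \<in> carrier_mat n n" "p * ?G \<in> carrier_mat n n" using p by auto
  show ?case unfolding add_pCons mat_poly_pCons pCons d e
    using c p by (intro eq_matI) (auto simp del: index_mult_mat(1))
qed

lemma mat_poly_mult: "mat_poly n (f * g) p = mat_poly n f p * mat_poly n g p"
proof (induction f)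
  case 0
  then show ?case by (simp add: left_mult_zero_mat[OF mat_poly_carrier])
next
  case (pCons a f)
  let ?F = "mat_poly n f p" and ?G = "mat_poly n g p"
  have "mat_poly n (pCons a f * g) p = a \<cdot>\<^sub>m ?G + (0 \<cdot>\<^sub>m 1\<^sub>m n + p * mat_poly n (f * g) p)"
    unfolding mult_pCons_left mat_poly_add mat_poly_smult mat_poly_pCons ..
  also have "0 \<cdot>\<^sub>m 1\<^sub>m n + p * mat_poly n (f * g) p = p * (?F * ?G)"
    unfolding pCons using p by (intro eq_matI) (auto simp del: index_mult_mat(1))
  also have "p * (?F * ?G) = (p * ?F) * ?G"
    using p by (intro assoc_mult_mat[symmetric, of _ n n _ n _ n]) auto
  also have "a \<cdot>\<^sub>m ?G + (p * ?F) * ?G = (a \<cdot>\<^sub>m 1\<^sub>m n + p * ?F) * ?G"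
    using p by (subst add_mult_distrib_mat[of _ n n]) (auto simp: mult_smult_assoc_mat[of _ n n _ n])
  finally show ?case by (simp add: mat_poly_pCons)
qed

lemma mat_poly_diff: "mat_poly n (f - g) p = mat_poly n f p - mat_poly n g p"
proof -
  have "f - g = f + Polynomial.smult (-1) g" by simp
  then have "mat_poly n (f - g) p = mat_poly n f p + (-1) \<cdot>\<^sub>m mat_poly n g p"
    by (metis mat_poly_add mat_poly_smult)
  also have "\<dots> = mat_poly n f p - mat_poly n g p"
    by (intro eq_matI) (auto simp: carrier_matD[OF mat_poly_carrier])
  finally show ?thesis .
qed

lemma mat_poly_commute: "mat_poly n f p * mat_poly n g p = mat_poly n g p * mat_poly n f p"
  by (metis mat_poly_mult mult.commute)

lemma mat_poly_X: "mat_poly n [:0, 1:] p = p"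
  using p by (simp add: mat_poly_linear) (intro eq_matI, auto)

lemma mat_poly_1: "mat_poly n 1 p = 1\<^sub>m n"
  unfolding one_pCons mat_poly_const by (intro eq_matI) auto

lemma mat_poly_dvd_eq_0:
  assumes "f dvd g" "mat_poly n f p = 0\<^sub>m n n"
  shows "mat_poly n g p = 0\<^sub>m n n"
  using assms by (auto simp: mat_poly_mult left_mult_zero_mat[OF mat_poly_carrier] elim!: dvdE)

text \<open>The \<open>n\<^sup>2 + 1\<close> first powers of a matrix are linearly dependent: written out as the columns of
  a square matrix with an additional zero row, they have determinant zero.\<close>

lemma annihilating_poly_exists:
  obtains f where "f \<noteq> 0" "mat_poly n f p = 0\<^sub>m n n"
proof -
  define m where "m = n * n"
  define M where "M = mat (Suc m) (Suc m) (\<lambda>(r, c). if r < m then (mat_poly n ([:0,1:] ^ c) p) $$ (r div n, r mod n) else 0)"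
  have M: "M \<in> carrier_mat (Suc m) (Suc m)" by (simp add: M_def)
  have "M = mat\<^sub>r (Suc m) (Suc m) (\<lambda>i. if i = m then 0\<^sub>v (Suc m) else row M i)"
    by (intro eq_matI) (auto simp: M_def less_Suc_eq)
  moreover have "det (mat\<^sub>r (Suc m) (Suc m) (\<lambda>i. if i = m then 0\<^sub>v (Suc m) else row M i)) = 0"
    using M by (intro det_row_0) auto
  ultimately have "det M = 0" by simp
  then obtain v where v: "v \<in> carrier_vec (Suc m)" "v \<noteq> 0\<^sub>v (Suc m)" "M *\<^sub>v v = 0\<^sub>v (Suc m)"
    using det_0_iff_vec_prod_zero[OF M] by auto
  define f where "f = (\<Sum>c<Suc m. Polynomial.smult (v $ c) ([:0,1:] ^ c))"
  have coeff: "coeff f c = v $ c" if "c < Suc m" for c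
  proof -
    have "coeff f c = (\<Sum>k<Suc m. v $ k * coeff (monom 1 k) c)"
      by (simp add: f_def coeff_sum monom_altdef del: sum.lessThan_Suc)
    also have "\<dots> = (\<Sum>k<Suc m. if k = c then v $ k else 0)"
      by (intro sum.cong) auto
    finally show ?thesis using that by (simp del: sum.lessThan_Suc)
  qed
  have "f \<noteq> 0"
  proof
    assume "f = 0"
    with coeff have "v = 0\<^sub>v (Suc m)" using v(1) by (intro eq_vecI) auto
    with v show False by simp
  qed
  moreover have "mat_poly n f p $$ (i, j) = 0" if "i < n" "j < n" for i j
  proof -
    have ind: "mat_poly n (\<Sum>c\<in>C. Polynomial.smult (v $ c) ([:0,1:] ^ c)) p $$ (i, j) =
       (\<Sum>c\<in>C. v $ c * mat_poly n ([:0,1:] ^ c) p $$ (i, j))" if "finite C" for C :: "nat set"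
      using that
    proof induction
      case (insert c C)
      then show ?case using \<open>i < n\<close> \<open>j < n\<close>
        by (simp add: mat_poly_add mat_poly_smult carrier_matD[OF mat_poly_carrier])
    qed (use that \<open>i < n\<close> \<open>j < n\<close> in simp)
    define r where "r = i * n + j"
    have "r < Suc i * n" using that by (simp add: r_def)
    also have "\<dots> \<le> m" unfolding m_def using that by (intro mult_le_mono1) simp
    finally have rm: "r < m" .
    have r: "r div n = i" "r mod n = j" using that by (auto simp: r_def)
    have "0 = (M *\<^sub>v v) $ r" using v(3) rm by simp
    also have "\<dots> = (\<Sum>c<Suc m. M $$ (r, c) * v $ c)"
      using rm M v(1) by (simp add: scalar_prod_def atLeast0LessThan del: sum.lessThan_Suc)
    also have "\<dots> = (\<Sum>c<Suc m. v $ c * mat_poly n ([:0,1:] ^ c) p $$ (i, j))"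
      using rm r by (intro sum.cong) (auto simp: M_def mult.commute)
    also have "\<dots> = mat_poly n f p $$ (i, j)" unfolding f_def by (rule ind[symmetric]) simp
    finally show ?thesis by simp
  qed
  then have "mat_poly n f p = 0\<^sub>m n n" by (intro eq_matI) (auto simp: carrier_matD[OF mat_poly_carrier])
  ultimately show ?thesis using that by blast
qed

end

section \<open>Interpolation by complex polynomials\<close>

text \<open>A complex polynomial is the product of its root factors, so divisibility may be tested at one
  root of the divisor at a time.\<close>

lemma complex_poly_dvdI:
  fixes f h :: "complex poly"
  assumes "f \<noteq> 0" and "\<And>z. poly f z = 0 \<Longrightarrow> [:-z, 1:] ^ Polynomial.order z f dvd h"
  shows "f dvd h"
proof (cases "h = 0")
  case False
  let ?P = "\<lambda>f z. [:-z, 1:] ^ Polynomial.order z f"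
  have ord: "Polynomial.order z f \<le> Polynomial.order z h" if "poly f z = 0" for z
    using assms(2)[OF that] False by (simp add: order_divides)
  have sub: "{z. poly f z = 0} \<subseteq> {z. poly h z = 0}"
  proof safe
    fix z assume "poly f z = 0"
    then have "Polynomial.order z h \<noteq> 0" using ord[of z] assms(1) by (simp add: order_root)
    then show "poly h z = 0" using False by (simp add: order_root)
  qed
  have "(\<Prod>z|poly f z = 0. ?P f z) = Polynomial.smult (1 / lead_coeff f) f"
    using assms(1) by (subst (3) complex_poly_decompose[symmetric]) simp
  then have "f dvd (\<Prod>z|poly f z = 0. ?P f z)" by (simp add: dvd_smult)
  also have "\<dots> dvd (\<Prod>z|poly f z = 0. ?P h z)"
    by (intro prod_dvd_prod le_imp_power_dvd) (use ord in auto)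
  also have "\<dots> dvd (\<Prod>z|poly h z = 0. ?P h z)"
    using False sub by (intro prod_dvd_prod_subset poly_roots_finite) auto
  also have "\<dots> dvd Polynomial.smult (lead_coeff h) (\<Prod>z|poly h z = 0. ?P h z)" by (simp add: dvd_smult)
  also have "\<dots> = h" by (rule complex_poly_decompose)
  finally show ?thesis .
qed simp

definition lagrange_basis :: "complex set \<Rightarrow> complex \<Rightarrow> complex poly" where
  "lagrange_basis L z = (\<Prod>w\<in>L - {z}. Polynomial.smult (1 / (z - w)) [:-w, 1:])"

lemma poly_lagrange_basis:
  assumes "finite L" "z \<in> L" "w \<in> L"
  shows "poly (lagrange_basis L z) w = (if w = z then 1 else 0)"
proof (cases "w = z")
  case True
  have "poly (lagrange_basis L z) w = (\<Prod>u\<in>L - {z}. 1)"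
    unfolding lagrange_basis_def poly_prod using True by (intro prod.cong) (auto simp: field_simps)
  then show ?thesis using True by simp
next
  case False
  then show ?thesis using assms
    by (auto simp: lagrange_basis_def poly_prod intro!: prod_zero bexI[of _ w])
qed

text \<open>The difference of the two sides vanishes at all nodes, and its degree is less than their number.\<close>

lemma lagrange_basis_partition_of_unity:
  assumes "finite L" "L \<noteq> {}"
  shows "(\<Sum>z\<in>L. lagrange_basis L z) = 1"
proof (rule ccontr)
  define h where "h = (\<Sum>z\<in>L. lagrange_basis L z) - 1"
  assume "\<not> ?thesis"
  then have h: "h \<noteq> 0" by (simp add: h_def)
  have "degree (lagrange_basis L z) \<le> card L - 1" if "z \<in> L" for z
  proof -
    have "degree (lagrange_basis L z) \<le> (\<Sum>w\<in>L - {z}. (degree \<circ> (\<lambda>w. Polynomial.smult (1 / (z - w)) [:-w, 1:])) w)"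
      unfolding lagrange_basis_def by (rule degree_prod_sum_le) (use assms in simp)
    also have "\<dots> \<le> (\<Sum>w\<in>L - {z}. 1)" by (intro sum_mono) simp
    also have "\<dots> = card L - 1" using that assms by simp
    finally show ?thesis .
  qed
  then have "degree h \<le> card L - 1"
    unfolding h_def by (intro degree_diff_le degree_sum_le) (use assms in auto)
  moreover have "L \<subseteq> {z. poly h z = 0}"
  proof
    fix w assume w: "w \<in> L"
    have "(\<Sum>z\<in>L. poly (lagrange_basis L z) w) = (\<Sum>z\<in>L. if z = w then 1 else 0)"
      using w assms by (intro sum.cong) (auto simp: poly_lagrange_basis)
    then show "w \<in> {z. poly h z = 0}" using w assms by (simp add: h_def poly_sum)
  qed
  then have "card L \<le> card {z. poly h z = 0}" by (intro card_mono poly_roots_finite h)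
  moreover have "card {z. poly h z = 0} \<le> degree h" using h by (rule card_poly_roots_bound)
  moreover have "card L > 0" using assms by (simp add: card_gt_0_iff)
  ultimately show False by linarith
qed

text \<open>An interpolation that is constant to order \<open>N\<close> near every node: if \<open>l\<close> is the Lagrange
  polynomial of a node, then \<open>1 - (1 - l\<^sup>N)\<^sup>N\<close> is flat of order \<open>N\<close> with the same values.\<close>

lemma flat_interpolation:
  fixes v :: "complex \<Rightarrow> complex"
  assumes L: "finite L"
  obtains g where "\<And>z. z \<in> L \<Longrightarrow> [:-z, 1:] ^ N dvd g - [:v z:]"
proof -
  define E where "E z = 1 - (1 - lagrange_basis L z ^ N) ^ N" for z
  define g where "g = (\<Sum>z\<in>L. Polynomial.smult (v z) (E z))"
  have one: "[:-z, 1:] ^ N dvd E z - 1" if "z \<in> L" "N > 0" for z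
  proof -
    have "[:-z, 1:] dvd 1 - lagrange_basis L z ^ N"
      using L that by (simp add: poly_eq_0_iff_dvd[symmetric] poly_lagrange_basis)
    then have "[:-z, 1:] ^ N dvd (1 - lagrange_basis L z ^ N) ^ N" by (rule dvd_power_same)
    then show ?thesis unfolding E_def by (simp add: dvd_diff_commute)
  qed
  have zero: "[:-w, 1:] ^ N dvd E z" if "z \<in> L" "w \<in> L" "w \<noteq> z" for z w
  proof -
    let ?l = "lagrange_basis L z ^ N"
    have "[:-w, 1:] dvd lagrange_basis L z"
      using L that by (simp add: poly_eq_0_iff_dvd[symmetric] poly_lagrange_basis)
    then have "[:-w, 1:] ^ N dvd ?l" by (rule dvd_power_same)
    also have "?l dvd E z"
    proof -
      have "1 - (1 - ?l) dvd 1 ^ N - (1 - ?l) ^ N"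
        by (subst power_diff_sumr2) simp
      then show ?thesis by (simp add: E_def)
    qed
    finally show ?thesis .
  qed
  have "[:-z, 1:] ^ N dvd g - [:v z:]" if "z \<in> L" for z
  proof (cases "N = 0")
    case False
    have "g - [:v z:] = (\<Sum>w\<in>L - {z}. Polynomial.smult (v w) (E w)) + Polynomial.smult (v z) (E z - 1)"
      unfolding g_def using that L by (subst sum.remove[of _ z]) (auto simp: smult_diff_right)
    moreover have "[:-z, 1:] ^ N dvd (\<Sum>w\<in>L - {z}. Polynomial.smult (v w) (E w))"
      using that by (intro dvd_sum dvd_smult zero) auto
    moreover have "[:-z, 1:] ^ N dvd Polynomial.smult (v z) (E z - 1)"
      using that False by (intro dvd_smult one) auto
    ultimately show ?thesis by (simp add: dvd_add)
  qed simp
  then show ?thesis using that by blast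
qed

section \<open>The adjoint action of a matrix with a separable annihilating polynomial\<close>

text \<open>At a matrix annihilated by the product over the nodes, the Lagrange polynomials give a complete
  family of projections to eigenspaces; their sum is one, so compressing from both sides loses nothing.\<close>

lemma separating_idempotents:
  assumes p: "p \<in> carrier_mat n n" and n: "n > 0" and L: "finite L"
    and zero: "mat_poly n (\<Prod>z\<in>L. [:-z, 1:]) p = 0\<^sub>m n n"
    and x: "x \<in> carrier_mat n n"
    and sep: "\<And>z w. z \<in> L \<Longrightarrow> w \<in> L \<Longrightarrow>
      mat_poly n (lagrange_basis L z) p * x * mat_poly n (lagrange_basis L w) p = 0\<^sub>m n n"
  shows "x = 0\<^sub>m n n"
proof -
  note pc = mat_poly_carrier[OF p]
  let ?e = "\<lambda>z. mat_poly n (lagrange_basis L z) p"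
  have "L \<noteq> {}"
  proof
    assume "L = {}"
    then have "(1\<^sub>m n :: complex mat) $$ (0,0) = 0\<^sub>m n n $$ (0,0)" using zero p by (simp add: mat_poly_1)
    then show False using n by simp
  qed
  note unity = lagrange_basis_partition_of_unity[OF L this]
  have left: "y = 0\<^sub>m n n" if y: "y \<in> carrier_mat n n" and e: "\<And>z. z \<in> L \<Longrightarrow> ?e z * y = 0\<^sub>m n n" for y
  proof -
    have "T \<subseteq> L \<Longrightarrow> mat_poly n (\<Sum>z\<in>T. lagrange_basis L z) p * y = 0\<^sub>m n n" if "finite T" for T
      using that
    proof induction
      case (insert z T)
      then show ?case using e[of z] y
        by (simp add: mat_poly_add[OF p] add_mult_distrib_mat[OF pc pc y])
    qed (use y p in simp)
    from this[OF L] show ?thesis using unity y by (simp add: mat_poly_1[OF p])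
  qed
  have right: "y = 0\<^sub>m n n" if y: "y \<in> carrier_mat n n" and e: "\<And>z. z \<in> L \<Longrightarrow> y * ?e z = 0\<^sub>m n n" for y
  proof -
    have "T \<subseteq> L \<Longrightarrow> y * mat_poly n (\<Sum>z\<in>T. lagrange_basis L z) p = 0\<^sub>m n n" if "finite T" for T
      using that
    proof induction
      case (insert z T)
      then show ?case using e[of z] y
        by (simp add: mat_poly_add[OF p] mult_add_distrib_mat[OF y pc pc])
    qed (use y p in simp)
    from this[OF L] show ?thesis using unity y by (simp add: mat_poly_1[OF p])
  qed
  show ?thesis
  proof (rule left[OF x])
    fix z assume "z \<in> L"
    show "?e z * x = 0\<^sub>m n n"
    proof (rule right[OF mult_carrier_mat[OF pc x]])
      fix w assume "w \<in> L"
      with \<open>z \<in> L\<close> show "?e z * x * ?e w = 0\<^sub>m n n" by (rule sep)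
    qed
  qed
qed

lemma zero_smult_mat: "M \<in> carrier_mat n m \<Longrightarrow> (0::complex) \<cdot>\<^sub>m M = 0\<^sub>m n m"
  by (intro eq_matI) auto

lemma mat_eq_if_minus_eq_0:
  fixes x y :: "complex mat"
  assumes "x - y = 0\<^sub>m n n" "x \<in> carrier_mat n n" "y \<in> carrier_mat n n"
  shows "x = y"
proof (rule eq_matI)
  fix i j assume ij: "i < dim_row y" "j < dim_col y"
  then have "(x - y) $$ (i, j) = 0" using assms(1,3) by simp
  then show "x $$ (i, j) = y $$ (i, j)" using ij assms(2,3) by simp
qed (use assms in auto)

lemma lagrange_idempotent_eigen:
  assumes p: "p \<in> carrier_mat n n" and L: "finite L"
    and zero: "mat_poly n (\<Prod>z\<in>L. [:-z, 1:]) p = 0\<^sub>m n n" and z: "z \<in> L"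
  shows "p * mat_poly n (lagrange_basis L z) p = z \<cdot>\<^sub>m mat_poly n (lagrange_basis L z) p"
    and "mat_poly n (lagrange_basis L z) p * p = z \<cdot>\<^sub>m mat_poly n (lagrange_basis L z) p"
proof -
  let ?l = "lagrange_basis L z" and ?c = "\<Prod>w\<in>L - {z}. 1 / (z - w)"
  have "[:-z, 1:] * ?l = Polynomial.smult ?c ([:-z, 1:] * (\<Prod>w\<in>L - {z}. [:-w, 1:]))"
    unfolding lagrange_basis_def prod_smult by simp
  also have "[:-z, 1:] * (\<Prod>w\<in>L - {z}. [:-w, 1:]) = (\<Prod>w\<in>L. [:-w, 1:])"
    using L z by (subst prod.remove[of L z]) auto
  finally have "mat_poly n ([:-z, 1:] * ?l) p = ?c \<cdot>\<^sub>m 0\<^sub>m n n"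
    using zero by (simp only: mat_poly_smult[OF p])
  moreover have "[:-z, 1:] * ?l = [:0, 1:] * ?l - Polynomial.smult z ?l" by simp
  ultimately have "p * mat_poly n ?l p - z \<cdot>\<^sub>m mat_poly n ?l p = 0\<^sub>m n n"
    using p by (simp only: mat_poly_diff[OF p] mat_poly_mult[OF p] mat_poly_smult[OF p] mat_poly_X[OF p] smult_zero_mat)
  then show *: "p * mat_poly n ?l p = z \<cdot>\<^sub>m mat_poly n ?l p"
    by (rule mat_eq_if_minus_eq_0) (use p mat_poly_carrier[OF p, of ?l] in auto)
  show "mat_poly n ?l p * p = z \<cdot>\<^sub>m mat_poly n ?l p"
    using mat_poly_commute[OF p, of ?l "[:0,1:]"] by (simp add: mat_poly_X[OF p] *)
qed

text \<open>On the image of an eigenprojection \<open>p\<close> is a scalar, from either side, so between two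
  eigenprojections \<open>ad p\<close> is the difference of the eigenvalues.\<close>

lemma compressed_bracket:
  assumes p: "p \<in> carrier_mat n n" and L: "finite L"
    and zero: "mat_poly n (\<Prod>z\<in>L. [:-z, 1:]) p = 0\<^sub>m n n" and zw: "z \<in> L" "w \<in> L"
    and x: "x \<in> carrier_mat n n"
  shows "mat_poly n (lagrange_basis L z) p * lie_bracket p x * mat_poly n (lagrange_basis L w) p =
    (z - w) \<cdot>\<^sub>m (mat_poly n (lagrange_basis L z) p * x * mat_poly n (lagrange_basis L w) p)"
proof -
  let ?e = "mat_poly n (lagrange_basis L z) p" and ?f = "mat_poly n (lagrange_basis L w) p"
  have e: "?e \<in> carrier_mat n n" and f: "?f \<in> carrier_mat n n" using mat_poly_carrier[OF p] by auto
  have px: "p * x \<in> carrier_mat n n" "x * p \<in> carrier_mat n n" using p x by auto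
  have exf: "?e * x * ?f \<in> carrier_mat n n" using e f x by auto
  have ex: "?e * x \<in> carrier_mat n n" using e x by auto
  have "?e * lie_bracket p x * ?f = ?e * (p * x) * ?f - ?e * (x * p) * ?f"
    unfolding lie_bracket_def mult_minus_distrib_mat[OF e px]
    by (rule minus_mult_distrib_mat[OF mult_carrier_mat[OF e px(1)] mult_carrier_mat[OF e px(2)] f])
  also have "?e * (p * x) = z \<cdot>\<^sub>m (?e * x)"
    using lagrange_idempotent_eigen(2)[OF p L zero zw(1)]
    by (simp add: assoc_mult_mat[OF e p x, symmetric] mult_smult_assoc_mat[OF e x])
  also have "z \<cdot>\<^sub>m (?e * x) * ?f = z \<cdot>\<^sub>m (?e * x * ?f)" by (rule mult_smult_assoc_mat[OF ex f])
  also have "?e * (x * p) * ?f = ?e * x * (p * ?f)"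
    by (simp add: assoc_mult_mat[OF e x p, symmetric] assoc_mult_mat[OF ex p f])
  also have "\<dots> = w \<cdot>\<^sub>m (?e * x * ?f)"
    unfolding lagrange_idempotent_eigen(1)[OF p L zero zw(2)] by (rule mult_smult_distrib[OF ex f])
  also have "z \<cdot>\<^sub>m (?e * x * ?f) - w \<cdot>\<^sub>m (?e * x * ?f) = (z - w) \<cdot>\<^sub>m (?e * x * ?f)"
    using exf by (intro eq_matI) (auto simp: left_diff_distrib simp del: index_mult_mat(1))
  finally show ?thesis .
qed

lemma smult_mat_eq_0:
  fixes c :: complex
  assumes "c \<cdot>\<^sub>m y = 0\<^sub>m n n" "y \<in> carrier_mat n n" "c \<noteq> 0"
  shows "y = 0\<^sub>m n n"
proof -
  have "y $$ (i, j) = 0" if "i < n" "j < n" for i j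
  proof -
    have "(c \<cdot>\<^sub>m y) $$ (i, j) = 0" using assms(1) that by simp
    then show ?thesis using assms(2,3) that by simp
  qed
  then show ?thesis using assms(2) by (intro eq_matI) auto
qed

lemma smult_mat_cancel:
  fixes c d :: complex
  assumes "c \<cdot>\<^sub>m y = d \<cdot>\<^sub>m y" "y \<in> carrier_mat n n" "c \<noteq> d"
  shows "y = 0\<^sub>m n n"
proof (rule smult_mat_eq_0)
  have "(c - d) \<cdot>\<^sub>m y = c \<cdot>\<^sub>m y - d \<cdot>\<^sub>m y"
    using assms(2) by (intro eq_matI) (auto simp: left_diff_distrib)
  also have "\<dots> = 0\<^sub>m n n" unfolding assms(1) using assms(2) by (intro eq_matI) auto
  finally show "(c - d) \<cdot>\<^sub>m y = 0\<^sub>m n n" .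
qed (use assms in auto)

lemma lie_bracket_carrier:
  "x \<in> carrier_mat n n \<Longrightarrow> y \<in> carrier_mat n n \<Longrightarrow> lie_bracket x y \<in> carrier_mat n n"
  by (simp add: lie_bracket_def minus_carrier_mat)

text \<open>Some compression of an eigenvector is not zero, and there \<open>ad p\<close> acts by a difference of nodes.\<close>

lemma ad_eigenvalue_difference:
  assumes p: "p \<in> carrier_mat n n" and n: "n > 0" and L: "finite L"
    and zero: "mat_poly n (\<Prod>z\<in>L. [:-z, 1:]) p = 0\<^sub>m n n"
    and x: "x \<in> carrier_mat n n" "x \<noteq> 0\<^sub>m n n" and eig: "lie_bracket p x = \<mu> \<cdot>\<^sub>m x"
  obtains z w where "z \<in> L" "w \<in> L" "\<mu> = z - w"
proof (rule ccontr)
  assume no: "\<not> thesis"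
  note pc = mat_poly_carrier[OF p]
  have "x = 0\<^sub>m n n"
  proof (rule separating_idempotents[OF p n L zero x(1)])
    fix z w assume zw: "z \<in> L" "w \<in> L"
    let ?e = "mat_poly n (lagrange_basis L z) p" and ?f = "mat_poly n (lagrange_basis L w) p"
    have "(z - w) \<cdot>\<^sub>m (?e * x * ?f) = ?e * (\<mu> \<cdot>\<^sub>m x) * ?f"
      using compressed_bracket[OF p L zero zw x(1)] eig by simp
    also have "\<dots> = \<mu> \<cdot>\<^sub>m (?e * x * ?f)"
      by (simp add: mult_smult_distrib[OF pc x(1)] mult_smult_assoc_mat[OF mult_carrier_mat[OF pc x(1)] pc])
    finally have "(z - w) \<cdot>\<^sub>m (?e * x * ?f) = \<mu> \<cdot>\<^sub>m (?e * x * ?f)" .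
    moreover have "?e * x * ?f \<in> carrier_mat n n" by (rule mult_carrier_mat[OF mult_carrier_mat[OF pc x(1)] pc])
    moreover have "z - w \<noteq> \<mu>" using no that zw by blast
    ultimately show "?e * x * ?f = 0\<^sub>m n n"
      by (rule smult_mat_cancel)
  qed
  with x show False by simp
qed

text \<open>A generalized eigenvector of \<open>ad p\<close> is an eigenvector: compress \<open>[p, x] - k x\<close> between the projections
  for \<open>z\<close> and \<open>w\<close>. If \<open>z - w = k\<close> then the compression is zero by its definition, and otherwise because
  it is an eigenvector for both \<open>z - w\<close> and \<open>k\<close>.\<close>

lemma ad_semisimple:
  assumes p: "p \<in> carrier_mat n n" and n: "n > 0" and L: "finite L"
    and zero: "mat_poly n (\<Prod>z\<in>L. [:-z, 1:]) p = 0\<^sub>m n n"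
    and x: "x \<in> carrier_mat n n"
    and sq: "lie_bracket p (lie_bracket p x - k \<cdot>\<^sub>m x) = k \<cdot>\<^sub>m (lie_bracket p x - k \<cdot>\<^sub>m x)"
  shows "lie_bracket p x = k \<cdot>\<^sub>m x"
proof -
  note pc = mat_poly_carrier[OF p]
  define y where "y = lie_bracket p x - k \<cdot>\<^sub>m x"
  have b: "lie_bracket p x \<in> carrier_mat n n" using lie_bracket_carrier[OF p x] .
  have y: "y \<in> carrier_mat n n" using b x by (simp add: y_def minus_carrier_mat)
  have "y = 0\<^sub>m n n"
  proof (rule separating_idempotents[OF p n L zero y])
    fix z w assume zw: "z \<in> L" "w \<in> L"
    let ?e = "mat_poly n (lagrange_basis L z) p" and ?f = "mat_poly n (lagrange_basis L w) p"
    have c: "?e * x * ?f \<in> carrier_mat n n" "?e * y * ?f \<in> carrier_mat n n"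
      using mult_carrier_mat[OF mult_carrier_mat[OF pc x] pc] mult_carrier_mat[OF mult_carrier_mat[OF pc y] pc] by auto
    have kx: "k \<cdot>\<^sub>m x \<in> carrier_mat n n" using x by simp
    have s: "?e * (k \<cdot>\<^sub>m u) * ?f = k \<cdot>\<^sub>m (?e * u * ?f)" if "u \<in> carrier_mat n n" for u
      by (simp add: mult_smult_distrib[OF pc that] mult_smult_assoc_mat[OF mult_carrier_mat[OF pc that] pc])
    have "?e * y * ?f = ?e * lie_bracket p x * ?f - ?e * (k \<cdot>\<^sub>m x) * ?f"
      unfolding y_def mult_minus_distrib_mat[OF pc b kx]
      by (rule minus_mult_distrib_mat[OF mult_carrier_mat[OF pc b] mult_carrier_mat[OF pc kx] pc])
    also have "\<dots> = (z - w) \<cdot>\<^sub>m (?e * x * ?f) - k \<cdot>\<^sub>m (?e * x * ?f)"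
      using compressed_bracket[OF p L zero zw x] s[OF x] by simp
    also have "\<dots> = (z - w - k) \<cdot>\<^sub>m (?e * x * ?f)"
      using c by (intro eq_matI) (auto simp: left_diff_distrib simp del: index_mult_mat(1))
    finally have 1: "?e * y * ?f = (z - w - k) \<cdot>\<^sub>m (?e * x * ?f)" .
    have 2: "(z - w) \<cdot>\<^sub>m (?e * y * ?f) = k \<cdot>\<^sub>m (?e * y * ?f)"
      using compressed_bracket[OF p L zero zw y] sq s[OF y] by (simp add: y_def)
    show "?e * y * ?f = 0\<^sub>m n n"
    proof (cases "z - w = k")
      case True
      then have "?e * y * ?f = 0 \<cdot>\<^sub>m (?e * x * ?f)" using 1 by simp
      then show ?thesis using zero_smult_mat[OF c(1)] by simp
    next
      case False
      then show ?thesis by (rule smult_mat_cancel[OF 2 c(2)])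
    qed
  qed
  then show ?thesis unfolding y_def by (rule mat_eq_if_minus_eq_0) (use b x in auto)
qed

section \<open>Traceless parts of associative matrix algebras\<close>

definition mat_tr :: "nat \<Rightarrow> complex mat \<Rightarrow> complex" where
  "mat_tr n x = (\<Sum>i<n. x $$ (i, i))"

definition traceless :: "nat \<Rightarrow> complex mat set \<Rightarrow> complex mat set" where
  "traceless n A = {x \<in> A. mat_tr n x = 0}"

lemma mat_tr_add: "x \<in> carrier_mat n n \<Longrightarrow> y \<in> carrier_mat n n \<Longrightarrow> mat_tr n (x + y) = mat_tr n x + mat_tr n y"
  by (simp add: mat_tr_def sum.distrib)

lemma mat_tr_smult: "x \<in> carrier_mat n n \<Longrightarrow> mat_tr n (c \<cdot>\<^sub>m x) = c * mat_tr n x"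
  by (simp add: mat_tr_def sum_distrib_left)

lemma mat_tr_one: "mat_tr n (1\<^sub>m n) = of_nat n"
  by (simp add: mat_tr_def)

lemma mat_tr_mult_commute:
  assumes x: "x \<in> carrier_mat n n" and y: "y \<in> carrier_mat n n"
  shows "mat_tr n (x * y) = mat_tr n (y * x)"
proof -
  have "mat_tr n (x * y) = (\<Sum>i<n. \<Sum>j<n. x $$ (i, j) * y $$ (j, i))"
    using x y by (simp add: mat_tr_def scalar_prod_def atLeast0LessThan)
  also have "\<dots> = (\<Sum>j<n. \<Sum>i<n. y $$ (j, i) * x $$ (i, j))"
    by (subst sum.swap) (simp add: mult.commute)
  also have "\<dots> = mat_tr n (y * x)"
    using x y by (simp add: mat_tr_def scalar_prod_def atLeast0LessThan)
  finally show ?thesis .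
qed

lemma mat_minus_eq_add_smult:
  fixes x y :: "complex mat"
  assumes "x \<in> carrier_mat n n" "y \<in> carrier_mat n n"
  shows "x - y = x + (-1) \<cdot>\<^sub>m y"
  using assms by (intro eq_matI) auto

lemma mat_tr_lie_bracket:
  assumes "x \<in> carrier_mat n n" "y \<in> carrier_mat n n"
  shows "mat_tr n (lie_bracket x y) = 0"
proof -
  have "lie_bracket x y = x * y + (-1) \<cdot>\<^sub>m (y * x)"
    unfolding lie_bracket_def using assms by (intro mat_minus_eq_add_smult) auto
  then show ?thesis using assms
    by (simp add: mat_tr_add[OF mult_carrier_mat smult_carrier_mat[OF mult_carrier_mat]] mat_tr_smult[OF mult_carrier_mat]
        mat_tr_mult_commute[of y n x])
qed

lemma lie_bracket_add_scalar:
  assumes x: "x \<in> carrier_mat n n" and y: "y \<in> carrier_mat n n"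
  shows "lie_bracket x (y + c \<cdot>\<^sub>m 1\<^sub>m n) = lie_bracket x y"
    and "lie_bracket (x + c \<cdot>\<^sub>m 1\<^sub>m n) y = lie_bracket x y"
proof -
  have one: "c \<cdot>\<^sub>m 1\<^sub>m n \<in> carrier_mat n n" by simp
  have 1: "u * (c \<cdot>\<^sub>m 1\<^sub>m n) = c \<cdot>\<^sub>m u" "c \<cdot>\<^sub>m 1\<^sub>m n * u = c \<cdot>\<^sub>m u" if "u \<in> carrier_mat n n" for u
    using that by (simp_all add: mult_smult_distrib[OF that one_carrier_mat] mult_smult_assoc_mat[OF one_carrier_mat that])
  have c: "x * y \<in> carrier_mat n n" "y * x \<in> carrier_mat n n" using x y by auto
  show "lie_bracket x (y + c \<cdot>\<^sub>m 1\<^sub>m n) = lie_bracket x y"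
    unfolding lie_bracket_def mult_add_distrib_mat[OF x y one] add_mult_distrib_mat[OF y one x] 1[OF x]
    using x y c by (intro eq_matI) (auto simp del: index_mult_mat(1))
  show "lie_bracket (x + c \<cdot>\<^sub>m 1\<^sub>m n) y = lie_bracket x y"
    unfolding lie_bracket_def mult_add_distrib_mat[OF y x one] add_mult_distrib_mat[OF x one y] 1[OF y]
    using x y c by (intro eq_matI) (auto simp del: index_mult_mat(1))
qed

locale unital_matrix_algebra =
  fixes n :: nat and A :: "complex mat set"
  assumes size: "n > 0"
    and carrier: "A \<subseteq> carrier_mat n n"
    and one: "1\<^sub>m n \<in> A"
    and add: "x \<in> A \<Longrightarrow> y \<in> A \<Longrightarrow> x + y \<in> A"
    and smult: "x \<in> A \<Longrightarrow> c \<cdot>\<^sub>m x \<in> A"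
    and mult: "x \<in> A \<Longrightarrow> y \<in> A \<Longrightarrow> x * y \<in> A"
begin

lemma dim: "x \<in> A \<Longrightarrow> x \<in> carrier_mat n n"
  using carrier by auto

lemma minus: "x \<in> A \<Longrightarrow> y \<in> A \<Longrightarrow> x - y \<in> A"
  using add smult mat_minus_eq_add_smult[OF dim dim] by metis

lemma bracket: "x \<in> A \<Longrightarrow> y \<in> A \<Longrightarrow> lie_bracket x y \<in> traceless n A"
  using minus mult mat_tr_lie_bracket[OF dim dim] by (simp add: traceless_def lie_bracket_def)

lemma traceless_lie_subalgebra: "lie_subalgebra n (traceless n A)"
proof -
  have "0\<^sub>m n n = 0 \<cdot>\<^sub>m (1\<^sub>m n :: complex mat)" by (intro eq_matI) auto
  then have "0\<^sub>m n n \<in> A" using smult[OF one, of 0] by simp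
  moreover have "mat_tr n (0\<^sub>m n n) = 0" by (simp add: mat_tr_def)
  ultimately have "submodule class_ring (traceless n A) (module_mat TYPE(complex) n n)"
    using dim add smult vectorspace.axioms(1)[OF matrix_vs[of n n, where 'a = complex]]
    by (auto simp: submodule_def module_mat_simps class_ring_simps traceless_def mat_tr_add mat_tr_smult)
  then show ?thesis using bracket
    by (auto simp: lie_subalgebra_def VectorSpace.subspace_def matrix_vs traceless_def)
qed

lemma mat_poly_mem:
  assumes "p \<in> A" shows "mat_poly n f p \<in> A"
proof (induction f)
  case 0
  have "0\<^sub>m n n = 0 \<cdot>\<^sub>m (1\<^sub>m n :: complex mat)" by (intro eq_matI) auto
  then show ?case using smult[OF one, of 0] dim[OF assms] by simp
next
  case (pCons c f)
  then show ?case using assms by (simp add: mat_poly_pCons[OF dim] add smult one mult)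
qed

definition traceless_part :: "complex mat \<Rightarrow> complex mat" where
  "traceless_part y = y + (- (mat_tr n y / of_nat n)) \<cdot>\<^sub>m 1\<^sub>m n"

lemma traceless_part_mem: "y \<in> A \<Longrightarrow> traceless_part y \<in> traceless n A"
  using size by (auto simp: traceless_def traceless_part_def add smult one dim mat_tr_add mat_tr_smult mat_tr_one)

text \<open>Scalar matrices are central, so brackets do not see the projection to the traceless part. This
  is what allows a functional on the traceless part to be studied on the associative algebra.\<close>

lemma bracket_traceless_part:
  assumes "x \<in> A" "y \<in> A"
  shows "lie_bracket x (traceless_part y) = lie_bracket x y"
    "lie_bracket (traceless_part x) y = lie_bracket x y"
  unfolding traceless_part_def by (intro lie_bracket_add_scalar dim assms)+

lemma traceless_part_id: "y \<in> traceless n A \<Longrightarrow> traceless_part y = y"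
  using dim by (auto simp: traceless_def traceless_part_def zero_smult_mat[OF one_carrier_mat])

end

section \<open>Principal elements are semisimple with integral differences of eigenvalues\<close>

locale frobenius_matrix_algebra = unital_matrix_algebra +
  fixes F p
  assumes frobenius: "frobenius_functional n (traceless n A) F"
    and p_mem: "p \<in> traceless n A"
    and principal: "x \<in> traceless n A \<Longrightarrow> F (lie_bracket p x) = F x"
begin

lemma F_linear: "linear_functional (traceless n A) F"
  using frobenius by (simp add: frobenius_functional_def)

text \<open>The extension of \<open>F\<close> to the associative algebra that vanishes on scalar matrices; it can be
  applied to products.\<close>

definition Fhat :: "complex mat \<Rightarrow> complex" where
  "Fhat y = F (traceless_part y)"

lemma Fhat_add:
  assumes "x \<in> A" "y \<in> A" shows "Fhat (x + y) = Fhat x + Fhat y"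
proof -
  have "traceless_part (x + y) = traceless_part x + traceless_part y"
    using dim[OF assms(1)] dim[OF assms(2)]
    by (intro eq_matI) (auto simp: traceless_part_def mat_tr_add[of _ n] add_divide_distrib)
  then show ?thesis using F_linear traceless_part_mem assms by (simp add: Fhat_def linear_functional_def)
qed

lemma Fhat_smult:
  assumes "x \<in> A" shows "Fhat (c \<cdot>\<^sub>m x) = c * Fhat x"
proof -
  have "traceless_part (c \<cdot>\<^sub>m x) = c \<cdot>\<^sub>m traceless_part x"
    using dim[OF assms] by (intro eq_matI) (auto simp: traceless_part_def mat_tr_smult[of _ n] right_diff_distrib)
  then show ?thesis using F_linear traceless_part_mem assms by (simp add: Fhat_def linear_functional_def)
qed

lemma Fhat_mult_commute:
  assumes x: "x \<in> A" and y: "y \<in> A"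
  shows "Fhat (x * y) = Fhat (y * x) + F (lie_bracket x y)"
proof -
  have "x * y = y * x + lie_bracket x y"
    using dim[OF x] dim[OF y] by (intro eq_matI) (auto simp: lie_bracket_def simp del: index_mult_mat(1))
  moreover have "lie_bracket x y \<in> A" using bracket[OF x y] by (simp add: traceless_def)
  ultimately have "Fhat (x * y) = Fhat (y * x) + Fhat (lie_bracket x y)"
    using Fhat_add[of "y * x"] mult[OF y x] by simp
  then show ?thesis by (simp add: Fhat_def traceless_part_id[OF bracket[OF x y]])
qed

lemma pA: "p \<in> A" and p_dim: "p \<in> carrier_mat n n"
  using p_mem dim by (auto simp: traceless_def)

lemma Fhat_principal:
  assumes y: "y \<in> A" shows "Fhat (p * y) = Fhat (y * p) + Fhat y"
  using Fhat_mult_commute[OF pA y] bracket_traceless_part(1)[OF pA y] principal[OF traceless_part_mem[OF y]]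
  by (simp add: Fhat_def)

text \<open>For \<open>f(z) = z\<close> this says \<open>F(p y) = F(y p) + F(y)\<close>, the defining property of the principal
  element; passing one factor \<open>p\<close> at a time from left to right replaces it by \<open>p + 1\<close>.\<close>

lemma Fhat_shift:
  assumes "y \<in> A"
  shows "Fhat (mat_poly n f p * y) = Fhat (y * mat_poly n (f \<circ>\<^sub>p [:1, 1:]) p)"
  using assms
proof (induction f arbitrary: y)
  case 0
  then show ?case using dim[of y] by (simp add: mat_poly_0[OF p_dim])
next
  case (pCons c f)
  note c = mat_poly_carrier[OF p_dim]
  let ?f = "mat_poly n f p" and ?g = "mat_poly n (f \<circ>\<^sub>p [:1, 1:]) p"
  have y: "y \<in> carrier_mat n n" using pCons.prems dim by auto
  have mem: "?f \<in> A" "?g \<in> A" by (rule mat_poly_mem[OF pA])+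
  have one_y: "c \<cdot>\<^sub>m 1\<^sub>m n * y = c \<cdot>\<^sub>m y" "y * (c \<cdot>\<^sub>m 1\<^sub>m n) = c \<cdot>\<^sub>m y"
    using y by (simp_all add: mult_smult_distrib[OF y one_carrier_mat] mult_smult_assoc_mat[OF one_carrier_mat y])
  have "mat_poly n (pCons c f) p * y = c \<cdot>\<^sub>m y + p * (?f * y)"
    unfolding mat_poly_pCons[OF p_dim]
    using add_mult_distrib_mat[OF smult_carrier_mat[OF one_carrier_mat] mult_carrier_mat[OF p_dim c] y]
    by (simp add: one_y assoc_mult_mat[OF p_dim c y])
  then have "Fhat (mat_poly n (pCons c f) p * y) = c * Fhat y + Fhat (p * (?f * y))"
    using pCons.prems mem pA by (simp add: Fhat_add Fhat_smult mult smult)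
  also have "Fhat (p * (?f * y)) = Fhat (?f * (y * p)) + Fhat (?f * y)"
    using pCons.prems mem pA by (simp add: Fhat_principal mult assoc_mult_mat[OF c y p_dim])
  also have "\<dots> = Fhat (y * p * ?g) + Fhat (y * ?g)"
    using pCons.IH[of y] pCons.IH[of "y * p"] pCons.prems pA by (simp add: mult)
  finally have 1: "Fhat (mat_poly n (pCons c f) p * y) = c * Fhat y + (Fhat (y * p * ?g) + Fhat (y * ?g))" .
  have "pCons c f \<circ>\<^sub>p [:1, 1:] = [:c:] + (pCons 0 (f \<circ>\<^sub>p [:1, 1:]) + (f \<circ>\<^sub>p [:1, 1:]))"
    by (simp add: pcompose_pCons)
  then have "mat_poly n (pCons c f \<circ>\<^sub>p [:1, 1:]) p = c \<cdot>\<^sub>m 1\<^sub>m n + (p * ?g + ?g)"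
    by (simp only: mat_poly_add[OF p_dim] mat_poly_const[OF p_dim])
       (simp add: mat_poly_pCons[OF p_dim] zero_smult_mat[OF one_carrier_mat] left_add_zero_mat[OF mult_carrier_mat[OF p_dim c]])
  then have "y * mat_poly n (pCons c f \<circ>\<^sub>p [:1, 1:]) p = c \<cdot>\<^sub>m y + (y * p * ?g + y * ?g)"
    using mult_add_distrib_mat[OF y smult_carrier_mat[OF one_carrier_mat] add_carrier_mat[OF c, of "p * ?g"]]
      mult_add_distrib_mat[OF y mult_carrier_mat[OF p_dim c] c]
    by (simp add: one_y assoc_mult_mat[OF y p_dim c])
  then show ?case using 1 pCons.prems mem pA by (simp add: Fhat_add Fhat_smult mult smult add)
qed

text \<open>By the shift rule such a matrix commutes with everything under \<open>F\<close>, so its traceless part is in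
  the radical of the Kirillov form.\<close>

lemma shift_invariant_scalar:
  assumes f: "mat_poly n (f \<circ>\<^sub>p [:1, 1:]) p = mat_poly n f p"
  obtains c where "mat_poly n f p = c \<cdot>\<^sub>m 1\<^sub>m n"
proof -
  let ?u = "mat_poly n f p"
  have u: "?u \<in> A" by (rule mat_poly_mem[OF pA])
  have "F (lie_bracket (traceless_part ?u) y) = 0" if "y \<in> traceless n A" for y
  proof -
    have y: "y \<in> A" using that by (simp add: traceless_def)
    then show ?thesis using Fhat_shift[OF y, of f] f Fhat_mult_commute[OF u y] bracket_traceless_part(2)[OF u y]
      by simp
  qed
  then have z: "traceless_part ?u = 0\<^sub>m n n"
    using frobenius traceless_part_mem[OF u] by (auto simp: frobenius_functional_def kirillov_form_def)
  define c where "c = mat_tr n ?u / of_nat n"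
  have "?u = traceless_part ?u + c \<cdot>\<^sub>m 1\<^sub>m n"
    using dim[OF u] by (intro eq_matI) (auto simp: traceless_part_def c_def)
  then show ?thesis using z that[of c] by simp
qed

text \<open>Interpolation yields \<open>g\<close> that near every eigenvalue \<open>z\<close> of \<open>p\<close> and of \<open>p + 1\<close> agrees with the
  constant \<open>\<lfloor>Re z\<rfloor>\<close> up to an order that \<open>p\<close> cannot detect. Since the floor of the real part grows by
  one under \<open>z \<mapsto> z + 1\<close>, the matrix \<open>p - g(p)\<close> is invariant under the shift, hence a scalar \<open>c\<close>. As
  \<open>g(p)\<close> is annihilated by the product of all \<open>z - k\<close> with \<open>k\<close> among these integers, \<open>p\<close> is annihilated
  by a polynomial with simple roots in \<open>c + \<int>\<close>.\<close>

lemma principal_annihilated: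
  obtains L c where "finite L" "\<And>z. z \<in> L \<Longrightarrow> \<exists>k::int. z = c + of_int k"
    "mat_poly n (\<Prod>z\<in>L. [:-z, 1:]) p = 0\<^sub>m n n"
proof -
  obtain f where f: "f \<noteq> 0" "mat_poly n f p = 0\<^sub>m n n" by (rule annihilating_poly_exists[OF p_dim])
  define R where "R = {z. poly f z = 0}"
  define N where "N = degree f"
  define v :: "complex \<Rightarrow> complex" where "v z = of_int \<lfloor>Re z\<rfloor>" for z
  have R: "finite R" unfolding R_def using f(1) by (rule poly_roots_finite)
  have "finite (R \<union> (\<lambda>z. z + 1) ` R)" using R by simp
  then obtain g where g: "\<And>z. z \<in> R \<union> (\<lambda>z. z + 1) ` R \<Longrightarrow> [:-z, 1:] ^ N dvd g - [:v z:]"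
    by (rule flat_interpolation[where v = v and N = N]) blast
  have dvdI: "f dvd h" if "\<And>z. z \<in> R \<Longrightarrow> [:-z, 1:] ^ N dvd h" for h
  proof (rule complex_poly_dvdI[OF f(1)])
    fix z assume z: "poly f z = 0"
    have "[:-z, 1:] ^ Polynomial.order z f dvd [:-z, 1:] ^ N"
      unfolding N_def by (intro le_imp_power_dvd order_degree f(1))
    also have "\<dots> dvd h" using that z by (simp add: R_def)
    finally show "[:-z, 1:] ^ Polynomial.order z f dvd h" .
  qed
  define u where "u = [:0, 1:] - g"
  have "f dvd u \<circ>\<^sub>p [:1, 1:] - u"
  proof (rule dvdI)
    fix z assume z: "z \<in> R"
    have pow: "q ^ k \<circ>\<^sub>p r = (q \<circ>\<^sub>p r) ^ k" for q r :: "complex poly" and k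
      by (induction k) (simp_all add: pcompose_mult pcompose_1)
    have "[:-(z + 1), 1:] ^ N dvd g - [:v (z + 1):]" using z by (intro g) auto
    then obtain h where h: "g - [:v (z + 1):] = [:-(z + 1), 1:] ^ N * h" by (rule dvdE)
    have "(g - [:v (z + 1):]) \<circ>\<^sub>p [:1, 1:] = ([:-(z + 1), 1:] \<circ>\<^sub>p [:1, 1:]) ^ N * (h \<circ>\<^sub>p [:1, 1:])"
      unfolding h by (simp only: pcompose_mult pow)
    also have "[:-(z + 1), 1:] \<circ>\<^sub>p [:1, 1:] = [:-z, 1:]" by (simp add: pcompose_pCons)
    also have "(g - [:v (z + 1):]) \<circ>\<^sub>p [:1, 1:] = g \<circ>\<^sub>p [:1, 1:] - [:v z:] - 1"
      by (simp add: pcompose_diff v_def one_pCons)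
    finally have "[:-z, 1:] ^ N dvd g \<circ>\<^sub>p [:1, 1:] - [:v z:] - 1" by simp
    moreover have "[:-z, 1:] ^ N dvd g - [:v z:]" using z by (intro g) auto
    ultimately have "[:-z, 1:] ^ N dvd (g - [:v z:]) - (g \<circ>\<^sub>p [:1, 1:] - [:v z:] - 1)" by (rule dvd_diff[rotated])
    also have "\<dots> = u \<circ>\<^sub>p [:1, 1:] - u"
      by (simp add: u_def pcompose_diff pcompose_pCons one_pCons)
    finally show "[:-z, 1:] ^ N dvd u \<circ>\<^sub>p [:1, 1:] - u" .
  qed
  then have "mat_poly n (u \<circ>\<^sub>p [:1, 1:] - u) p = 0\<^sub>m n n" using f(2) by (rule mat_poly_dvd_eq_0[OF p_dim])
  then have "mat_poly n (u \<circ>\<^sub>p [:1, 1:]) p = mat_poly n u p"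
    by (intro mat_eq_if_minus_eq_0[OF _ mat_poly_carrier[OF p_dim] mat_poly_carrier[OF p_dim]])
       (simp add: mat_poly_diff[OF p_dim])
  then obtain c where c: "mat_poly n u p = c \<cdot>\<^sub>m 1\<^sub>m n" by (rule shift_invariant_scalar)
  define K where "K = (\<lambda>z. \<lfloor>Re z\<rfloor>) ` R"
  have K: "finite K" using R by (simp add: K_def)
  have "f dvd (\<Prod>k\<in>K. g - [:of_int k:])"
  proof (rule dvdI)
    fix z assume z: "z \<in> R"
    then have "[:-z, 1:] ^ N dvd g - [:v z:]" by (intro g) auto
    also have "\<dots> dvd (\<Prod>k\<in>K. g - [:of_int k:])"
      unfolding v_def using K z by (intro dvd_prodI[of K "\<lfloor>Re z\<rfloor>"]) (auto simp: K_def)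
    finally show "[:-z, 1:] ^ N dvd (\<Prod>k\<in>K. g - [:of_int k:])" .
  qed
  then have Q: "mat_poly n (\<Prod>k\<in>K. g - [:of_int k:]) p = 0\<^sub>m n n" using f(2) by (rule mat_poly_dvd_eq_0[OF p_dim])
  have factor: "mat_poly n [:-(c + of_int k), 1:] p = mat_poly n (g - [:of_int k:]) p" for k :: int
  proof -
    have "[:-(c + of_int k), 1:] = (g - [:of_int k:]) + (u - [:c:])" by (simp add: u_def)
    then have "mat_poly n [:-(c + of_int k), 1:] p = mat_poly n (g - [:of_int k:]) p + (c \<cdot>\<^sub>m 1\<^sub>m n - c \<cdot>\<^sub>m 1\<^sub>m n)"
      by (simp only: mat_poly_add[OF p_dim] mat_poly_diff[OF p_dim, of u] c mat_poly_const[OF p_dim])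
    also have "c \<cdot>\<^sub>m 1\<^sub>m n - c \<cdot>\<^sub>m 1\<^sub>m n = (0\<^sub>m n n :: complex mat)" by (intro eq_matI) auto
    finally show ?thesis using right_add_zero_mat[OF mat_poly_carrier[OF p_dim]] by simp
  qed
  have "mat_poly n (\<Prod>k\<in>T. [:-(c + of_int k), 1:]) p = mat_poly n (\<Prod>k\<in>T. g - [:of_int k:]) p"
    if "finite T" for T :: "int set"
    using that
  proof induction
    case (insert k T)
    then show ?case by (simp only: prod.insert mat_poly_mult[OF p_dim] factor simp_thms)
  qed simp
  from this[OF K] have "mat_poly n (\<Prod>k\<in>K. [:-(c + of_int k), 1:]) p = 0\<^sub>m n n" using Q by simp
  moreover have "(\<Prod>z\<in>(\<lambda>k. c + of_int k) ` K. [:-z, 1:]) = (\<Prod>k\<in>K. [:-(c + of_int k), 1:])"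
    by (subst prod.reindex) (auto simp: inj_on_def)
  ultimately show ?thesis using that[of "(\<lambda>k. c + of_int k) ` K" c] K by auto
qed

theorem principal_ad_integral:
  assumes x: "x \<in> carrier_mat n n" "x \<noteq> 0\<^sub>m n n" and eig: "lie_bracket p x = \<mu> \<cdot>\<^sub>m x"
  shows "\<mu> \<in> \<int>"
proof -
  obtain L c where L: "finite L" "\<And>z. z \<in> L \<Longrightarrow> \<exists>k::int. z = c + of_int k"
    "mat_poly n (\<Prod>z\<in>L. [:-z, 1:]) p = 0\<^sub>m n n"
    using principal_annihilated by blast
  obtain z w where zw: "z \<in> L" "w \<in> L" "\<mu> = z - w"
    by (rule ad_eigenvalue_difference[OF p_dim size L(1,3) x eig])
  obtain k l :: int where "z = c + of_int k" "w = c + of_int l" using L(2) zw by metis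
  then have "\<mu> = of_int (k - l)" using zw by simp
  then show ?thesis by simp
qed

theorem principal_ad_semisimple:
  assumes "x \<in> carrier_mat n n"
    and "lie_bracket p (lie_bracket p x - k \<cdot>\<^sub>m x) = k \<cdot>\<^sub>m (lie_bracket p x - k \<cdot>\<^sub>m x)"
  shows "lie_bracket p x = k \<cdot>\<^sub>m x"
proof -
  obtain L c where L: "finite L" "\<And>z. z \<in> L \<Longrightarrow> \<exists>k::int. z = c + of_int k"
    "mat_poly n (\<Prod>z\<in>L. [:-z, 1:]) p = 0\<^sub>m n n"
    using principal_annihilated by blast
  show ?thesis by (rule ad_semisimple[OF p_dim size L(1,3) assms])
qed

end

section \<open>Dimensions and characteristic polynomials\<close>

lemma mat_subspace_dim_eq:
  fixes T :: "complex vec \<Rightarrow> complex mat"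
  assumes U: "vectorspace class_ring (module_vec TYPE(complex) d\<lparr>carrier := U\<rparr>)"
    and fin: "vectorspace.fin_dim class_ring (module_vec TYPE(complex) d\<lparr>carrier := U\<rparr>)"
    and W: "VectorSpace.subspace class_ring W (module_mat TYPE(complex) n n)"
    and bij: "bij_betw T U W"
    and add: "\<And>u v. u \<in> U \<Longrightarrow> v \<in> U \<Longrightarrow> T (u + v) = T u + T v"
    and smult: "\<And>c u. u \<in> U \<Longrightarrow> T (c \<cdot>\<^sub>v u) = c \<cdot>\<^sub>m T u"
  shows "mat_subspace_dim n W = vectorspace.dim class_ring (module_vec TYPE(complex) d\<lparr>carrier := U\<rparr>)"
proof -
  let ?U = "module_vec TYPE(complex) d\<lparr>carrier := U\<rparr>"
  let ?W = "module_mat TYPE(complex) n n\<lparr>carrier := W\<rparr>"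
  have "vectorspace class_ring ?W" using vectorspace.subspace_is_vs[OF matrix_vs W] .
  moreover have "T \<in> LinearCombinations.module_hom class_ring ?U ?W"
    using bij add smult by (auto simp: LinearCombinations.module_hom_def module_vec_simps module_mat_simps bij_betw_def)
  ultimately have "linear_map class_ring ?U ?W T"
    using U by (simp add: linear_map_def mod_hom_def mod_hom_axioms_def vectorspace_def)
  then have "vectorspace.dim class_ring ?U = vectorspace.dim class_ring ?W"
    using fin bij by (intro linear_map.dim_eq) (auto simp: bij_betw_def)
  then show ?thesis by (simp add: mat_subspace_dim_def)
qed

lemma mat_subspace_dim_eq_kernel_dim:
  assumes M: "M \<in> carrier_mat d d"
    and W: "VectorSpace.subspace class_ring W (module_mat TYPE(complex) n n)"
    and bij: "bij_betw T (mat_kernel M) W"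
    and add: "\<And>u v. u \<in> carrier_vec d \<Longrightarrow> v \<in> carrier_vec d \<Longrightarrow> T (u + v) = T u + T v"
    and smult: "\<And>c u. u \<in> carrier_vec d \<Longrightarrow> T (c \<cdot>\<^sub>v u) = c \<cdot>\<^sub>m T u"
  shows "mat_subspace_dim n W = kernel_dim M"
proof -
  interpret kernel d d M using M by unfold_locales
  obtain B where "finite B" "Ker.basis B" using kernel_basis_exists[OF M] by auto
  then have "Ker.fin_dim" by (auto simp: Ker.basis_def Ker.fin_dim_def)
  then show ?thesis
    using mat_subspace_dim_eq[OF Ker.vectorspace_axioms _ W bij] add smult mat_kernelD[OF M] by simp
qed

lemma mat_subspace_dim_eq_card:
  assumes W: "VectorSpace.subspace class_ring W (module_mat TYPE(complex) n n)"
    and bij: "bij_betw T (carrier_vec d) W"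
    and add: "\<And>u v. u \<in> carrier_vec d \<Longrightarrow> v \<in> carrier_vec d \<Longrightarrow> T (u + v) = T u + T v"
    and smult: "\<And>c u. u \<in> carrier_vec d \<Longrightarrow> T (c \<cdot>\<^sub>v u) = c \<cdot>\<^sub>m T u"
  shows "mat_subspace_dim n W = d"
proof -
  have eq: "module_vec TYPE(complex) d\<lparr>carrier := carrier_vec d\<rparr> = module_vec TYPE(complex) d"
    by (simp add: module_vec_def)
  have "mat_subspace_dim n W = vectorspace.dim class_ring (module_vec TYPE(complex) d)"
    by (rule mat_subspace_dim_eq[where d = d and U = "carrier_vec d", unfolded eq, OF vec_vs vec_space.fin_dim W bij add smult])
  then show ?thesis by (simp add: vec_space.dim_is_n)
qed

text \<open>If squaring does not enlarge the kernel, then all Jordan blocks for \<open>k\<close> have size one, so the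
  algebraic and the geometric multiplicity agree.\<close>

lemma order_char_poly_eq_kernel_dim:
  fixes A :: "complex mat"
  assumes A: "A \<in> carrier_mat d d"
    and ker: "mat_kernel (char_matrix A k ^\<^sub>m 2) = mat_kernel (char_matrix A k)"
  shows "Polynomial.order k (char_poly A) = kernel_dim (char_matrix A k)"
proof -
  obtain as where "char_poly A = (\<Prod>a\<leftarrow>as. [:- a, 1:])" using char_poly_factorized[OF A] by blast
  then obtain n_as where jnf: "jordan_nf A n_as" using jordan_nf_exists[OF A] by blast
  define ns where "ns = map fst (filter (\<lambda>na. snd na = k) n_as)"
  have ns: "map fst (filter (\<lambda>(n, e). e = k) n_as) = ns"
    unfolding ns_def by (rule arg_cong[where f = "map fst"], rule filter_cong) auto
  have C: "char_matrix A k \<in> carrier_mat d d" using A by (simp add: char_matrix_def)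
  have "kernel_dim (char_matrix A k ^\<^sub>m 2) = kernel_dim (char_matrix A k)"
    using ker C pow_carrier_mat[OF C, of 2] by (simp add: kernel_dim_def)
  then have eq: "sum_list (map (min 2) ns) = sum_list (map (min 1) ns)"
    using dim_gen_eigenspace[OF jnf, of k 2] dim_gen_eigenspace[OF jnf, of k 1] C
    by (simp add: dim_gen_eigenspace_def ns)
  have "\<forall>m\<in>set ns. m \<le> 1"
  proof (rule ccontr)
    assume "\<not> (\<forall>m\<in>set ns. m \<le> 1)"
    then obtain m where "m \<in> set ns" "m \<ge> 2" by force
    then have "sum_list (map (min 1) ns) < sum_list (map (min 2) ns)"
    proof (induction ns)
      case (Cons m' ns)
      have "sum_list (map (min 1) ns) \<le> sum_list (map (min 2) ns)" by (rule sum_list_mono) auto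
      then show ?case using Cons by auto
    qed simp
    with eq show False by simp
  qed
  then have "map (min 1) ns = ns" by (simp add: map_idI min_absorb2)
  then have "kernel_dim (char_matrix A k) = sum_list ns"
    using dim_gen_eigenspace[OF jnf, of k 1] C by (simp add: dim_gen_eigenspace_def ns)
  also have "\<dots> = Polynomial.order k (char_poly A)"
    using jordan_nf_order[OF jnf, of k] by (simp add: ns_def)
  finally show ?thesis by simp
qed

lemma poly_char_poly_int:
  fixes A :: "complex mat"
  assumes A: "A \<in> carrier_mat d d" and int: "\<And>\<mu>. eigenvalue A \<mu> \<Longrightarrow> \<mu> \<in> \<int>"
  shows "poly (char_poly A) (of_int x) \<in> \<int>"
proof -
  obtain as where as: "char_poly A = (\<Prod>a\<leftarrow>as. [:- a, 1:])" using char_poly_factorized[OF A] by blast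
  have "a \<in> \<int>" if "a \<in> set as" for a
  proof -
    have "poly (char_poly A) a = 0" unfolding as using that
      by (induction as) auto
    then show ?thesis using int eigenvalue_root_char_poly[OF A] by simp
  qed
  then have "poly (\<Prod>a\<leftarrow>as. [:- a, 1:]) (of_int x) \<in> \<int>"
    by (induction as) auto
  then show ?thesis by (simp add: as)
qed

text \<open>There are uncountably many arguments but only countably many values, so some integer \<open>m\<close> is the
  quotient infinitely often, and then \<open>N = m \<delta>\<close> as polynomials.\<close>

lemma integer_valued_poly_quotient_constant:
  fixes N \<delta> :: "complex poly"
  assumes "\<delta> \<noteq> 0"
    and int: "\<And>t. poly \<delta> t \<noteq> 0 \<Longrightarrow> \<exists>m::int. poly N t = poly \<delta> t * of_int m"
  obtains m :: int where "N = Polynomial.smult (of_int m) \<delta>"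
proof -
  define Z where "Z = {t. poly \<delta> t = 0}"
  define S where "S m = {t. poly N t = poly \<delta> t * of_int m}" for m :: int
  have "Z \<union> (\<Union>m. S m) = UNIV" using int by (auto simp: Z_def S_def)
  have "\<exists>m. infinite (S m)"
  proof (rule ccontr)
    assume "\<nexists>m. infinite (S m)"
    then have "countable (\<Union>m. S m)" by (intro countable_UN) (auto intro: countable_finite)
    moreover have "countable Z" unfolding Z_def by (intro countable_finite poly_roots_finite assms(1))
    ultimately have "countable (Z \<union> (\<Union>m. S m))" by simp
    then have "countable (UNIV :: complex set)" using \<open>Z \<union> (\<Union>m. S m) = UNIV\<close> by simp
    then have "countable (range Re)" by (rule countable_image)
    moreover have "range Re = UNIV" by (metis Re_complex_of_real surjI)
    ultimately show False using uncountable_UNIV_real by simp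
  qed
  then obtain m where m: "infinite (S m)" by blast
  have "S m \<subseteq> {t. poly (N - Polynomial.smult (of_int m) \<delta>) t = 0}" by (auto simp: S_def)
  with m have "infinite {t. poly (N - Polynomial.smult (of_int m) \<delta>) t = 0}" using finite_subset by blast
  then have "N - Polynomial.smult (of_int m) \<delta> = 0" using poly_roots_finite by blast
  then show ?thesis using that by simp
qed

section \<open>Independence of the Frobenius functional\<close>

lemma linear_form_on_carrier_vec:
  fixes L :: "complex vec \<Rightarrow> complex"
  assumes add: "\<And>u v. u \<in> carrier_vec d \<Longrightarrow> v \<in> carrier_vec d \<Longrightarrow> L (u + v) = L u + L v"
    and smult: "\<And>c u. u \<in> carrier_vec d \<Longrightarrow> L (c \<cdot>\<^sub>v u) = c * L u"
    and v: "v \<in> carrier_vec d"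
  shows "L v = (\<Sum>i<d. v $ i * L (unit_vec d i))"
proof -
  have "L (vec d (\<lambda>i. if i < m then v $ i else 0)) = (\<Sum>i<m. v $ i * L (unit_vec d i))" if "m \<le> d" for m
    using that
  proof (induction m)
    case 0
    have "vec d (\<lambda>i. 0) = 0 \<cdot>\<^sub>v (0\<^sub>v d :: complex vec)" by (intro eq_vecI) auto
    then show ?case using smult[of "0\<^sub>v d" 0] by simp
  next
    case (Suc m)
    have "vec d (\<lambda>i. if i < Suc m then v $ i else 0) =
      vec d (\<lambda>i. if i < m then v $ i else 0) + v $ m \<cdot>\<^sub>v unit_vec d m"
      using Suc.prems by (intro eq_vecI) (auto simp: less_Suc_eq)
    then show ?case using Suc by (simp add: add smult)
  qed
  moreover have "vec d (\<lambda>i. if i < d then v $ i else 0) = v" using v by (intro eq_vecI) auto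
  ultimately show ?thesis by (metis order_refl)
qed

text \<open>Linear coordinates \<open>\<psi>\<close> with inverse \<open>\<phi>\<close> turn the Kirillov form and the adjoint action into
  matrices, to which determinants and characteristic polynomials apply.\<close>

locale coordinatised_lie_algebra =
  fixes n d :: nat and g :: "complex mat set"
    and \<psi> :: "complex mat \<Rightarrow> complex vec" and \<phi> :: "complex vec \<Rightarrow> complex mat"
  assumes lie: "lie_subalgebra n g"
    and \<psi>_mem: "x \<in> g \<Longrightarrow> \<psi> x \<in> carrier_vec d"
    and \<phi>_mem: "v \<in> carrier_vec d \<Longrightarrow> \<phi> v \<in> g"
    and \<psi>\<phi>: "v \<in> carrier_vec d \<Longrightarrow> \<psi> (\<phi> v) = v"
    and \<phi>\<psi>: "x \<in> g \<Longrightarrow> \<phi> (\<psi> x) = x"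
    and \<phi>_add: "u \<in> carrier_vec d \<Longrightarrow> v \<in> carrier_vec d \<Longrightarrow> \<phi> (u + v) = \<phi> u + \<phi> v"
    and \<phi>_smult: "v \<in> carrier_vec d \<Longrightarrow> \<phi> (c \<cdot>\<^sub>v v) = c \<cdot>\<^sub>m \<phi> v"
begin

lemma g_subspace: "VectorSpace.subspace class_ring g (module_mat TYPE(complex) n n)"
  and g_bracket: "x \<in> g \<Longrightarrow> y \<in> g \<Longrightarrow> lie_bracket x y \<in> g"
  using lie by (auto simp: lie_subalgebra_def)

lemma g_dim: "x \<in> g \<Longrightarrow> x \<in> carrier_mat n n"
  and g_add: "x \<in> g \<Longrightarrow> y \<in> g \<Longrightarrow> x + y \<in> g"
  and g_zero: "0\<^sub>m n n \<in> g"
  and g_smult: "x \<in> g \<Longrightarrow> c \<cdot>\<^sub>m x \<in> g"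
  using g_subspace by (auto simp: VectorSpace.subspace_def submodule_def module_mat_simps class_ring_simps)

lemma \<psi>_add: "x \<in> g \<Longrightarrow> y \<in> g \<Longrightarrow> \<psi> (x + y) = \<psi> x + \<psi> y"
  by (metis \<phi>\<psi> \<psi>\<phi> \<phi>_add \<psi>_mem add_carrier_vec)

lemma \<psi>_smult: "x \<in> g \<Longrightarrow> \<psi> (c \<cdot>\<^sub>m x) = c \<cdot>\<^sub>v \<psi> x"
  by (metis \<phi>\<psi> \<psi>\<phi> \<phi>_smult \<psi>_mem smult_carrier_vec)

lemma lie_bracket_linear_left:
  assumes "x \<in> g" "y \<in> g" "z \<in> g"
  shows "lie_bracket (x + y) z = lie_bracket x z + lie_bracket y z"
    "lie_bracket (c \<cdot>\<^sub>m x) z = c \<cdot>\<^sub>m lie_bracket x z"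
proof -
  note d = g_dim[OF assms(1)] g_dim[OF assms(2)] g_dim[OF assms(3)]
  show "lie_bracket (x + y) z = lie_bracket x z + lie_bracket y z"
    unfolding lie_bracket_def add_mult_distrib_mat[OF d(1-3)] mult_add_distrib_mat[OF d(3,1,2)]
    using d by (intro eq_matI) (auto simp del: index_mult_mat(1))
  show "lie_bracket (c \<cdot>\<^sub>m x) z = c \<cdot>\<^sub>m lie_bracket x z"
    unfolding lie_bracket_def mult_smult_assoc_mat[OF d(1,3)] mult_smult_distrib[OF d(3,1)]
    using d by (intro eq_matI) (auto simp del: index_mult_mat(1) simp: right_diff_distrib)
qed

lemma lie_bracket_linear_right:
  assumes "x \<in> g" "y \<in> g" "z \<in> g"
  shows "lie_bracket z (x + y) = lie_bracket z x + lie_bracket z y"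
    "lie_bracket z (c \<cdot>\<^sub>m x) = c \<cdot>\<^sub>m lie_bracket z x"
proof -
  note d = g_dim[OF assms(1)] g_dim[OF assms(2)] g_dim[OF assms(3)]
  show "lie_bracket z (x + y) = lie_bracket z x + lie_bracket z y"
    unfolding lie_bracket_def add_mult_distrib_mat[OF d(1-3)] mult_add_distrib_mat[OF d(3,1,2)]
    using d by (intro eq_matI) (auto simp del: index_mult_mat(1))
  show "lie_bracket z (c \<cdot>\<^sub>m x) = c \<cdot>\<^sub>m lie_bracket z x"
    unfolding lie_bracket_def mult_smult_assoc_mat[OF d(1,3)] mult_smult_distrib[OF d(3,1)]
    using d by (intro eq_matI) (auto simp del: index_mult_mat(1) simp: right_diff_distrib)
qed

abbreviation e :: "nat \<Rightarrow> complex mat" where "e i \<equiv> \<phi> (unit_vec d i)"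

definition ad_mat :: "complex mat \<Rightarrow> complex mat" where
  "ad_mat p = mat d d (\<lambda>(i, j). \<psi> (lie_bracket p (e j)) $ i)"

definition kirillov_mat :: "(complex mat \<Rightarrow> complex) \<Rightarrow> complex mat" where
  "kirillov_mat F = mat d d (\<lambda>(j, k). kirillov_form F (e k) (e j))"

definition functional_vec :: "(complex mat \<Rightarrow> complex) \<Rightarrow> complex vec" where
  "functional_vec F = vec d (\<lambda>j. F (e j))"

lemma ad_mat_carrier [simp]: "ad_mat p \<in> carrier_mat d d"
  and kirillov_mat_carrier [simp]: "kirillov_mat F \<in> carrier_mat d d"
  and functional_vec_carrier [simp]: "functional_vec F \<in> carrier_vec d"
  by (auto simp: ad_mat_def kirillov_mat_def functional_vec_def)

lemma e_mem [simp]: "e i \<in> g"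
  by (rule \<phi>_mem) simp

lemma functional_in_coordinates:
  assumes "linear_functional g F" "v \<in> carrier_vec d"
  shows "F (\<phi> v) = (\<Sum>i<d. v $ i * F (e i))"
  using assms by (intro linear_form_on_carrier_vec)
    (auto simp: \<phi>_add \<phi>_smult linear_functional_def \<phi>_mem)

lemma coordinate_of_linear_map:
  assumes mem: "\<And>x. x \<in> g \<Longrightarrow> T x \<in> g"
    and add: "\<And>x y. x \<in> g \<Longrightarrow> y \<in> g \<Longrightarrow> T (x + y) = T x + T y"
    and smult: "\<And>c x. x \<in> g \<Longrightarrow> T (c \<cdot>\<^sub>m x) = c \<cdot>\<^sub>m T x"
    and v: "v \<in> carrier_vec d" and i: "i < d"
  shows "\<psi> (T (\<phi> v)) $ i = (\<Sum>k<d. v $ k * \<psi> (T (e k)) $ i)"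
proof (rule linear_form_on_carrier_vec[where L = "\<lambda>v. \<psi> (T (\<phi> v)) $ i"])
  fix u v :: "complex vec" assume uv: "u \<in> carrier_vec d" "v \<in> carrier_vec d"
  then have "\<psi> (T (\<phi> (u + v))) = \<psi> (T (\<phi> u)) + \<psi> (T (\<phi> v))"
    by (simp add: \<phi>_add \<phi>_mem mem add \<psi>_add)
  moreover have "dim_vec (\<psi> (T (\<phi> v))) = d" using uv by (intro carrier_vecD \<psi>_mem mem \<phi>_mem)
  ultimately show "\<psi> (T (\<phi> (u + v))) $ i = \<psi> (T (\<phi> u)) $ i + \<psi> (T (\<phi> v)) $ i"
    using i by simp
next
  fix c and u :: "complex vec" assume u: "u \<in> carrier_vec d"
  then have "\<psi> (T (\<phi> (c \<cdot>\<^sub>v u))) = c \<cdot>\<^sub>v \<psi> (T (\<phi> u))"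
    by (simp add: \<phi>_smult \<phi>_mem mem smult \<psi>_smult)
  moreover have "dim_vec (\<psi> (T (\<phi> u))) = d" using u by (intro carrier_vecD \<psi>_mem mem \<phi>_mem)
  ultimately show "\<psi> (T (\<phi> (c \<cdot>\<^sub>v u))) $ i = c * \<psi> (T (\<phi> u)) $ i"
    using i by simp
qed (use v in simp)

lemma \<psi>_bracket:
  assumes p: "p \<in> g" and x: "x \<in> g"
  shows "\<psi> (lie_bracket p x) = ad_mat p *\<^sub>v \<psi> x"
proof (rule eq_vecI)
  fix i assume "i < dim_vec (ad_mat p *\<^sub>v \<psi> x)"
  then have i: "i < d" by (simp add: ad_mat_def)
  have "\<psi> (lie_bracket p (\<phi> (\<psi> x))) $ i = (\<Sum>k<d. \<psi> x $ k * \<psi> (lie_bracket p (e k)) $ i)"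
    by (rule coordinate_of_linear_map[where T = "lie_bracket p"])
       (use p x i in \<open>auto simp: g_bracket lie_bracket_linear_right \<psi>_mem\<close>)
  then show "\<psi> (lie_bracket p x) $ i = (ad_mat p *\<^sub>v \<psi> x) $ i"
    using i carrier_vecD[OF \<psi>_mem[OF x]] x
    by (simp add: ad_mat_def scalar_prod_def atLeast0LessThan \<phi>\<psi> mult.commute)
qed (use \<psi>_mem[OF g_bracket[OF p x]] in \<open>simp add: ad_mat_def\<close>)

lemma ad_mat_index:
  assumes p: "p \<in> g" and i: "i < d" "j < d"
  shows "ad_mat p $$ (i, j) = (\<Sum>k<d. \<psi> p $ k * \<psi> (lie_bracket (e k) (e j)) $ i)"
proof -
  have "\<psi> (lie_bracket (\<phi> (\<psi> p)) (e j)) $ i = (\<Sum>k<d. \<psi> p $ k * \<psi> (lie_bracket (e k) (e j)) $ i)"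
    by (rule coordinate_of_linear_map[where T = "\<lambda>x. lie_bracket x (e j)"])
       (use p i in \<open>auto simp: g_bracket lie_bracket_linear_left \<psi>_mem\<close>)
  then show ?thesis using p i by (simp add: ad_mat_def \<phi>\<psi>)
qed

lemma kirillov_mat_mult:
  assumes F: "linear_functional g F" and x: "x \<in> g" and j: "j < d"
  shows "(kirillov_mat F *\<^sub>v \<psi> x) $ j = F (lie_bracket x (e j))"
proof -
  have "linear_functional g (\<lambda>x. F (lie_bracket x (e j)))"
    using F by (auto simp: linear_functional_def lie_bracket_linear_left g_bracket)
  from functional_in_coordinates[OF this \<psi>_mem[OF x]] show ?thesis
    using x j carrier_vecD[OF \<psi>_mem[OF x]]
    by (simp add: kirillov_mat_def kirillov_form_def scalar_prod_def atLeast0LessThan \<phi>\<psi> mult.commute)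
qed

lemma functional_eqI:
  assumes "linear_functional g F" "linear_functional g G" "\<And>j. j < d \<Longrightarrow> F (e j) = G (e j)" "x \<in> g"
  shows "F x = G x"
  using functional_in_coordinates[OF assms(1) \<psi>_mem[OF assms(4)]]
    functional_in_coordinates[OF assms(2) \<psi>_mem[OF assms(4)]] assms(3,4) by (simp add: \<phi>\<psi>)

lemma linear_functional_bracket:
  "linear_functional g F \<Longrightarrow> x \<in> g \<Longrightarrow> linear_functional g (\<lambda>y. F (lie_bracket x y))"
  by (auto simp: linear_functional_def lie_bracket_linear_right g_bracket)

lemma \<psi>_eq_0_iff:
  assumes "x \<in> g" shows "\<psi> x = 0\<^sub>v d \<longleftrightarrow> x = 0\<^sub>m n n"
  proof -
    have "\<phi> (0\<^sub>v d) = 0\<^sub>m n n"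
    proof -
      have "0 \<cdot>\<^sub>v 0\<^sub>v d = (0\<^sub>v d :: complex vec)" by (intro eq_vecI) auto
      then have "\<phi> (0\<^sub>v d) = 0 \<cdot>\<^sub>m \<phi> (0\<^sub>v d)" using \<phi>_smult[of "0\<^sub>v d" 0] by simp
      also have "\<dots> = 0\<^sub>m n n" using g_dim[OF \<phi>_mem[of "0\<^sub>v d"]] by (intro eq_matI) auto
      finally show ?thesis .
    qed
    then show ?thesis using \<phi>\<psi>[OF assms] \<psi>\<phi>[of "0\<^sub>v d"] by auto
  qed

lemma frobenius_iff_det:
  assumes F: "linear_functional g F"
  shows "frobenius_functional n g F \<longleftrightarrow> det (kirillov_mat F) \<noteq> 0"
proof -
  have radical: "kirillov_mat F *\<^sub>v \<psi> x = 0\<^sub>v d \<longleftrightarrow> (\<forall>y\<in>g. kirillov_form F x y = 0)" if x: "x \<in> g" for x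
  proof
    assume "kirillov_mat F *\<^sub>v \<psi> x = 0\<^sub>v d"
    then have basis: "F (lie_bracket x (e j)) = 0" if "j < d" for j
      using kirillov_mat_mult[OF F x that] that by simp
    have zero: "linear_functional g (\<lambda>y. 0)" by (simp add: linear_functional_def)
    have "F (lie_bracket x y) = 0" if "y \<in> g" for y
      using functional_eqI[OF linear_functional_bracket[OF F x] zero basis that] by simp
    then show "\<forall>y\<in>g. kirillov_form F x y = 0" by (simp add: kirillov_form_def)
  next
    assume "\<forall>y\<in>g. kirillov_form F x y = 0"
    then show "kirillov_mat F *\<^sub>v \<psi> x = 0\<^sub>v d"
      using kirillov_mat_mult[OF F x] by (intro eq_vecI) (auto simp: kirillov_form_def kirillov_mat_def)
  qed
  have "det (kirillov_mat F) = 0 \<longleftrightarrow> (\<exists>x\<in>g. x \<noteq> 0\<^sub>m n n \<and> kirillov_mat F *\<^sub>v \<psi> x = 0\<^sub>v d)"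
    (is "_ \<longleftrightarrow> ?R")
  proof
    assume "det (kirillov_mat F) = 0"
    then obtain v where v: "v \<in> carrier_vec d" "v \<noteq> 0\<^sub>v d" "kirillov_mat F *\<^sub>v v = 0\<^sub>v d"
      unfolding det_0_iff_vec_prod_zero[OF kirillov_mat_carrier] by blast
    then show ?R using \<psi>_eq_0_iff[OF \<phi>_mem[OF v(1)]] by (intro bexI[of _ "\<phi> v"]) (auto simp: \<psi>\<phi> \<phi>_mem)
  next
    assume ?R
    then show "det (kirillov_mat F) = 0"
      unfolding det_0_iff_vec_prod_zero[OF kirillov_mat_carrier] using \<psi>_eq_0_iff \<psi>_mem by blast
  qed
  then show ?thesis using F radical by (auto simp: frobenius_functional_def)
qed

lemma principal_iff:
  assumes F: "linear_functional g F" and p: "p \<in> g"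
  shows "(\<forall>x\<in>g. F (lie_bracket p x) = F x) \<longleftrightarrow> kirillov_mat F *\<^sub>v \<psi> p = functional_vec F"
proof
  assume "\<forall>x\<in>g. F (lie_bracket p x) = F x"
  then show "kirillov_mat F *\<^sub>v \<psi> p = functional_vec F"
    using kirillov_mat_mult[OF F p] by (intro eq_vecI) (auto simp: functional_vec_def kirillov_mat_def)
next
  assume eq: "kirillov_mat F *\<^sub>v \<psi> p = functional_vec F"
  show "\<forall>x\<in>g. F (lie_bracket p x) = F x"
  proof
    fix x assume x: "x \<in> g"
    have "F (lie_bracket p (e j)) = F (e j)" if "j < d" for j
      using kirillov_mat_mult[OF F p that] eq that by (simp add: functional_vec_def)
    then show "F (lie_bracket p x) = F x"
      by (rule functional_eqI[OF linear_functional_bracket[OF F p] F _ x])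
  qed
qed

lemma principal_element_unique:
  assumes F: "frobenius_functional n g F"
    and "p \<in> g" "\<And>x. x \<in> g \<Longrightarrow> F (lie_bracket p x) = F x"
    and "q \<in> g" "\<And>x. x \<in> g \<Longrightarrow> F (lie_bracket q x) = F x"
  shows "p = q"
proof -
  have F': "linear_functional g F" using F by (simp add: frobenius_functional_def)
  define y where "y = p + (-1) \<cdot>\<^sub>m q"
  have y: "y \<in> g" using assms(2,4) by (simp add: y_def g_add g_smult)
  have "kirillov_form F y x = 0" if "x \<in> g" for x
    using assms(2-5) that F' unfolding linear_functional_def
    by (simp add: y_def kirillov_form_def lie_bracket_linear_left g_smult g_bracket)
  then have "y = 0\<^sub>m n n" using F y by (auto simp: frobenius_functional_def)
  then have "y $$ (i, j) = 0" if "i < n" "j < n" for i j using that by simp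
  then show ?thesis using g_dim[OF assms(2)] g_dim[OF assms(4)] by (intro eq_matI) (auto simp: y_def)
qed

lemma principal_elementI:
  assumes F: "frobenius_functional n g F" and "p \<in> g" "\<And>x. x \<in> g \<Longrightarrow> F (lie_bracket p x) = F x"
  shows "principal_element g F = p"
  unfolding principal_element_def
  using assms(2,3) principal_element_unique[OF F] by (intro the_equality) auto

text \<open>The principal element solves a linear system given by the Kirillov matrix. The solution is written
  with the adjugate, so that it is polynomial in the functional up to the factor \<open>1 / det\<close>.\<close>

lemma principal_element_solve:
  assumes F: "frobenius_functional n g F"
  shows "principal_element g F =
    \<phi> ((1 / det (kirillov_mat F)) \<cdot>\<^sub>v (adj_mat (kirillov_mat F) *\<^sub>v functional_vec F))" (is "_ = \<phi> ?v")
    and "principal_element g F \<in> g"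
    and "x \<in> g \<Longrightarrow> F (lie_bracket (principal_element g F) x) = F x"
proof -
  have F': "linear_functional g F" using F by (simp add: frobenius_functional_def)
  let ?B = "kirillov_mat F"
  have det: "det ?B \<noteq> 0" using F frobenius_iff_det[OF F'] by simp
  note adj = adj_mat[OF kirillov_mat_carrier[of F]]
  have v: "?v \<in> carrier_vec d" using adj(1) by simp
  have "?B *\<^sub>v ?v = (1 / det ?B) \<cdot>\<^sub>v (?B * adj_mat ?B *\<^sub>v functional_vec F)"
    using adj(1) by (simp add: mult_mat_vec[OF kirillov_mat_carrier] assoc_mult_mat_vec[OF kirillov_mat_carrier adj(1)])
  also have "\<dots> = functional_vec F"
    unfolding adj(2) using det by (intro eq_vecI) (auto simp: functional_vec_def)
  finally have "\<forall>x\<in>g. F (lie_bracket (\<phi> ?v) x) = F x"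
    unfolding principal_iff[OF F' \<phi>_mem[OF v]] \<psi>\<phi>[OF v] .
  then show eq: "principal_element g F = \<phi> ?v" and "x \<in> g \<Longrightarrow> F (lie_bracket (principal_element g F) x) = F x"
    using principal_elementI[OF F \<phi>_mem[OF v]] by auto
  show "principal_element g F \<in> g" unfolding eq using v by (rule \<phi>_mem)
qed

end

lemma char_matrix_mult_vec:
  fixes A :: "complex mat"
  assumes "A \<in> carrier_mat d d" "v \<in> carrier_vec d"
  shows "char_matrix A k *\<^sub>v v = A *\<^sub>v v + (-k) \<cdot>\<^sub>v v"
proof -
  have "((-k) \<cdot>\<^sub>m 1\<^sub>m d) *\<^sub>v v = (-k) \<cdot>\<^sub>v v"
    using assms(2) by (intro eq_vecI) auto
  then show ?thesis using assms by (simp add: char_matrix_def add_mult_distrib_mat_vec[of _ d d])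
qed

context coordinatised_lie_algebra
begin

lemma coordinate_mat_dims [simp]:
  "dim_row (ad_mat p) = d" "dim_col (ad_mat p) = d"
  "dim_row (kirillov_mat F) = d" "dim_col (kirillov_mat F) = d"
  by (simp_all add: ad_mat_def kirillov_mat_def)

lemma char_matrix_ad_mat_carrier: "char_matrix (ad_mat p) k \<in> carrier_mat d d"
  by (simp add: char_matrix_def)

lemma mem_kernel_char_matrix_iff:
  assumes p: "p \<in> g" and x: "x \<in> g"
  shows "char_matrix (ad_mat p) k *\<^sub>v \<psi> x = \<psi> (lie_bracket p x + (-k) \<cdot>\<^sub>m x)"
    and "\<psi> x \<in> mat_kernel (char_matrix (ad_mat p) k) \<longleftrightarrow> lie_bracket p x = k \<cdot>\<^sub>m x"
proof -
  show eq: "char_matrix (ad_mat p) k *\<^sub>v \<psi> x = \<psi> (lie_bracket p x + (-k) \<cdot>\<^sub>m x)"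
    using x p by (simp add: char_matrix_mult_vec[OF ad_mat_carrier \<psi>_mem] \<psi>_bracket \<psi>_add \<psi>_smult g_bracket g_smult)
  have C: "char_matrix (ad_mat p) k \<in> carrier_mat d d" by (rule char_matrix_ad_mat_carrier)
  have b: "lie_bracket p x + (-k) \<cdot>\<^sub>m x \<in> g" using p x by (simp add: g_add g_bracket g_smult)
  have "\<psi> (lie_bracket p x + (-k) \<cdot>\<^sub>m x) = 0\<^sub>v d \<longleftrightarrow> lie_bracket p x + (-k) \<cdot>\<^sub>m x = 0\<^sub>m n n"
    by (rule \<psi>_eq_0_iff[OF b])
  also have "\<dots> \<longleftrightarrow> lie_bracket p x = k \<cdot>\<^sub>m x"
  proof
    assume z: "lie_bracket p x + (-k) \<cdot>\<^sub>m x = 0\<^sub>m n n"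
    show "lie_bracket p x = k \<cdot>\<^sub>m x"
    proof (rule eq_matI)
      fix i j assume ij: "i < dim_row (k \<cdot>\<^sub>m x)" "j < dim_col (k \<cdot>\<^sub>m x)"
      have "(lie_bracket p x + (-k) \<cdot>\<^sub>m x) $$ (i, j) = 0" using z ij g_dim[OF x] by simp
      then show "lie_bracket p x $$ (i, j) = (k \<cdot>\<^sub>m x) $$ (i, j)"
        using ij g_dim[OF x] by simp
    qed (use g_dim[OF x] g_dim[OF g_bracket[OF p x]] in auto)
  next
    assume z: "lie_bracket p x = k \<cdot>\<^sub>m x"
    show "lie_bracket p x + (-k) \<cdot>\<^sub>m x = 0\<^sub>m n n"
      unfolding z using g_dim[OF x] by (intro eq_matI) auto
  qed
  finally show "\<psi> x \<in> mat_kernel (char_matrix (ad_mat p) k) \<longleftrightarrow> lie_bracket p x = k \<cdot>\<^sub>m x"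
    using \<psi>_mem[OF x] by (simp add: mat_kernel[OF C] eq)
qed

text \<open>Semisimplicity enters only through the kernel of the square of \<open>ad p - k\<close>.\<close>

lemma dim_principal_eigenspace:
  assumes F: "frobenius_functional n g F"
    and semisimple: "\<And>x. x \<in> g \<Longrightarrow>
      lie_bracket (principal_element g F) (lie_bracket (principal_element g F) x - of_int k \<cdot>\<^sub>m x) =
        of_int k \<cdot>\<^sub>m (lie_bracket (principal_element g F) x - of_int k \<cdot>\<^sub>m x) \<Longrightarrow>
      lie_bracket (principal_element g F) x = of_int k \<cdot>\<^sub>m x"
  shows "mat_subspace_dim n (principal_eigenspace g F k) =
    Polynomial.order (of_int k) (char_poly (ad_mat (principal_element g F)))"
proof -
  define p where "p = principal_element g F"
  have p: "p \<in> g" unfolding p_def by (rule principal_element_solve(2)[OF F])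
  define C where "C = char_matrix (ad_mat p) (of_int k)"
  have C: "C \<in> carrier_mat d d" unfolding C_def by (rule char_matrix_ad_mat_carrier)
  have ker: "mat_kernel (C ^\<^sub>m 2) = mat_kernel C"
  proof
    have C2: "C ^\<^sub>m 2 = C * C" using C by (simp add: numeral_2_eq_2)
    show "mat_kernel C \<subseteq> mat_kernel (C ^\<^sub>m 2)" unfolding C2 by (rule mat_kernel_mult_subset[OF C C])
    show "mat_kernel (C ^\<^sub>m 2) \<subseteq> mat_kernel C"
    proof
      fix v assume "v \<in> mat_kernel (C ^\<^sub>m 2)"
      then have v: "v \<in> carrier_vec d" "C *\<^sub>v (C *\<^sub>v v) = 0\<^sub>v d"
        unfolding C2 using C by (auto simp: mat_kernel[OF mult_carrier_mat[OF C C]] assoc_mult_mat_vec[of _ d d _ d])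
      define x where "x = \<phi> v"
      have x: "x \<in> g" "\<psi> x = v" using v by (auto simp: x_def \<phi>_mem \<psi>\<phi>)
      define y where "y = lie_bracket p x + (- of_int k) \<cdot>\<^sub>m x"
      have y: "y \<in> g" using p x by (simp add: y_def g_add g_bracket g_smult)
      have y': "y = lie_bracket p x - of_int k \<cdot>\<^sub>m x"
        using g_dim[OF x(1)] g_dim[OF g_bracket[OF p x(1)]] by (intro eq_matI) (auto simp: y_def)
      have "C *\<^sub>v v = \<psi> y" using mem_kernel_char_matrix_iff(1)[OF p x(1)] x(2) by (simp add: C_def y_def)
      then have "\<psi> y \<in> mat_kernel C" using v(2) \<psi>_mem[OF y] by (simp add: mat_kernel[OF C])
      then have "lie_bracket p y = of_int k \<cdot>\<^sub>m y"
        unfolding C_def mem_kernel_char_matrix_iff(2)[OF p y] .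
      then have "lie_bracket p x = of_int k \<cdot>\<^sub>m x" using semisimple[OF x(1)] by (simp add: y' p_def)
      then show "v \<in> mat_kernel C" using mem_kernel_char_matrix_iff(2)[OF p x(1)] x(2) by (simp add: C_def)
    qed
  qed
  let ?W = "principal_eigenspace g F k"
  have W: "?W = {x \<in> g. lie_bracket p x = of_int k \<cdot>\<^sub>m x}" by (simp add: principal_eigenspace_def p_def)
  have bij: "bij_betw \<phi> (mat_kernel C) ?W"
  proof (rule bij_betw_byWitness[where f' = \<psi>])
    show "\<forall>v\<in>mat_kernel C. \<psi> (\<phi> v) = v" using mat_kernelD[OF C] \<psi>\<phi> by auto
    show "\<forall>x\<in>?W. \<phi> (\<psi> x) = x" using \<phi>\<psi> by (auto simp: W)
    show "\<phi> ` mat_kernel C \<subseteq> ?W"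
    proof safe
      fix v assume v: "v \<in> mat_kernel C"
      then have v': "v \<in> carrier_vec d" using mat_kernelD[OF C] by auto
      then show "\<phi> v \<in> ?W" using v mem_kernel_char_matrix_iff(2)[OF p \<phi>_mem[OF v'], of "of_int k"]
        by (auto simp: W C_def \<psi>\<phi> \<phi>_mem)
    qed
    show "\<psi> ` ?W \<subseteq> mat_kernel C"
      using mem_kernel_char_matrix_iff(2)[OF p] by (auto simp: W C_def)
  qed
  have "submodule class_ring ?W (module_mat TYPE(complex) n n)"
  proof -
    have "Module.module class_ring (module_mat TYPE(complex) n n)"
      by (rule vectorspace.axioms(1)[OF matrix_vs])
    moreover have "x + y \<in> ?W" if "x \<in> ?W" "y \<in> ?W" for x y
      using that p by (auto simp: W g_add lie_bracket_linear_right add_smult_distrib_left_mat[OF g_dim g_dim])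
    moreover have "c \<cdot>\<^sub>m x \<in> ?W" if "x \<in> ?W" for c x
      using that p g_dim[of x]
      by (auto simp: W g_smult lie_bracket_linear_right intro!: eq_matI)
    moreover have "0\<^sub>m n n \<in> ?W"
    proof -
      have "lie_bracket p (0\<^sub>m n n) = 0\<^sub>m n n"
        unfolding lie_bracket_def using g_dim[OF p] by simp
      then show ?thesis by (simp add: W g_zero)
    qed
    moreover have "?W \<subseteq> carrier_mat n n" using g_dim by (auto simp: W)
    ultimately show ?thesis by (auto simp: submodule_def module_mat_simps class_ring_simps)
  qed
  then have sub: "VectorSpace.subspace class_ring ?W (module_mat TYPE(complex) n n)"
    by (simp add: VectorSpace.subspace_def matrix_vs)
  have "mat_subspace_dim n ?W = kernel_dim C"
    by (rule mat_subspace_dim_eq_kernel_dim[OF C sub bij \<phi>_add \<phi>_smult])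
  also have "\<dots> = Polynomial.order (of_int k) (char_poly (ad_mat p))"
    unfolding C_def by (rule order_char_poly_eq_kernel_dim[symmetric, OF ad_mat_carrier]) (use ker in \<open>simp add: C_def\<close>)
  finally show ?thesis by (simp add: p_def)
qed

lemma eigenvalue_ad_mat:
  assumes p: "p \<in> g" and ev: "eigenvalue (ad_mat p) \<mu>"
  obtains x where "x \<in> g" "x \<noteq> 0\<^sub>m n n" "lie_bracket p x = \<mu> \<cdot>\<^sub>m x"
proof -
  obtain v where v: "v \<in> carrier_vec d" "v \<noteq> 0\<^sub>v d" "ad_mat p *\<^sub>v v = \<mu> \<cdot>\<^sub>v v"
    using ev by (auto simp: eigenvalue_def eigenvector_def ad_mat_def)
  have x: "\<phi> v \<in> g" "\<psi> (\<phi> v) = v" using v by (auto simp: \<phi>_mem \<psi>\<phi>)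
  have C: "char_matrix (ad_mat p) \<mu> \<in> carrier_mat d d" by (rule char_matrix_ad_mat_carrier)
  have "char_matrix (ad_mat p) \<mu> *\<^sub>v v = 0\<^sub>v d"
    unfolding char_matrix_mult_vec[OF ad_mat_carrier v(1)] v(3) using v(1) by (intro eq_vecI) auto
  then have "\<psi> (\<phi> v) \<in> mat_kernel (char_matrix (ad_mat p) \<mu>)" using v(1) x(2) by (simp add: mat_kernel[OF C])
  then have "lie_bracket p (\<phi> v) = \<mu> \<cdot>\<^sub>m \<phi> v" using mem_kernel_char_matrix_iff(2)[OF p x(1)] by simp
  moreover have "\<phi> v \<noteq> 0\<^sub>m n n" using \<psi>_eq_0_iff[OF x(1)] v(2) x(2) by simp
  ultimately show ?thesis using that x(1) by blast
qed

text \<open>Along the line \<open>F\<^sub>0 + t (F\<^sub>1 - F\<^sub>0)\<close> let \<open>\<delta>(t)\<close> be the determinant of the Kirillov matrix. By Cramer's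
  rule \<open>\<delta>(t) ad p\<close> has polynomial entries \<open>U\<close>, so at an integer the characteristic polynomial of \<open>ad p\<close>
  is a polynomial in \<open>t\<close> divided by a power of \<open>\<delta>\<close>. Wherever \<open>\<delta>(t) \<noteq> 0\<close> the functional is Frobenius
  and the value is an integer, hence the value is the same for all such \<open>t\<close>.\<close>

lemma char_poly_ad_independent:
  assumes F0: "frobenius_functional n g F0" and F1: "frobenius_functional n g F1"
    and integral: "\<And>F x \<mu>. frobenius_functional n g F \<Longrightarrow> x \<in> g \<Longrightarrow> x \<noteq> 0\<^sub>m n n \<Longrightarrow>
      lie_bracket (principal_element g F) x = \<mu> \<cdot>\<^sub>m x \<Longrightarrow> \<mu> \<in> \<int>"
  shows "char_poly (ad_mat (principal_element g F0)) = char_poly (ad_mat (principal_element g F1))"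
proof -
  define G where "G t y = F0 y + t * (F1 y - F0 y)" for t y
  have lin0: "linear_functional g F0" and lin1: "linear_functional g F1"
    using F0 F1 by (auto simp: frobenius_functional_def)
  have lin: "linear_functional g (G t)" for t
    using lin0 lin1 by (auto simp: linear_functional_def G_def algebra_simps)
  have G01: "G 0 = F0" "G 1 = F1" by (auto simp: G_def fun_eq_iff)
  define line where "line y = [:F0 y, F1 y - F0 y:]" for y
  have line: "poly (line y) t = G t y" for y t by (simp add: line_def G_def)
  define B where "B = mat d d (\<lambda>(j, k). line (lie_bracket (e k) (e j)))"
  have B: "B \<in> carrier_mat d d" by (simp add: B_def)
  have Bt: "poly (B $$ (j, k)) t = kirillov_mat (G t) $$ (j, k)" if "j < d" "k < d" for j k t
    using that by (simp add: B_def kirillov_mat_def line kirillov_form_def)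
  define \<delta> where "\<delta> = det B"
  have \<delta>: "poly \<delta> t = det (kirillov_mat (G t))" for t
    unfolding \<delta>_def by (rule poly_det_cong[OF kirillov_mat_carrier B Bt])
  have adj: "poly (adj_mat B $$ (i, j)) t = adj_mat (kirillov_mat (G t)) $$ (i, j)" if "i < d" "j < d" for i j t
  proof -
    have "poly (det (mat_delete B j i)) t = det (mat_delete (kirillov_mat (G t)) j i)"
      by (rule poly_det_cong[of _ "d - 1"])
         (use that Bt B in \<open>auto simp: mat_delete_def\<close>)
    then show ?thesis using that B
      by (simp add: adj_mat_def cofactor_def)
  qed
  define w where "w k = (\<Sum>j<d. adj_mat B $$ (k, j) * line (e j))" for k
  have w: "poly (w k) t = (adj_mat (kirillov_mat (G t)) *\<^sub>v functional_vec (G t)) $ k" if "k < d" for k t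
  proof -
    have "dim_row (adj_mat (kirillov_mat (G t))) = d" "dim_col (adj_mat (kirillov_mat (G t))) = d"
      using adj_mat(1)[OF kirillov_mat_carrier] by auto
    then show ?thesis using that
      by (simp add: w_def poly_sum adj line scalar_prod_def atLeast0LessThan functional_vec_def)
  qed
  define U where "U i j = (\<Sum>k<d. Polynomial.smult (\<psi> (lie_bracket (e k) (e j)) $ i) (w k))" for i j
  let ?A = "\<lambda>t. ad_mat (principal_element g (G t))"
  have frob: "frobenius_functional n g (G t)" if "poly \<delta> t \<noteq> 0" for t
    using that frobenius_iff_det[OF lin] \<delta> by simp
  have U: "poly (U i j) t = poly \<delta> t * ?A t $$ (i, j)" if "i < d" "j < d" "poly \<delta> t \<noteq> 0" for i j t
  proof -
    let ?adj = "adj_mat (kirillov_mat (G t)) *\<^sub>v functional_vec (G t)"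
    have v: "(1 / poly \<delta> t) \<cdot>\<^sub>v ?adj \<in> carrier_vec d"
      using mult_mat_vec_carrier[OF adj_mat(1)[OF kirillov_mat_carrier] functional_vec_carrier] by simp
    have "\<psi> (principal_element g (G t)) = (1 / poly \<delta> t) \<cdot>\<^sub>v ?adj"
      using principal_element_solve(1)[OF frob[OF that(3)]] \<psi>\<phi>[OF v] by (simp add: \<delta>)
    then have "\<psi> (principal_element g (G t)) $ k = poly (w k) t / poly \<delta> t" if "k < d" for k
      using that w[OF that] carrier_matD(1)[OF adj_mat(1)[OF kirillov_mat_carrier[of "G t"]]] by simp
    then have "?A t $$ (i, j) = (\<Sum>k<d. poly (w k) t / poly \<delta> t * \<psi> (lie_bracket (e k) (e j)) $ i)"
      using ad_mat_index[OF principal_element_solve(2)[OF frob[OF that(3)]] that(1,2)] by simp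
    also have "poly \<delta> t * \<dots> = (\<Sum>k<d. poly (w k) t * \<psi> (lie_bracket (e k) (e j)) $ i)"
      using that(3) by (simp add: sum_distrib_left)
    finally show ?thesis by (simp add: U_def poly_sum mult.commute)
  qed
  have \<delta>01: "poly \<delta> 0 \<noteq> 0" "poly \<delta> 1 \<noteq> 0"
    using F0 F1 frobenius_iff_det[OF lin0] frobenius_iff_det[OF lin1] by (auto simp: \<delta> G01)
  have at_int: "poly (char_poly (?A 0)) (of_int x) = poly (char_poly (?A 1)) (of_int x)" for x :: int
  proof -
    define M where "M = mat d d (\<lambda>(i, j). (if i = j then Polynomial.smult (of_int x) \<delta> else 0) - U i j)"
    have N: "poly (det M) t = poly \<delta> t ^ d * poly (char_poly (?A t)) (of_int x)" if t: "poly \<delta> t \<noteq> 0" for t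
    proof -
      have "poly (det M) t = det (poly \<delta> t \<cdot>\<^sub>m (- char_matrix (?A t) (of_int x)))"
        by (rule poly_det_cong[of _ d])
           (use U[OF _ _ t] in \<open>auto simp: M_def char_matrix_def algebra_simps\<close>)
      also have "\<dots> = poly \<delta> t ^ d * det (- char_matrix (?A t) (of_int x))"
        by (subst det_smult) (simp add: char_matrix_def)
      finally show ?thesis by (simp add: char_poly_matrix[OF ad_mat_carrier])
    qed
    \<comment> \<open>The spare factor \<open>\<delta>\<close> makes \<open>\<delta>(t) \<noteq> 0\<close> follow from the denominator also for \<open>d = 0\<close>.\<close>
    have "\<exists>m::int. poly (det M * \<delta>) t = poly (\<delta> ^ Suc d) t * of_int m" if t: "poly (\<delta> ^ Suc d) t \<noteq> 0" for t
    proof -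
      have t: "poly \<delta> t \<noteq> 0" using t by auto
      have "poly (char_poly (?A t)) (of_int x) \<in> \<int>"
      proof (rule poly_char_poly_int[OF ad_mat_carrier])
        fix \<mu> assume "eigenvalue (?A t) \<mu>"
        then show "\<mu> \<in> \<int>"
          using eigenvalue_ad_mat[OF principal_element_solve(2)[OF frob[OF t]]] integral[OF frob[OF t]] by metis
      qed
      then show ?thesis using N[OF t] by (auto elim!: Ints_cases)
    qed
    moreover have "\<delta> ^ Suc d \<noteq> 0" using \<delta>01 by auto
    ultimately obtain m :: int where "det M * \<delta> = Polynomial.smult (of_int m) (\<delta> ^ Suc d)"
      using integer_valued_poly_quotient_constant by blast
    then have D: "poly (det M) t * poly \<delta> t = of_int m * (poly \<delta> t ^ d * poly \<delta> t)" for t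
      by (metis poly_mult poly_power poly_smult power_Suc2)
    have "poly (char_poly (?A t)) (of_int x) = of_int m" if "poly \<delta> t \<noteq> 0" for t
      using N[OF that] that D[of t] by (auto simp: mult.commute)
    then show ?thesis using \<delta>01 by simp
  qed
  have "char_poly (?A 0) - char_poly (?A 1) = 0"
  proof (rule ccontr)
    assume "char_poly (?A 0) - char_poly (?A 1) \<noteq> 0"
    then have "finite {z. poly (char_poly (?A 0) - char_poly (?A 1)) z = 0}" by (rule poly_roots_finite)
    moreover have "range of_int \<subseteq> {z. poly (char_poly (?A 0) - char_poly (?A 1)) z = 0}"
      using at_int by auto
    ultimately have "finite (range (of_int :: int \<Rightarrow> complex))" by (rule finite_subset[rotated])
    then show False using finite_imageD[of of_int "UNIV :: int set"] by (simp add: inj_on_def)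
  qed
  then show ?thesis by (simp add: G01)
qed

theorem principal_eigenspace_dim_independent:
  assumes F0: "frobenius_functional n g F0" and F1: "frobenius_functional n g F1"
    and integral: "\<And>F x \<mu>. frobenius_functional n g F \<Longrightarrow> x \<in> g \<Longrightarrow> x \<noteq> 0\<^sub>m n n \<Longrightarrow>
      lie_bracket (principal_element g F) x = \<mu> \<cdot>\<^sub>m x \<Longrightarrow> \<mu> \<in> \<int>"
    and semisimple: "\<And>F x k. frobenius_functional n g F \<Longrightarrow> x \<in> g \<Longrightarrow>
      lie_bracket (principal_element g F) (lie_bracket (principal_element g F) x - k \<cdot>\<^sub>m x) =
        k \<cdot>\<^sub>m (lie_bracket (principal_element g F) x - k \<cdot>\<^sub>m x) \<Longrightarrow>
      lie_bracket (principal_element g F) x = k \<cdot>\<^sub>m x"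
  shows "mat_subspace_dim n (principal_eigenspace g F0 k) = mat_subspace_dim n (principal_eigenspace g F1 k)"
  using dim_principal_eigenspace[OF F0 semisimple[OF F0]] dim_principal_eigenspace[OF F1 semisimple[OF F1]]
    char_poly_ad_independent[OF F0 F1 integral] by simp

end

section \<open>Edge functionals on incidence algebras\<close>

definition supported :: "nat \<Rightarrow> (nat \<times> nat) set \<Rightarrow> complex mat set" where
  "supported n S = {x \<in> carrier_mat n n. \<forall>i<n. \<forall>j<n. (i, j) \<notin> S \<longrightarrow> x $$ (i, j) = 0}"

lemma supported_unital_matrix_algebra:
  assumes n: "n > 0" and refl: "\<And>i. i < n \<Longrightarrow> (i, i) \<in> S"
    and trans: "\<And>i j k. i < n \<Longrightarrow> j < n \<Longrightarrow> k < n \<Longrightarrow> (i, j) \<in> S \<Longrightarrow> (j, k) \<in> S \<Longrightarrow> (i, k) \<in> S"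
  shows "unital_matrix_algebra n (supported n S)"
proof
  fix x y assume xy: "x \<in> supported n S" "y \<in> supported n S"
  show "x * y \<in> supported n S"
    unfolding supported_def
  proof (safe)
    show "x * y \<in> carrier_mat n n" using xy by (auto simp: supported_def)
    fix i k assume ik: "i < n" "k < n" "(i, k) \<notin> S"
    have "(x * y) $$ (i, k) = (\<Sum>j<n. x $$ (i, j) * y $$ (j, k))"
      using xy ik by (auto simp: supported_def scalar_prod_def atLeast0LessThan)
    also have "\<dots> = 0"
    proof (intro sum.neutral ballI)
      fix j assume "j \<in> {..<n}"
      then have "(i, j) \<notin> S \<or> (j, k) \<notin> S" using trans[of i j k] ik by auto
      then show "x $$ (i, j) * y $$ (j, k) = 0" using xy ik \<open>j \<in> {..<n}\<close> by (auto simp: supported_def)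
    qed
    finally show "(x * y) $$ (i, k) = 0" .
  qed
next
  show "supported n S \<subseteq> carrier_mat n n" by (auto simp: supported_def)
  have "(1\<^sub>m n :: complex mat) $$ (i, j) = 0" if "i < n" "j < n" "(i, j) \<notin> S" for i j
    using that refl[of i] by (cases "i = j") auto
  then show "1\<^sub>m n \<in> supported n S" by (auto simp: supported_def)
next
  fix x y assume "x \<in> supported n S" "y \<in> supported n S"
  then show "x + y \<in> supported n S" by (auto simp: supported_def)
next
  fix x c assume "x \<in> supported n S"
  then show "c \<cdot>\<^sub>m x \<in> supported n S" by (auto simp: supported_def)
qed (rule n)

lemma traceless_supported_subspace:
  "VectorSpace.subspace class_ring (traceless n (supported n T)) (module_mat TYPE(complex) n n)"
proof -
  have "Module.module class_ring (module_mat TYPE(complex) n n)"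
    by (rule vectorspace.axioms(1)[OF matrix_vs])
  then have "submodule class_ring (traceless n (supported n T)) (module_mat TYPE(complex) n n)"
    by (auto simp: submodule_def module_mat_simps class_ring_simps traceless_def supported_def mat_tr_add mat_tr_smult)
       (simp add: mat_tr_def)
  then show ?thesis by (simp add: VectorSpace.subspace_def matrix_vs)
qed

text \<open>A traceless matrix is determined by its entries other than the one at \<open>(0, 0)\<close>.\<close>

lemma traceless_supported_coordinates:
  assumes n: "n > 0" and T: "T \<subseteq> {..<n} \<times> {..<n}" and diag: "(0, 0) \<in> T \<or> (\<forall>i. (i, i) \<notin> T)"
  defines "g \<equiv> traceless n (supported n T)" and "d \<equiv> card (T - {(0, 0)})"
  obtains \<psi> :: "complex mat \<Rightarrow> complex vec" and \<phi> :: "complex vec \<Rightarrow> complex mat"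
  where "\<And>x. x \<in> g \<Longrightarrow> \<psi> x \<in> carrier_vec d" "\<And>v. v \<in> carrier_vec d \<Longrightarrow> \<phi> v \<in> g"
    "\<And>v. v \<in> carrier_vec d \<Longrightarrow> \<psi> (\<phi> v) = v" "\<And>x. x \<in> g \<Longrightarrow> \<phi> (\<psi> x) = x"
    "\<And>u v. u \<in> carrier_vec d \<Longrightarrow> v \<in> carrier_vec d \<Longrightarrow> \<phi> (u + v) = \<phi> u + \<phi> v"
    "\<And>c v. v \<in> carrier_vec d \<Longrightarrow> \<phi> (c \<cdot>\<^sub>v v) = c \<cdot>\<^sub>m \<phi> v"
proof -
  let ?T = "T - {(0, 0)}"
  have fin: "finite ?T" using T finite_subset by blast
  obtain f where f: "bij_betw f {0..<d} ?T"
    using ex_bij_betw_nat_finite[OF fin] by (auto simp: d_def)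
  define ix where "ix = the_inv_into {0..<d} f"
  have ix: "ix p < d" "f (ix p) = p" if "p \<in> ?T" for p
    using bij_betw_the_inv_into[OF f] f_the_inv_into_f_bij_betw[OF f] that
    by (auto simp: ix_def bij_betw_def)
  have fi: "f k \<in> ?T" "ix (f k) = k" if "k < d" for k
    using bij_betw_apply[OF f] the_inv_into_f_f[OF bij_betw_imp_inj_on[OF f]] that by (simp_all add: ix_def)
  define ent where "ent v p = (if p \<in> ?T then v $ ix p else 0)" for v :: "complex vec" and p
  define \<psi> where "\<psi> x = vec d (\<lambda>k. x $$ f k)" for x :: "complex mat"
  define \<phi> where "\<phi> v = mat n n (\<lambda>p. ent v p - (if p = (0, 0) then (\<Sum>k<n. ent v (k, k)) else 0))" for v
  have ent00: "ent v (0, 0) = 0" for v by (simp add: ent_def)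
  have fn: "f k = (i, j) \<Longrightarrow> k < d \<Longrightarrow> i < n \<and> j < n" for k i j using fi(1)[of k] T by auto
  show ?thesis
  proof
    fix x assume x: "x \<in> g"
    then have xc: "x \<in> carrier_mat n n" "\<And>i j. i < n \<Longrightarrow> j < n \<Longrightarrow> (i, j) \<notin> T \<Longrightarrow> x $$ (i, j) = 0"
      "(\<Sum>i<n. x $$ (i, i)) = 0"
      by (auto simp: g_def traceless_def supported_def mat_tr_def)
    show "\<psi> x \<in> carrier_vec d" by (simp add: \<psi>_def)
    have e: "ent (\<psi> x) (i, j) = x $$ (i, j)" if "i < n" "j < n" "(i, j) \<noteq> (0, 0)" for i j
      using that ix[of "(i, j)"] xc(2) by (auto simp: ent_def \<psi>_def)
    have "(\<Sum>k<n. ent (\<psi> x) (k, k)) = (\<Sum>k\<in>{..<n} - {0}. x $$ (k, k))"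
      using n by (subst sum.remove[of _ 0]) (auto simp: ent00 e intro!: sum.cong)
    also have "\<dots> = - x $$ (0, 0)"
      using xc(3) n by (subst (asm) sum.remove[of _ 0]) (auto simp: eq_neg_iff_add_eq_0 add.commute)
    finally have s: "(\<Sum>k<n. ent (\<psi> x) (k, k)) = - x $$ (0, 0)" .
    show "\<phi> (\<psi> x) = x"
    proof (rule eq_matI)
      fix i j assume "i < dim_row x" "j < dim_col x"
      then have "i < n" "j < n" using xc(1) by auto
      then show "\<phi> (\<psi> x) $$ (i, j) = x $$ (i, j)"
        using e[of i j] s by (cases "(i, j) = (0, 0)") (auto simp: \<phi>_def ent00)
    qed (use xc(1) in \<open>auto simp: \<phi>_def\<close>)
  next
    fix v :: "complex vec" assume v: "v \<in> carrier_vec d"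
    have tr: "mat_tr n (\<phi> v) = 0"
      using n by (simp add: mat_tr_def \<phi>_def sum_subtractf)
    have "\<phi> v $$ (i, j) = 0" if "i < n" "j < n" "(i, j) \<notin> T" for i j
    proof -
      have "(\<Sum>k<n. ent v (k, k)) = 0" if "(0, 0) \<notin> T"
        using diag that by (intro sum.neutral) (auto simp: ent_def)
      moreover have "ent v (i, j) = 0" using that by (simp add: ent_def)
      ultimately show ?thesis using that by (auto simp: \<phi>_def)
    qed
    then show "\<phi> v \<in> g" using tr by (auto simp: g_def traceless_def supported_def) (simp_all add: \<phi>_def)
    show "\<psi> (\<phi> v) = v"
    proof (rule eq_vecI)
      fix k assume "k < dim_vec v"
      then have k: "k < d" using v by simp
      obtain i j where ij: "f k = (i, j)" by fastforce
      have "(i, j) \<in> ?T" "ix (i, j) = k" "i < n" "j < n" using fi[OF k] fn[OF ij k] ij by auto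
      then show "\<psi> (\<phi> v) $ k = v $ k" using k ij by (auto simp: \<psi>_def \<phi>_def ent_def)
    qed (use v in \<open>simp add: \<psi>_def\<close>)
    fix c
    have "ent (c \<cdot>\<^sub>v v) p = c * ent v p" for p
      using v ix by (auto simp: ent_def)
    then show "\<phi> (c \<cdot>\<^sub>v v) = c \<cdot>\<^sub>m \<phi> v"
      by (intro eq_matI) (auto simp: \<phi>_def sum_distrib_left right_diff_distrib)
  next
    fix u v :: "complex vec" assume uv: "u \<in> carrier_vec d" "v \<in> carrier_vec d"
    have "ent (u + v) p = ent u p + ent v p" for p
      using uv ix by (auto simp: ent_def)
    then show "\<phi> (u + v) = \<phi> u + \<phi> v"
      by (intro eq_matI) (auto simp: \<phi>_def sum.distrib)
  qed
qed

lemma dim_traceless_supported: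
  assumes n: "n > 0" and T: "T \<subseteq> {..<n} \<times> {..<n}" and diag: "(0, 0) \<in> T \<or> (\<forall>i. (i, i) \<notin> T)"
  shows "mat_subspace_dim n (traceless n (supported n T)) = card (T - {(0, 0)})"
proof -
  let ?g = "traceless n (supported n T)" and ?d = "card (T - {(0, 0)})"
  obtain \<psi> \<phi> where c: "\<And>x. x \<in> ?g \<Longrightarrow> \<psi> x \<in> carrier_vec ?d" "\<And>v. v \<in> carrier_vec ?d \<Longrightarrow> \<phi> v \<in> ?g"
    "\<And>v. v \<in> carrier_vec ?d \<Longrightarrow> \<psi> (\<phi> v) = v" "\<And>x. x \<in> ?g \<Longrightarrow> \<phi> (\<psi> x) = x"
    "\<And>u v. u \<in> carrier_vec ?d \<Longrightarrow> v \<in> carrier_vec ?d \<Longrightarrow> \<phi> (u + v) = \<phi> u + \<phi> v"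
    "\<And>c v. v \<in> carrier_vec ?d \<Longrightarrow> \<phi> (c \<cdot>\<^sub>v v) = c \<cdot>\<^sub>m \<phi> v"
    by (rule traceless_supported_coordinates[OF assms]) blast
  have "bij_betw \<phi> (carrier_vec ?d) ?g"
    by (rule bij_betw_byWitness[where f' = \<psi>]) (use c in auto)
  then show ?thesis using c by (intro mat_subspace_dim_eq_card[OF traceless_supported_subspace])
qed

definition edge_functional :: "(nat \<times> nat) set \<Rightarrow> complex mat \<Rightarrow> complex" where
  "edge_functional E x = (\<Sum>e\<in>E. x $$ e)"

lemma edge_functional_linear:
  assumes "E \<subseteq> {..<n} \<times> {..<n}" and "g \<subseteq> carrier_mat n n"
  shows "linear_functional g (edge_functional E)"
proof -
  have "edge_functional E (x + y) = edge_functional E x + edge_functional E y"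
    if "x \<in> g" "y \<in> g" for x y
    unfolding edge_functional_def sum.distrib[symmetric]
  proof (rule sum.cong)
    fix e assume "e \<in> E"
    then obtain i j where "e = (i, j)" "i < n" "j < n" using assms by auto
    moreover have "y \<in> carrier_mat n n" using that assms by auto
    ultimately show "(x + y) $$ e = x $$ e + y $$ e" by simp
  qed simp
  moreover have "edge_functional E (c \<cdot>\<^sub>m x) = c * edge_functional E x" if "x \<in> g" for x c
    unfolding edge_functional_def sum_distrib_left
  proof (rule sum.cong)
    fix e assume "e \<in> E"
    then obtain i j where "e = (i, j)" "i < n" "j < n" using assms by auto
    moreover have "x \<in> carrier_mat n n" using that assms by auto
    ultimately show "(c \<cdot>\<^sub>m x) $$ e = c * x $$ e" by simp
  qed simp
  ultimately show ?thesis by (simp add: linear_functional_def)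
qed

definition unit_mat :: "nat \<Rightarrow> nat \<Rightarrow> nat \<Rightarrow> complex mat" where
  "unit_mat n i j = mat n n (\<lambda>(k, l). if k = i \<and> l = j then 1 else 0)"

text \<open>Testing the radical on a matrix unit leaves one term for each edge into the column index and one
  for each edge out of the row index.\<close>

lemma edge_functional_bracket_unit_mat:
  assumes x: "x \<in> carrier_mat n n" and ij: "i < n" "j < n" and E: "E \<subseteq> {..<n} \<times> {..<n}"
  shows "edge_functional E (lie_bracket x (unit_mat n i j)) =
    (\<Sum>u | (u, j) \<in> E. x $$ (u, i)) - (\<Sum>v | (i, v) \<in> E. x $$ (j, v))"
proof -
  have finE: "finite E" using E finite_subset by blast
  have u: "unit_mat n i j \<in> carrier_mat n n" by (simp add: unit_mat_def)
  have 1: "(x * unit_mat n i j) $$ (k, l) = (if l = j then x $$ (k, i) else 0)" if "k < n" "l < n" for k l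
  proof -
    have "(x * unit_mat n i j) $$ (k, l) = (\<Sum>q<n. x $$ (k, q) * (if q = i \<and> l = j then 1 else 0))"
      using that x u by (simp add: scalar_prod_def atLeast0LessThan) (simp add: unit_mat_def)
    also have "\<dots> = (\<Sum>q<n. if q = i then (if l = j then x $$ (k, i) else 0) else 0)"
      by (intro sum.cong) auto
    finally show ?thesis using ij by simp
  qed
  have 2: "(unit_mat n i j * x) $$ (k, l) = (if k = i then x $$ (j, l) else 0)" if "k < n" "l < n" for k l
  proof -
    have "(unit_mat n i j * x) $$ (k, l) = (\<Sum>q<n. (if k = i \<and> q = j then 1 else 0) * x $$ (q, l))"
      using that x u by (simp add: scalar_prod_def atLeast0LessThan) (simp add: unit_mat_def)
    also have "\<dots> = (\<Sum>q<n. if q = j then (if k = i then x $$ (j, l) else 0) else 0)"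
      by (intro sum.cong) auto
    finally show ?thesis using ij by simp
  qed
  have "edge_functional E (lie_bracket x (unit_mat n i j)) =
    (\<Sum>(k, l)\<in>E. (if l = j then x $$ (k, i) else 0) - (if k = i then x $$ (j, l) else 0))"
    unfolding edge_functional_def
  proof (rule sum.cong)
    fix e assume "e \<in> E"
    moreover obtain k l where kl: "e = (k, l)" by fastforce
    ultimately have "k < n" "l < n" using E by auto
    then show "lie_bracket x (unit_mat n i j) $$ e =
      (case e of (k, l) \<Rightarrow> (if l = j then x $$ (k, i) else 0) - (if k = i then x $$ (j, l) else 0))"
      using x u 1[of k l] 2[of k l] by (simp add: kl lie_bracket_def del: index_mult_mat(1))
  qed simp
  also have "\<dots> = (\<Sum>(k, l)\<in>E. if l = j then x $$ (k, i) else 0) - (\<Sum>(k, l)\<in>E. if k = i then x $$ (j, l) else 0)"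
    by (simp add: sum_subtractf case_prod_unfold)
  also have "(\<Sum>(k, l)\<in>E. if l = j then x $$ (k, i) else 0) = (\<Sum>(k, l)\<in>{e \<in> E. snd e = j}. x $$ (k, i))"
    by (intro sum.mono_neutral_cong_right finE) (auto split: if_splits)
  also have "\<dots> = (\<Sum>u | (u, j) \<in> E. x $$ (u, i))"
    by (rule sum.reindex_bij_witness[where i = "\<lambda>u. (u, j)" and j = fst]) auto
  also have "(\<Sum>(k, l)\<in>E. if k = i then x $$ (j, l) else 0) = (\<Sum>(k, l)\<in>{e \<in> E. fst e = i}. x $$ (j, l))"
    by (intro sum.mono_neutral_cong_right finE) (auto split: if_splits)
  also have "\<dots> = (\<Sum>v | (i, v) \<in> E. x $$ (j, v))"
    by (rule sum.reindex_bij_witness[where i = "\<lambda>v. (i, v)" and j = snd]) auto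
  finally show ?thesis .
qed

definition weight_mat :: "nat \<Rightarrow> (nat \<Rightarrow> int) \<Rightarrow> complex mat" where
  "weight_mat n d = mat n n (\<lambda>(i, j). if i = j then of_int (d i) - (\<Sum>k<n. of_int (d k)) / of_nat n else 0)"

lemma lie_bracket_weight_mat:
  assumes x: "x \<in> carrier_mat n n" and ij: "i < n" "j < n"
  shows "lie_bracket (weight_mat n d) x $$ (i, j) = of_int (d i - d j) * x $$ (i, j)"
proof -
  let ?w = "\<lambda>i. of_int (d i) - (\<Sum>k<n. of_int (d k)) / of_nat n :: complex"
  have w: "weight_mat n d \<in> carrier_mat n n" by (simp add: weight_mat_def)
  have "(weight_mat n d * x) $$ (i, j) = (\<Sum>q<n. (if i = q then ?w i else 0) * x $$ (q, j))"
    using ij x w by (simp add: scalar_prod_def atLeast0LessThan) (simp add: weight_mat_def)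
  also have "\<dots> = (\<Sum>q<n. if q = i then ?w i * x $$ (i, j) else 0)" by (intro sum.cong) auto
  finally have 1: "(weight_mat n d * x) $$ (i, j) = ?w i * x $$ (i, j)" using ij by simp
  have "(x * weight_mat n d) $$ (i, j) = (\<Sum>q<n. x $$ (i, q) * (if q = j then ?w q else 0))"
    using ij x w by (simp add: scalar_prod_def atLeast0LessThan) (simp add: weight_mat_def)
  also have "\<dots> = (\<Sum>q<n. if q = j then ?w j * x $$ (i, j) else 0)" by (intro sum.cong) auto
  finally have 2: "(x * weight_mat n d) $$ (i, j) = ?w j * x $$ (i, j)" using ij by simp
  show ?thesis using x w ij
    by (simp add: lie_bracket_def 1 2 del: index_mult_mat(1)) (simp add: algebra_simps)
qed

lemma keys_sum_zpow:
  assumes "finite T"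
  shows "Poly_Mapping.keys (\<Sum>p\<in>T. zpow (f p)) = f ` T"
proof -
  have "Poly_Mapping.lookup (\<Sum>p\<in>T. zpow (f p)) k = int (card {p \<in> T. f p = k})" for k
  proof -
    have "Poly_Mapping.lookup (\<Sum>p\<in>T. zpow (f p)) k = (\<Sum>p\<in>T. if f p = k then 1 else 0)"
      by (simp add: lookup_sum zpow_def lookup_single when_def eq_commute[of k])
    also have "\<dots> = (\<Sum>p\<in>{p \<in> T. f p = k}. 1)"
      using assms by (intro sum.mono_neutral_cong_right) auto
    finally show ?thesis by simp
  qed
  then show ?thesis using assms by (auto simp: in_keys_iff)
qed

text \<open>An edge functional whose edges have weight difference one has the diagonal matrix of the weights,
  shifted to trace zero, as principal element. The last assumption is nondegeneracy, spelled out on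
  matrix units.\<close>

locale weighted_edge_functional =
  fixes n :: nat and S E :: "(nat \<times> nat) set" and d :: "nat \<Rightarrow> int"
  assumes n: "n > 0" and S: "S \<subseteq> {..<n} \<times> {..<n}"
    and refl: "i < n \<Longrightarrow> (i, i) \<in> S"
    and trans: "(i, j) \<in> S \<Longrightarrow> (j, k) \<in> S \<Longrightarrow> (i, k) \<in> S"
    and E: "E \<subseteq> S" and weight: "(i, j) \<in> E \<Longrightarrow> d i - d j = 1"
    and radical: "x \<in> traceless n (supported n S) \<Longrightarrow>
      (\<And>i j. (i, j) \<in> S \<Longrightarrow> (\<Sum>u | (u, j) \<in> E. x $$ (u, i)) = (\<Sum>v | (i, v) \<in> E. x $$ (j, v))) \<Longrightarrow>
      x = 0\<^sub>m n n"
begin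

abbreviation "g \<equiv> traceless n (supported n S)"
abbreviation "F\<^sub>0 \<equiv> edge_functional E"

sublocale alg: unital_matrix_algebra n "supported n S"
  by (rule supported_unital_matrix_algebra[OF n]) (use refl trans in blast)+

lemma finite_S: "finite S"
  using S finite_subset by blast

lemma g_carrier: "g \<subseteq> carrier_mat n n"
  by (auto simp: traceless_def supported_def)

lemma E_index: "E \<subseteq> {..<n} \<times> {..<n}"
  using E S by blast

lemma frobenius_edge_functional: "frobenius_functional n g F\<^sub>0"
  unfolding frobenius_functional_def
proof (intro conjI ballI impI)
  show "linear_functional g F\<^sub>0" by (rule edge_functional_linear[OF E_index g_carrier])
  fix x assume x: "x \<in> g" and rad: "\<forall>y\<in>g. kirillov_form F\<^sub>0 x y = 0"
  have xA: "x \<in> supported n S" and xc: "x \<in> carrier_mat n n" using x g_carrier by (auto simp: traceless_def)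
  show "x = 0\<^sub>m n n"
  proof (rule radical[OF x])
    fix i j assume ij: "(i, j) \<in> S"
    then have ij': "i < n" "j < n" using S by auto
    have u: "unit_mat n i j \<in> supported n S" using ij by (auto simp: supported_def unit_mat_def)
    have "F\<^sub>0 (lie_bracket x (alg.traceless_part (unit_mat n i j))) = 0"
      using rad alg.traceless_part_mem[OF u] by (simp add: kirillov_form_def)
    then have "0 = F\<^sub>0 (lie_bracket x (unit_mat n i j))"
      by (simp add: alg.bracket_traceless_part(1)[OF xA u])
    then show "(\<Sum>u | (u, j) \<in> E. x $$ (u, i)) = (\<Sum>v | (i, v) \<in> E. x $$ (j, v))"
      unfolding edge_functional_bracket_unit_mat[OF xc ij' E_index] by simp
  qed
qed

lemma weight_mat_mem: "weight_mat n d \<in> g"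
proof -
  have "mat_tr n (weight_mat n d) = 0"
    using n by (simp add: mat_tr_def weight_mat_def sum_subtractf)
  moreover have "weight_mat n d \<in> supported n S"
    using refl by (auto simp: supported_def weight_mat_def)
  ultimately show ?thesis by (simp add: traceless_def)
qed

lemma weight_mat_principal:
  assumes x: "x \<in> g" shows "F\<^sub>0 (lie_bracket (weight_mat n d) x) = F\<^sub>0 x"
  unfolding edge_functional_def
proof (rule sum.cong)
  fix e assume e: "e \<in> E"
  then obtain i j where ij: "e = (i, j)" "i < n" "j < n" using E_index by auto
  have "x \<in> carrier_mat n n" using x g_carrier by auto
  then show "lie_bracket (weight_mat n d) x $$ e = x $$ e"
    using lie_bracket_weight_mat[of x n i j d] ij(2,3) e unfolding ij(1) by (simp only: weight of_int_1 mult_1_left)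
qed simp

definition graded_positions :: "int \<Rightarrow> (nat \<times> nat) set" where
  "graded_positions k = {(i, j) \<in> S. d i - d j = k}"

lemma weight_mat_eigenspace:
  "{x \<in> g. lie_bracket (weight_mat n d) x = of_int k \<cdot>\<^sub>m x} = traceless n (supported n (graded_positions k))"
proof (intro equalityI subsetI)
  fix x assume "x \<in> {x \<in> g. lie_bracket (weight_mat n d) x = of_int k \<cdot>\<^sub>m x}"
  then have x: "x \<in> g" and eig: "lie_bracket (weight_mat n d) x = of_int k \<cdot>\<^sub>m x" by auto
  have xc: "x \<in> carrier_mat n n" using x g_carrier by auto
  have "x $$ (i, j) = 0" if ij: "i < n" "j < n" "(i, j) \<notin> graded_positions k" for i j
  proof (cases "(i, j) \<in> S")
    case True
    then have "d i - d j \<noteq> k" using ij by (simp add: graded_positions_def)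
    then have "of_int (d i - d j) \<noteq> (of_int k :: complex)" by (simp only: of_int_eq_iff not_False_eq_True)
    moreover have "lie_bracket (weight_mat n d) x $$ (i, j) = of_int k * x $$ (i, j)"
      unfolding eig using xc ij by simp
    then have "of_int (d i - d j) * x $$ (i, j) = of_int k * x $$ (i, j)"
      by (simp only: lie_bracket_weight_mat[OF xc ij(1,2)])
    ultimately show ?thesis by (simp only: mult_cancel_right simp_thms)
  next
    case False
    then show ?thesis using x ij by (simp add: traceless_def supported_def)
  qed
  then show "x \<in> traceless n (supported n (graded_positions k))"
    using x xc by (simp add: traceless_def supported_def)
next
  fix x assume x: "x \<in> traceless n (supported n (graded_positions k))"
  then have xc: "x \<in> carrier_mat n n" by (simp add: traceless_def supported_def)
  have xg: "x \<in> g" using x by (auto simp: traceless_def supported_def graded_positions_def)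
  have "lie_bracket (weight_mat n d) x = of_int k \<cdot>\<^sub>m x"
  proof (rule eq_matI)
    fix i j assume "i < dim_row (of_int k \<cdot>\<^sub>m x)" "j < dim_col (of_int k \<cdot>\<^sub>m x)"
    then have ij: "i < n" "j < n" using xc by auto
    show "lie_bracket (weight_mat n d) x $$ (i, j) = (of_int k \<cdot>\<^sub>m x) $$ (i, j)"
    proof (cases "(i, j) \<in> graded_positions k")
      case True
      then have "d i - d j = k" by (simp add: graded_positions_def)
      then show ?thesis using lie_bracket_weight_mat[OF xc ij, of d] ij xc by (simp del: of_int_diff)
    next
      case False
      then have "x $$ (i, j) = 0" using x ij by (simp add: traceless_def supported_def)
      then show ?thesis using lie_bracket_weight_mat[OF xc ij, of d] ij xc by simp
    qed
  qed (use xc in \<open>auto simp: lie_bracket_def weight_mat_def\<close>)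
  then show "x \<in> {x \<in> g. lie_bracket (weight_mat n d) x = of_int k \<cdot>\<^sub>m x}" using xg by simp
qed

theorem frobenius: "frobenius n g"
  unfolding frobenius_def using alg.traceless_lie_subalgebra frobenius_edge_functional by blast

theorem dim_algebra: "mat_subspace_dim n g = card (S - {(0, 0)})"
  using refl n by (intro dim_traceless_supported S) auto

text \<open>By independence of the functional it suffices to look at the edge functional, whose principal
  element is diagonal.\<close>

theorem dim_principal_eigenspace:
  assumes F: "frobenius_functional n g F"
  shows "mat_subspace_dim n (principal_eigenspace g F k) = card (graded_positions k - {(0, 0)})"
proof -
  let ?d = "card (S - {(0, 0)})"
  have diag: "(0, 0) \<in> S \<or> (\<forall>i. (i, i) \<notin> S)" using refl n by blast
  obtain \<psi> \<phi> where c: "\<And>x. x \<in> g \<Longrightarrow> \<psi> x \<in> carrier_vec ?d" "\<And>v. v \<in> carrier_vec ?d \<Longrightarrow> \<phi> v \<in> g"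
    "\<And>v. v \<in> carrier_vec ?d \<Longrightarrow> \<psi> (\<phi> v) = v" "\<And>x. x \<in> g \<Longrightarrow> \<phi> (\<psi> x) = x"
    "\<And>u v. u \<in> carrier_vec ?d \<Longrightarrow> v \<in> carrier_vec ?d \<Longrightarrow> \<phi> (u + v) = \<phi> u + \<phi> v"
    "\<And>c v. v \<in> carrier_vec ?d \<Longrightarrow> \<phi> (c \<cdot>\<^sub>v v) = c \<cdot>\<^sub>m \<phi> v"
    by (rule traceless_supported_coordinates[OF n S diag]) blast
  interpret coordinatised_lie_algebra n ?d g \<psi> \<phi>
    by (rule coordinatised_lie_algebra.intro[OF alg.traceless_lie_subalgebra c])
  have fma: "frobenius_matrix_algebra n (supported n S) G (principal_element g G)"
    if "frobenius_functional n g G" for G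
    by unfold_locales (use that principal_element_solve(2,3)[OF that] in auto)
  have "mat_subspace_dim n (principal_eigenspace g F k) = mat_subspace_dim n (principal_eigenspace g F\<^sub>0 k)"
  proof (rule principal_eigenspace_dim_independent[OF F frobenius_edge_functional])
    fix G x \<mu> assume G: "frobenius_functional n g G" "x \<in> g" "x \<noteq> 0\<^sub>m n n"
      "lie_bracket (principal_element g G) x = \<mu> \<cdot>\<^sub>m x"
    show "\<mu> \<in> \<int>"
      by (rule frobenius_matrix_algebra.principal_ad_integral[OF fma[OF G(1)] g_dim[OF G(2)] G(3,4)])
  next
    fix G x k assume G: "frobenius_functional n g G" "x \<in> g"
      "lie_bracket (principal_element g G) (lie_bracket (principal_element g G) x - k \<cdot>\<^sub>m x) =
        k \<cdot>\<^sub>m (lie_bracket (principal_element g G) x - k \<cdot>\<^sub>m x)"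
    show "lie_bracket (principal_element g G) x = k \<cdot>\<^sub>m x"
      by (rule frobenius_matrix_algebra.principal_ad_semisimple[OF fma[OF G(1)] g_dim[OF G(2)] G(3)])
  qed
  also have "principal_element g F\<^sub>0 = weight_mat n d"
    by (rule principal_elementI[OF frobenius_edge_functional weight_mat_mem weight_mat_principal])
  then have "principal_eigenspace g F\<^sub>0 k = traceless n (supported n (graded_positions k))"
    by (simp add: principal_eigenspace_def weight_mat_eigenspace)
  also have "mat_subspace_dim n \<dots> = card (graded_positions k - {(0, 0)})"
    using refl n S by (intro dim_traceless_supported n) (auto simp: graded_positions_def)
  finally show ?thesis .
qed

theorem ooms_polynomial_eq:
  assumes F: "frobenius_functional n g F"
  shows "ooms_polynomial n g F = (\<Sum>(i, j)\<in>S - {(0, 0)}. zpow (d i - d j))"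
proof -
  let ?T = "S - {(0, 0)}" and ?f = "\<lambda>(i, j). d i - d j"
  let ?c = "\<lambda>k. of_nat (card (graded_positions k - {(0, 0)})) * zpow k"
  have T: "finite ?T" using finite_S by simp
  have gr: "graded_positions k - {(0, 0)} = {p \<in> ?T. ?f p = k}" for k
    by (auto simp: graded_positions_def)
  have "ooms_polynomial n g F = Sum_any ?c"
    by (simp add: ooms_polynomial_def dim_principal_eigenspace[OF F])
  also have "\<dots> = (\<Sum>k\<in>?f ` ?T. ?c k)"
  proof (rule Sum_any.expand_superset)
    show "{k. ?c k \<noteq> 0} \<subseteq> ?f ` ?T"
    proof
      fix k assume "k \<in> {k. ?c k \<noteq> 0}"
      then have "graded_positions k - {(0, 0)} \<noteq> {}" by (intro notI) simp
      then show "k \<in> ?f ` ?T" unfolding gr by blast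
    qed
  qed (use T in simp)
  also have "\<dots> = (\<Sum>k\<in>?f ` ?T. \<Sum>p\<in>{p \<in> ?T. ?f p = k}. zpow (?f p))"
    unfolding gr by (intro sum.cong) auto
  also have "\<dots> = (\<Sum>p\<in>?T. zpow (?f p))"
    using T by (intro sum.group) auto
  finally show ?thesis by (simp add: case_prod_unfold)
qed

lemma keys_ooms_polynomial:
  assumes F: "frobenius_functional n g F"
  shows "Poly_Mapping.keys (ooms_polynomial n g F) = (\<lambda>(i, j). d i - d j) ` (S - {(0, 0)})"
  using keys_sum_zpow[of "S - {(0, 0)}" "\<lambda>(i, j). d i - d j"] finite_S
  by (simp add: ooms_polynomial_eq[OF F] case_prod_unfold)

end

section \<open>The radical equations of a seaweed with a zigzag tail\<close>

text \<open>The shift relation moves entries along the block diagonals in steps of \<open>h\<close>. A block diagonal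
  below the main one starts in the first block column, where the relation reads zero; one above the
  main diagonal ends in the last block column, where \<open>Q\<close> is zero.\<close>

lemma toeplitz_block_diagonal:
  fixes Q :: "nat \<Rightarrow> nat \<Rightarrow> complex"
  assumes h: "h > 0" and K: "K = h * c"
    and shift: "\<And>j i. j < K \<Longrightarrow> i < K + h \<Longrightarrow> Q (j + h) i = (if h \<le> i then Q j (i - h) else 0)"
    and last: "\<And>j i. j < K \<Longrightarrow> K \<le> i \<Longrightarrow> i < K + h \<Longrightarrow> Q j i = 0"
    and q: "q \<le> c" and s: "s < h" and i: "i < K + h"
  shows "Q (q * h + s) i = (if i div h = q then Q s (i mod h) else 0)"
proof -
  have down: "Q (q * h + s) i = (if q * h \<le> i then Q s (i - q * h) else 0)"
    if "q \<le> c" "i < K + h" "s < h" for q s i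
    using that
  proof (induction q arbitrary: i)
    case (Suc q)
    have "q * h + s < K" using mult_le_mono1[OF Suc.prems(1), of h] Suc.prems(3) by (simp add: K mult.commute)
    then have "Q (q * h + s + h) i = (if h \<le> i then Q (q * h + s) (i - h) else 0)"
      using Suc.prems by (intro shift) auto
    moreover have "q * h + s + h = Suc q * h + s" by simp
    ultimately have "Q (Suc q * h + s) i = (if h \<le> i then Q (q * h + s) (i - h) else 0)" by (simp only:)
    moreover have "Q (q * h + s) (i - h) = (if q * h \<le> i - h then Q s (i - h - q * h) else 0)"
      using Suc.prems by (intro Suc.IH) auto
    ultimately show ?case by auto
  qed simp
  have far: "Q s l = 0" if "h \<le> l" "l < K + h" "s < h" for s l
  proof -
    define t where "t = l div h"
    have t: "t \<ge> 1" "t \<le> c"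
      using that h div_le_mono[OF that(1), of h] less_mult_imp_div_less[of l "Suc c" h] by (auto simp: t_def K mult.commute)
    have l: "t * h \<le> l" "l < t * h + h"
      using div_mult_mod_eq[of l h] mod_less_divisor[OF h, of l] unfolding t_def by linarith+
    define q where "q = c - t"
    have K': "K = q * h + t * h" using t by (simp add: K q_def distrib_right[symmetric] mult.commute[of h])
    have "h \<le> t * h" using t by simp
    then have "q * h + s < K" using that K' by linarith
    moreover have "K \<le> l + q * h" "l + q * h < K + h" using l K' by linarith+
    ultimately have "Q (q * h + s) (l + q * h) = 0" by (rule last)
    moreover have "Q (q * h + s) (l + q * h) = Q s l"
      using down[of q "l + q * h" s] that \<open>l + q * h < K + h\<close> by (simp add: q_def)
    ultimately show ?thesis by simp
  qed
  show ?thesis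
  proof (cases "i div h = q")
    case True
    then have "i = q * h + i mod h" using div_mult_mod_eq[of i h] by simp
    then have "q * h \<le> i" "i - q * h = i mod h" by linarith+
    then show ?thesis using down[OF q i s] True by simp
  next
    case False
    show ?thesis
    proof (cases "q * h \<le> i")
      case True
      have "i \<ge> q * h + h"
      proof (rule ccontr)
        assume "\<not> i \<ge> q * h + h"
        then have "i div h = q" using True by (intro div_nat_eqI) (auto simp: mult.commute)
        with False show False ..
      qed
      then have "Q s (i - q * h) = 0" using i s by (intro far) auto
      then show ?thesis using down[OF q i s] False by simp
    qed (use down[OF q i s] False in simp)
  qed
qed

text \<open>The core has \<open>ab\<close> indices in \<open>b\<close> groups of \<open>a\<close>, and \<open>P\<close> vanishes in the columns of the last
  group outside its rows. The edges of step \<open>a\<close> yield a block Toeplitz relation, so \<open>P\<close> is block diagonal with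
  equal blocks. The edges of step one inside the last group yield a Toeplitz relation for that block.\<close>

lemma core_radical_scalar:
  fixes P :: "nat \<Rightarrow> nat \<Rightarrow> complex"
  assumes a: "a \<ge> 2" and b: "b \<ge> 2"
  defines "K \<equiv> a * (b - 1)" and "N \<equiv> a * b"
  assumes supp: "\<And>i j. i < K \<Longrightarrow> K \<le> j \<Longrightarrow> j < N \<Longrightarrow> P i j = 0" "\<And>i. i < N - 1 \<Longrightarrow> P i (N - 1) = 0"
    and rows: "\<And>i j. j < K \<Longrightarrow> i < N \<Longrightarrow>
      P (j + a) i = (if a \<le> i then P j (i - a) else 0) + (if K < i then P j (i - 1) else 0)"
    and block: "\<And>i j. K \<le> j \<Longrightarrow> j < N - 1 \<Longrightarrow> K \<le> i \<Longrightarrow> i < N \<Longrightarrow>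
      P (j + 1) i = P j (i - a) + (if K < i then P j (i - 1) else 0)"
    and ij: "i < N" "j < N"
  shows "P i j = (if i = j then P 0 0 else 0)"
proof -
  have N: "N = K + a" using b by (cases b) (auto simp: N_def K_def)
  have aK: "a \<le> K" using b by (auto simp: K_def)
  have shift: "P (j + a) i = (if a \<le> i then P j (i - a) else 0)" if "j < K" "i < K + a" for i j
  proof -
    have "P j (i - 1) = 0" if "K < i" using that \<open>j < K\<close> \<open>i < K + a\<close> by (intro supp) (auto simp: N)
    then show ?thesis using rows[of j i] that by (simp add: N)
  qed
  have toep: "P (q * a + s) i = (if i div a = q then P s (i mod a) else 0)"
    if "q \<le> b - 1" "s < a" "i < K + a" for q s i
    by (rule toeplitz_block_diagonal[where K = K and c = "b - 1"])
       (use a shift supp(1) that in \<open>auto simp: K_def N\<close>)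
  have Kq: "K = (b - 1) * a" by (simp add: K_def mult.commute)
  have PK: "P (K + s) (K + l) = P s l" if "s < a" "l < a" for s l
    using toep[of "b - 1" s "K + l"] that a by (simp add: Kq)
  have inner: "P s l = (if s = l then P 0 0 else 0)" if "s < a" "l < a" for s l
  proof -
    have "P (s * 1 + 0) l = (if l div 1 = s then P 0 (l mod 1) else 0)"
    proof (rule toeplitz_block_diagonal[where K = "a - 1" and c = "a - 1" and h = 1 and Q = P])
      fix j i assume ji: "j < a - 1" "i < a - 1 + 1"
      have "P (K + j + 1) (K + i) = P (K + j) (K + i - a) + (if K < K + i then P (K + j) (K + i - 1) else 0)"
        using ji a by (intro block) (auto simp: N)
      moreover have "P (K + j) (K + i - a) = 0"
      proof -
        obtain c where c: "b = Suc (Suc c)" using b by (metis Suc_le_D numeral_2_eq_2 Suc_le_mono)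
        then have "K + i - a = c * a + i" by (simp add: K_def algebra_simps)
        then have "(K + i - a) div a \<noteq> b - 1" using c ji a by simp
        then show ?thesis using toep[of "b - 1" j "K + i - a"] ji by (simp add: Kq)
      qed
      moreover have "P (K + j + 1) (K + i) = P (j + 1) i" using PK[of "j + 1" i] ji by simp
      moreover have "P (K + j) (K + i - 1) = P j (i - 1)" if "i \<noteq> 0" using PK[of j "i - 1"] ji that by simp
      ultimately show "P (j + 1) i = (if 1 \<le> i then P j (i - 1) else 0)" by auto
    next
      fix j i assume "j < a - 1" "a - 1 \<le> i" "i < a - 1 + 1"
      then have "i = a - 1" by simp
      then have "P j i = P (K + j) (N - 1)" using PK[of j i] \<open>j < a - 1\<close> by (simp add: N)
      also have "\<dots> = 0" using \<open>j < a - 1\<close> by (intro supp) (simp add: N)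
      finally show "P j i = 0" .
    qed (use that in auto)
    then show ?thesis by auto
  qed
  have q: "i div a \<le> b - 1" using ij(1) a less_mult_imp_div_less[of i b a] by (simp add: N_def mult.commute)
  have m: "i mod a < a" "j mod a < a" using a by auto
  have "P i j = P (i div a * a + i mod a) j" by simp
  also have "\<dots> = (if j div a = i div a then P (i mod a) (j mod a) else 0)"
    using ij(2) by (intro toep q m) (simp add: N)
  also have "\<dots> = (if i = j then P 0 0 else 0)"
    unfolding inner[OF m] by (metis div_mult_mod_eq)
  finally show ?thesis .
qed

definition core_positions :: "nat \<Rightarrow> nat \<Rightarrow> (nat \<times> nat) set" where
  "core_positions K N = {(i, j). i < N \<and> j < N \<and> (j < K \<or> K \<le> i \<and> (j < N - 1 \<or> i = N - 1))}"

text \<open>Edges are pairs (row, column): those of step \<open>a\<close> join consecutive groups, those of step one join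
  the members of the last group.\<close>

definition core_edges :: "nat \<Rightarrow> nat \<Rightarrow> nat \<Rightarrow> (nat \<times> nat) set" where
  "core_edges a K N = {(u, v). u = v + a \<and> v < K \<or> u = v + 1 \<and> K \<le> v \<and> v < N - 1}"

text \<open>The tail is the path \<open>N - 1, N, N + 1, \<dots>\<close> that starts at the last index of the core, with edges of
  alternating direction: even steps come from blocks above the diagonal, odd ones from blocks below.\<close>

definition tail_edge :: "nat \<Rightarrow> nat \<Rightarrow> nat \<times> nat" where
  "tail_edge N s = (if even s then (N - 1 + s, N + s) else (N + s, N - 1 + s))"

text \<open>The seaweed \<open>q(ab, 2\<^sup>r | a(b - 1), a - 1, 2\<^sup>r, 1)\<close> inside \<open>gl\<close> of size \<open>ab + 2r\<close>, with \<open>N = ab\<close> and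
  \<open>K = a(b - 1)\<close>. Outside the core it has only the diagonal and the edges of the tail.\<close>

definition seaweed_positions :: "nat \<Rightarrow> nat \<Rightarrow> nat \<Rightarrow> (nat \<times> nat) set" where
  "seaweed_positions K N r = core_positions K N \<union> {(i, j). i = j \<and> N \<le> i \<and> i < N + 2 * r} \<union> tail_edge N ` {..<2 * r}"

definition seaweed_edges :: "nat \<Rightarrow> nat \<Rightarrow> nat \<Rightarrow> nat \<Rightarrow> (nat \<times> nat) set" where
  "seaweed_edges a K N r = core_edges a K N \<union> tail_edge N ` {..<2 * r}"

lemma sum_eq_single:
  assumes "finite A" "u \<in> A" "\<And>v. v \<in> A \<Longrightarrow> v \<noteq> u \<Longrightarrow> f v = 0"
  shows "sum f A = (f u :: complex)"
  using assms by (simp add: sum.remove[of A u])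

lemma tail_edge_image_iff:
  assumes N: "N > 0"
  shows "(u, v) \<in> tail_edge N ` {..<2 * r} \<longleftrightarrow>
    u + 1 = v \<and> N \<le> v \<and> v < N + 2 * r \<and> even (v - N) \<or>
    v + 1 = u \<and> N \<le> u \<and> u < N + 2 * r \<and> odd (u - N)" (is "_ \<longleftrightarrow> ?R")
proof
  assume "(u, v) \<in> tail_edge N ` {..<2 * r}"
  then obtain s where "s < 2 * r" "(u, v) = tail_edge N s" by auto
  then show ?R using N by (cases "even s") (auto simp: tail_edge_def)
next
  assume ?R
  then show "(u, v) \<in> tail_edge N ` {..<2 * r}"
  proof (elim disjE conjE)
    assume *: "u + 1 = v" "N \<le> v" "v < N + 2 * r" "even (v - N)"
    then have "(u, v) = tail_edge N (v - N)" "v - N < 2 * r" using N by (auto simp: tail_edge_def)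
    then show ?thesis by blast
  next
    assume *: "v + 1 = u" "N \<le> u" "u < N + 2 * r" "odd (u - N)"
    then have "(u, v) = tail_edge N (u - N)" "u - N < 2 * r" using N by (auto simp: tail_edge_def)
    then show ?thesis by blast
  qed
qed

text \<open>The equation at a diagonal position of the tail relates the entries at the two edges that meet
  there; starting at the free end they all vanish. The equation at an edge of the tail then
  identifies the two neighbouring diagonal entries. What remains on the core are the equations of
  the core alone.\<close>

lemma seaweed_radical_scalar:
  fixes P :: "nat \<Rightarrow> nat \<Rightarrow> complex"
  assumes a: "a \<ge> 2" and b: "b \<ge> 2"
  defines "K \<equiv> a * (b - 1)" and "N \<equiv> a * b"
  assumes supp: "\<And>i j. i < N + 2 * r \<Longrightarrow> j < N + 2 * r \<Longrightarrow> (i, j) \<notin> seaweed_positions K N r \<Longrightarrow> P i j = 0"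
    and radical: "\<And>i j. (i, j) \<in> seaweed_positions K N r \<Longrightarrow>
      (\<Sum>u | (u, j) \<in> seaweed_edges a K N r. P u i) = (\<Sum>v | (i, v) \<in> seaweed_edges a K N r. P j v)"
    and ij: "i < N + 2 * r" "j < N + 2 * r"
  shows "P i j = (if i = j then P 0 0 else 0)"
proof -
  let ?R = "seaweed_positions K N r" and ?E = "seaweed_edges a K N r"
  have N: "N = K + a" using b by (cases b) (auto simp: N_def K_def)
  have aK: "a \<le> K" using b by (auto simp: K_def)
  have N0: "N > 0" using N a by simp
  note tail = tail_edge_image_iff[OF N0, of _ _ r]
  have Emem: "(u, v) \<in> ?E \<longleftrightarrow> u = v + a \<and> v < K \<or> u = v + 1 \<and> K \<le> v \<and> v < N - 1 \<or>
      (u + 1 = v \<and> N \<le> v \<and> v < N + 2 * r \<and> even (v - N) \<or> v + 1 = u \<and> N \<le> u \<and> u < N + 2 * r \<and> odd (u - N))" for u v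
    unfolding seaweed_edges_def Un_iff tail by (simp add: core_edges_def)
  have Rmem: "(u, v) \<in> ?R \<longleftrightarrow> (u < N \<and> v < N \<and> (v < K \<or> K \<le> u \<and> (v < N - 1 \<or> u = N - 1))) \<or>
      (u = v \<and> N \<le> u \<and> u < N + 2 * r) \<or>
      (u + 1 = v \<and> N \<le> v \<and> v < N + 2 * r \<and> even (v - N) \<or> v + 1 = u \<and> N \<le> u \<and> u < N + 2 * r \<and> odd (u - N))" for u v
    unfolding seaweed_positions_def Un_iff tail by (simp add: core_positions_def)
  have Ebound: "u < N + 2 * r \<and> v < N + 2 * r" if "(u, v) \<in> ?E" for u v
  proof -
    have "N \<ge> 1" using N0 by simp
    then show ?thesis using that[unfolded Emem] N by (elim disjE conjE; intro conjI; linarith)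
  qed
  have fin: "finite {u. (u, j) \<in> ?E}" "finite {v. (i, v) \<in> ?E}" for i j
    by (rule finite_subset[of _ "{..<N + 2 * r}"]; use Ebound in blast)+
  define t where "t s = N - 1 + s" for s
  \<comment> \<open>The entry at the edge number \<open>s\<close> of the tail; \<open>t s\<close> is the vertex number \<open>s\<close> of the path.\<close>
  define ev where "ev s = (if even s then P (t s) (t (Suc s)) else P (t (Suc s)) (t s))" for s
  \<comment> \<open>The equation at the diagonal position of the vertex \<open>t s\<close>: there the edges of the tail are
    all incoming or all outgoing.\<close>
  have vertex: "ev (s - 1) + (if s < 2 * r then ev s else 0) = 0" if s: "1 \<le> s" "s \<le> 2 * r" for s
  proof -
    define x where "x = t s"
    have x: "N \<le> x" "x < N + 2 * r" "t (Suc s) = x + 1" "t (s - 1) = x - 1" "Suc (s - 1) = s"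
      and bound: "x + 1 < N + 2 * r \<longleftrightarrow> s < 2 * r" and par: "x + 1 = N + s"
      using s N0 by (auto simp: t_def x_def)
    have even1: "even (x + 1 - N) \<longleftrightarrow> even s" using par by simp
    have even0: "even (x - N) \<longleftrightarrow> odd s" using par x(1) s by (cases s) auto
    have into: "(u, x) \<in> ?E \<longleftrightarrow> odd s \<and> (u + 1 = x \<or> u = x + 1 \<and> s < 2 * r)" for u
    proof -
      have "(u, x) \<in> ?E \<longleftrightarrow> u + 1 = x \<and> even (x - N) \<or> x + 1 = u \<and> x + 1 < N + 2 * r \<and> odd (x + 1 - N)"
      proof -
        have "\<not> x < K" "\<not> x < N - 1" using x(1) N by linarith+
        then show ?thesis unfolding Emem using x(1,2) by (cases "u = x + 1") auto
      qed
      then show ?thesis unfolding even0 even1 bound by auto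
    qed
    have out: "(x, v) \<in> ?E \<longleftrightarrow> even s \<and> (v + 1 = x \<or> v = x + 1 \<and> s < 2 * r)" for v
    proof -
      have "(x, v) \<in> ?E \<longleftrightarrow> x + 1 = v \<and> x + 1 < N + 2 * r \<and> even (x + 1 - N) \<or> v + 1 = x \<and> odd (x - N)"
      proof -
        have "\<not> (x = v + a \<and> v < K)" "\<not> (x = v + 1 \<and> K \<le> v \<and> v < N - 1)" using x(1) N by linarith+
        then show ?thesis unfolding Emem using x(1,2) by (cases "v = x + 1") auto
      qed
      then show ?thesis unfolding even0 even1 bound by auto
    qed
    have nb: "{y. y + 1 = x \<or> y = x + 1 \<and> s < 2 * r} = insert (x - 1) (if s < 2 * r then {x + 1} else {})"
      using x(1) N0 by auto
    have two: "sum f (insert (x - 1) (if s < 2 * r then {x + 1} else {})) =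
        f (x - 1) + (if s < 2 * r then f (x + 1) else 0)" for f :: "nat \<Rightarrow> complex"
      using x(1) N0 by simp
    have "(x, x) \<in> ?R" unfolding Rmem using x by simp
    note eq = radical[OF this, unfolded into out]
    show ?thesis
    proof (cases "even s")
      case True
      then have "0 = (\<Sum>v | v + 1 = x \<or> v = x + 1 \<and> s < 2 * r. P x v)" using eq by simp
      then have "P x (x - 1) + (if s < 2 * r then P x (x + 1) else 0) = 0" unfolding nb two by simp
      moreover have "ev (s - 1) = P x (x - 1)" "ev s = P x (x + 1)"
        using True s x by (simp_all add: ev_def x_def[symmetric])
      ultimately show ?thesis by (simp only:)
    next
      case False
      then have "(\<Sum>u | u + 1 = x \<or> u = x + 1 \<and> s < 2 * r. P u x) = 0" using eq by simp
      then have "P (x - 1) x + (if s < 2 * r then P (x + 1) x else 0) = 0" unfolding nb two by simp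
      moreover have "ev (s - 1) = P (x - 1) x" "ev s = P (x + 1) x"
        using False s x by (simp_all add: ev_def x_def[symmetric])
      ultimately show ?thesis by (simp only:)
    qed
  qed
  have ev0: "ev (2 * r - 1 - k) = 0" if "k < 2 * r" for k
    using that
  proof (induction k)
    case 0
    then show ?case using vertex[of "2 * r"] by simp
  next
    case (Suc k)
    have "2 * r - 1 - k - 1 = 2 * r - 1 - Suc k" by simp
    then show ?case using Suc vertex[of "2 * r - 1 - k"] by auto
  qed
  have ev0: "ev s = 0" if "s < 2 * r" for s using ev0[of "2 * r - 1 - s"] that by simp
  have step: "P (t (Suc s)) (t (Suc s)) = P (t s) (t s)" if s: "s < 2 * r" for s
  proof -
    obtain i j where e: "tail_edge N s = (i, j)" by fastforce
    have "(i, j) \<in> tail_edge N ` {..<2 * r}" using e s by force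
    then have mem: "(i, j) \<in> ?E" "(i, j) \<in> ?R" by (auto simp: seaweed_edges_def seaweed_positions_def)
    have ij: "i = N - 1 + s \<and> j = N + s \<or> i = N + s \<and> j = N - 1 + s \<and> s \<ge> 1"
      using e by (cases "even s") (auto simp: tail_edge_def elim: oddE)
    have edge: "u = v + a \<and> v < K \<or> u = v + 1 \<and> v < N - 1 \<or> u + 1 = v \<and> N \<le> v \<or> v + 1 = u \<and> N \<le> u"
      if "(u, v) \<in> ?E" for u v
      using that unfolding Emem by blast
    have u: "u = i \<or> (N \<le> u \<or> N \<le> i) \<and> (u \<ge> i + 2 \<or> i \<ge> u + 2)" if "(u, j) \<in> ?E" for u
      using edge[OF that] ij N N0 by arith
    have v: "v = j \<or> (N \<le> j \<or> N \<le> v) \<and> (j \<ge> v + 2 \<or> v \<ge> j + 2)" if "(i, v) \<in> ?E" for v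
      using edge[OF that] ij N N0 a by arith
    have far: "(u, w) \<notin> ?R" if "N \<le> u \<or> N \<le> w" "u \<ge> w + 2 \<or> w \<ge> u + 2" for u w
      unfolding Rmem using that by arith
    have "P u i = 0" if "(u, j) \<in> ?E" "u \<noteq> i" for u
      using u[OF that(1)] that(2) Ebound[OF mem(1)] Ebound[OF that(1)] by (intro supp[OF _ _ far]) blast+
    then have 1: "(\<Sum>u | (u, j) \<in> ?E. P u i) = P i i"
      using mem by (intro sum_eq_single fin) auto
    have "P j v = 0" if "(i, v) \<in> ?E" "v \<noteq> j" for v
      using v[OF that(1)] that(2) Ebound[OF mem(1)] Ebound[OF that(1)] by (intro supp[OF _ _ far]) blast+
    then have 2: "(\<Sum>v | (i, v) \<in> ?E. P j v) = P j j"
      using mem by (intro sum_eq_single fin) auto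
    have "t s = N - 1 + s" "t (Suc s) = N + s" using N0 by (simp_all add: t_def)
    then show ?thesis using radical[OF mem(2)] 1 2 ij by auto
  qed
  have tail_diag: "P (t s) (t s) = P (N - 1) (N - 1)" if "s \<le> 2 * r" for s
    using that
  proof (induction s)
    case (Suc s)
    then show ?case using step[of s] by simp
  qed (simp add: t_def)
  have PN: "P j N = 0" if "j < N" "r > 0" for j
  proof (cases "j = N - 1")
    case True
    then show ?thesis using ev0[of 0] that N0 by (simp add: ev_def t_def)
  next
    case False
    have "(j, N) \<notin> ?R" unfolding Rmem using that False by arith
    then show ?thesis using that by (intro supp) auto
  qed
  have out: "(\<Sum>v | (i, v) \<in> ?E. P j v) = (if a \<le> i then P j (i - a) else 0) + (if K < i then P j (i - 1) else 0)"
    if "i < N" "j < N" for i j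
  proof -
    let ?A = "if a \<le> i then {i - a} else {}" and ?B = "if K < i then {i - 1} else {}"
      and ?C = "if i = N - 1 \<and> r > 0 then {N} else {}"
    have "{v. (i, v) \<in> ?E} = ?A \<union> ?B \<union> ?C"
    proof (intro Set.set_eqI)
      fix v
      have "(i, v) \<in> ?E \<longleftrightarrow> i = v + a \<and> v < K \<or> i = v + 1 \<and> K \<le> v \<and> v < N - 1 \<or> i = N - 1 \<and> v = N \<and> r > 0"
      proof
        assume "(i, v) \<in> ?E"
        then show "i = v + a \<and> v < K \<or> i = v + 1 \<and> K \<le> v \<and> v < N - 1 \<or> i = N - 1 \<and> v = N \<and> r > 0"
          unfolding Emem using that by (elim disjE conjE) simp_all
      next
        assume "i = v + a \<and> v < K \<or> i = v + 1 \<and> K \<le> v \<and> v < N - 1 \<or> i = N - 1 \<and> v = N \<and> r > 0"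
        then show "(i, v) \<in> ?E" unfolding Emem using N0 by (elim disjE conjE) simp_all
      qed
      also have "i = v + a \<and> v < K \<longleftrightarrow> v \<in> ?A" using that N by auto
      also have "i = v + 1 \<and> K \<le> v \<and> v < N - 1 \<longleftrightarrow> v \<in> ?B" using that by auto
      also have "i = N - 1 \<and> v = N \<and> r > 0 \<longleftrightarrow> v \<in> ?C" by simp
      finally show "v \<in> {v. (i, v) \<in> ?E} \<longleftrightarrow> v \<in> ?A \<union> ?B \<union> ?C" by simp
    qed
    moreover have "?A \<inter> ?B = {}" "(?A \<union> ?B) \<inter> ?C = {}" using that a N by auto
    ultimately have "(\<Sum>v | (i, v) \<in> ?E. P j v) = sum (P j) ?A + sum (P j) ?B + sum (P j) ?C"
      by (simp add: sum.union_disjoint)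
    then show ?thesis using PN[OF that(2)] by simp
  qed
  have KN: "K + 2 \<le> N" using N a by simp
  have core: "P i j = (if i = j then P 0 0 else 0)" if "i < N" "j < N" for i j
  proof (rule core_radical_scalar[OF a b, folded K_def N_def])
    fix i j assume "i < K" "K \<le> j" "j < N"
    then have "(i, j) \<notin> ?R" unfolding Rmem by simp
    then show "P i j = 0" using \<open>i < K\<close> \<open>j < N\<close> KN by (intro supp) auto
  next
    fix i assume "i < N - 1"
    then have "(i, N - 1) \<notin> ?R" unfolding Rmem using KN by arith
    then show "P i (N - 1) = 0" using \<open>i < N - 1\<close> KN by (intro supp) auto
  next
    fix i j assume ji: "j < K" "i < N"
    have "u = j + a" if "(u, j) \<in> ?E" for u
      using that ji KN unfolding Emem by (elim disjE conjE) simp_all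
    moreover have "(j + a, j) \<in> ?E" unfolding Emem using ji by simp
    ultimately have "{u. (u, j) \<in> ?E} = {j + a}" by blast
    moreover have "(i, j) \<in> ?R" unfolding Rmem using ji KN by simp
    ultimately show "P (j + a) i = (if a \<le> i then P j (i - a) else 0) + (if K < i then P j (i - 1) else 0)"
      using radical[of i j] out[of i j] ji N by simp
  next
    fix i j assume ji: "K \<le> j" "j < N - 1" "K \<le> i" "i < N"
    have "u = j + 1" if "(u, j) \<in> ?E" for u
      using that ji KN unfolding Emem by (elim disjE conjE) simp_all
    moreover have "(j + 1, j) \<in> ?E" unfolding Emem using ji by simp
    ultimately have "{u. (u, j) \<in> ?E} = {j + 1}" by blast
    moreover have "(i, j) \<in> ?R" unfolding Rmem using ji KN by auto
    ultimately show "P (j + 1) i = P j (i - a) + (if K < i then P j (i - 1) else 0)"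
      using radical[of i j] out[of i j] ji aK by simp
  qed (use that in auto)
  show ?thesis
  proof (cases "i < N \<and> j < N")
    case False
    show ?thesis
    proof (cases "i = j")
      case True
      have "P i i = P (t (i - (N - 1))) (t (i - (N - 1)))" using False True N0 by (simp add: t_def)
      also have "\<dots> = P (N - 1) (N - 1)" using ij N0 by (intro tail_diag) auto
      also have "\<dots> = P 0 0" using core[of "N - 1" "N - 1"] N0 by simp
      finally show ?thesis using True by simp
    next
      case ne: False
      show ?thesis
      proof (cases "(i, j) \<in> ?R")
        case True
        then have "i + 1 = j \<and> N \<le> j \<and> j < N + 2 * r \<and> even (j - N) \<or>
            j + 1 = i \<and> N \<le> i \<and> i < N + 2 * r \<and> odd (i - N)"
          unfolding Rmem using False ne by blast
        then show ?thesis
        proof (elim disjE conjE)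
          assume *: "i + 1 = j" "N \<le> j" "j < N + 2 * r" "even (j - N)"
          have "t (j - N) = i" "t (Suc (j - N)) = j" using * N0 by (auto simp: t_def)
          then have "P i j = ev (j - N)" using * by (simp add: ev_def)
          then show ?thesis using ev0[of "j - N"] * by simp
        next
          assume *: "j + 1 = i" "N \<le> i" "i < N + 2 * r" "odd (i - N)"
          have "t (i - N) = j" "t (Suc (i - N)) = i" using * N0 by (auto simp: t_def)
          then have "P i j = ev (i - N)" using * by (simp add: ev_def)
          then show ?thesis using ev0[of "i - N"] * by simp
        qed
      qed (use supp ij ne in simp)
    qed
  qed (use core in simp)
qed

section \<open>Folding a parabolic in half\<close>

text \<open>The size is \<open>n = 2m\<close>, and \<open>\<tau> i = n - 1 - i\<close> reflects the indices. The equations in the lower left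
  quadrant identify \<open>x\<^bsub>\<tau>i,\<tau>j\<^esub>\<close> with \<open>x\<^bsub>i,j\<^esub>\<close>, those in the lower right quadrant kill the reflected entries
  of the lower left one, and those in the upper left quadrant then become the radical equations of
  the seaweed of all positions \<open>(i, j)\<close> that are allowed together with \<open>(\<tau> i, \<tau> j)\<close>. So both diagonal
  quadrants are the same scalar, which the trace forces to be zero.\<close>

lemma folding_radical:
  fixes x :: "complex mat"
  assumes m: "m > 0" and n: "n = 2 * m"
    and x: "x \<in> traceless n (supported n S)"
    and upper: "\<And>i j. i < m \<Longrightarrow> m \<le> j \<Longrightarrow> j < n \<Longrightarrow> (i, j) \<notin> S"
    and lower: "\<And>i j. m \<le> i \<Longrightarrow> i < n \<Longrightarrow> j < m \<Longrightarrow> (i, j) \<in> S"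
    and cover: "\<And>i j. i < m \<Longrightarrow> j < m \<Longrightarrow> (i, j) \<in> S \<or> (n - 1 - i, n - 1 - j) \<in> S"
    and E1: "E1 \<subseteq> {..<m} \<times> {..<m}" and E: "E = E1 \<union> (\<lambda>i. (n - 1 - i, i)) ` {..<m}"
    and radical: "\<And>i j. (i, j) \<in> S \<Longrightarrow> (\<Sum>u | (u, j) \<in> E. x $$ (u, i)) = (\<Sum>v | (i, v) \<in> E. x $$ (j, v))"
    and seaweed: "\<And>P. (\<And>i j. i < m \<Longrightarrow> j < m \<Longrightarrow> (i, j) \<notin> S \<or> (n - 1 - i, n - 1 - j) \<notin> S \<Longrightarrow> P i j = 0) \<Longrightarrow>
      (\<And>i j. i < m \<Longrightarrow> j < m \<Longrightarrow> (i, j) \<in> S \<Longrightarrow> (n - 1 - i, n - 1 - j) \<in> S \<Longrightarrow>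
        (\<Sum>u | (u, j) \<in> E1. P u i) = (\<Sum>v | (i, v) \<in> E1. P j v)) \<Longrightarrow>
      \<exists>c :: complex. \<forall>i<m. \<forall>j<m. P i j = (if i = j then c else 0)"
  shows "x = 0\<^sub>m n n"
proof -
  let ?\<tau> = "\<lambda>i. n - 1 - i"
  have xc: "x \<in> carrier_mat n n" and supp: "\<And>i j. i < n \<Longrightarrow> j < n \<Longrightarrow> (i, j) \<notin> S \<Longrightarrow> x $$ (i, j) = 0"
    and tr: "(\<Sum>i<n. x $$ (i, i)) = 0"
    using x by (auto simp: traceless_def supported_def mat_tr_def)
  have \<tau>: "?\<tau> (?\<tau> i) = i" "m \<le> ?\<tau> i" "?\<tau> i < n" if "i < m" for i
    using that n by auto
  have \<tau>': "?\<tau> (?\<tau> i) = i" "?\<tau> i < m" if "m \<le> i" "i < n" for i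
    using that n by auto
  have fin: "finite {u. (u, j) \<in> E1}" "finite {v. (i, v) \<in> E1}" for i j
    by (rule finite_subset[of _ "{..<m}"]; use E1 in blast)+
  have into: "{u. (u, j) \<in> E} = (if j < m then insert (?\<tau> j) {u. (u, j) \<in> E1} else {})" for j
    using E1 unfolding E by auto
  have out: "{v. (i, v) \<in> E} = (if i < m then {v. (i, v) \<in> E1} else {?\<tau> i})" if "i < n" for i
  proof (cases "i < m")
    case True
    have "(i, v) \<in> E \<longleftrightarrow> (i, v) \<in> E1" for v
    proof -
      have "i \<noteq> ?\<tau> v" if "v < m" using \<tau>(2)[OF that] True by simp
      then show ?thesis unfolding E by blast
    qed
    then show ?thesis using True by simp
  next
    case False
    then have "m \<le> i" by simp
    note \<tau>i = \<tau>'[OF this that]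
    have "(i, v) \<in> E \<longleftrightarrow> v = ?\<tau> i" for v
    proof
      assume "(i, v) \<in> E"
      then have "i = ?\<tau> v" "v < m" using False E1 unfolding E by auto
      then show "v = ?\<tau> i" using \<tau>(1)[of v] by simp
    next
      assume v: "v = ?\<tau> i"
      then have "v < m" "i = ?\<tau> v" using \<tau>i by simp_all
      then show "(i, v) \<in> E" unfolding E by auto
    qed
    then show ?thesis using False by simp
  qed
  have sum_in: "(\<Sum>u | (u, j) \<in> E. f u) = f (?\<tau> j) + (\<Sum>u | (u, j) \<in> E1. f u)"
    if "j < m" for j and f :: "nat \<Rightarrow> complex"
  proof -
    have "?\<tau> j \<notin> {u. (u, j) \<in> E1}" using E1 \<tau>[OF that] by auto
    then show ?thesis using into[of j] fin(1) that by simp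
  qed
  \<comment> \<open>Equation at the position \<open>(\<tau> j, i)\<close>.\<close>
  have reflect: "x $$ (?\<tau> i, ?\<tau> j) = x $$ (i, j)" if ij: "i < m" "j < m" for i j
  proof -
    have "(?\<tau> j, i) \<in> S" using lower \<tau>[OF ij(2)] ij by simp
    from radical[OF this] have "x $$ (?\<tau> i, ?\<tau> j) + (\<Sum>u | (u, i) \<in> E1. x $$ (u, ?\<tau> j)) = (\<Sum>v | (?\<tau> j, v) \<in> E. x $$ (i, v))"
      unfolding sum_in[OF ij(1)] .
    moreover have "(\<Sum>u | (u, i) \<in> E1. x $$ (u, ?\<tau> j)) = 0"
      using E1 upper \<tau>[OF ij(2)] n by (intro sum.neutral) (auto intro!: supp)
    moreover have "{v. (?\<tau> j, v) \<in> E} = {j}"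
      unfolding out[OF \<tau>(3)[OF ij(2)]] using \<tau>[OF ij(2)] by simp
    ultimately show ?thesis by simp
  qed
  \<comment> \<open>Equation at the position \<open>(\<tau> i, \<tau> j)\<close>.\<close>
  have corner: "x $$ (?\<tau> j, i) = 0" if ij: "i < m" "j < m" "(?\<tau> i, ?\<tau> j) \<in> S" for i j
  proof -
    have "{u. (u, ?\<tau> j) \<in> E} = {}" unfolding into using \<tau>(2)[OF ij(2)] by simp
    moreover have "{v. (?\<tau> i, v) \<in> E} = {i}"
      unfolding out[OF \<tau>(3)[OF ij(1)]] using \<tau>[OF ij(1)] by simp
    ultimately show ?thesis using radical[OF ij(3)] by simp
  qed
  have first: "x $$ (?\<tau> j, i) + (\<Sum>u | (u, j) \<in> E1. x $$ (u, i)) = (\<Sum>v | (i, v) \<in> E1. x $$ (j, v))"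
    if ij: "i < m" "j < m" "(i, j) \<in> S" for i j
  proof -
    have "i < n" using ij n by simp
    then show ?thesis using radical[OF ij(3)] out[of i] ij unfolding sum_in[OF ij(2)] by simp
  qed
  have "\<exists>c. \<forall>i<m. \<forall>j<m. x $$ (i, j) = (if i = j then c else 0)"
  proof (rule seaweed[where P = "\<lambda>i j. x $$ (i, j)"])
    fix i j assume ij: "i < m" "j < m" "(i, j) \<notin> S \<or> (?\<tau> i, ?\<tau> j) \<notin> S"
    then show "x $$ (i, j) = 0"
      using supp[of i j] supp[of "?\<tau> i" "?\<tau> j"] reflect[of i j] n by auto
  next
    fix i j assume "i < m" "j < m" "(i, j) \<in> S" "(?\<tau> i, ?\<tau> j) \<in> S"
    then show "(\<Sum>u | (u, j) \<in> E1. x $$ (u, i)) = (\<Sum>v | (i, v) \<in> E1. x $$ (j, v))"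
      using first[of i j] corner[of i j] by simp
  qed
  then obtain c where c: "\<And>i j. i < m \<Longrightarrow> j < m \<Longrightarrow> x $$ (i, j) = (if i = j then c else 0)" by blast
  have "(\<Sum>i<n. x $$ (i, i)) = (\<Sum>i<n. c)"
  proof (rule sum.cong)
    fix i assume i: "i \<in> {..<n}"
    show "x $$ (i, i) = c"
    proof (cases "i < m")
      case False
      then have "?\<tau> (?\<tau> i) = i" "?\<tau> i < m" using \<tau>'[of i] i by auto
      then show ?thesis using reflect[of "?\<tau> i" "?\<tau> i"] c by metis
    qed (use c in simp)
  qed simp
  then have c0: "c = 0" using tr m n by simp
  have corner': "x $$ (?\<tau> j, i) = 0" if ij: "i < m" "j < m" for i j
    using cover[OF ij]
  proof
    assume "(i, j) \<in> S"
    moreover have "(\<Sum>u | (u, j) \<in> E1. x $$ (u, i)) = 0" "(\<Sum>v | (i, v) \<in> E1. x $$ (j, v)) = 0"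
      using E1 c c0 ij by (auto intro!: sum.neutral)
    ultimately show ?thesis using first[of i j] ij by simp
  qed (use corner ij in blast)
  show ?thesis
  proof (rule eq_matI)
    fix i j assume "i < dim_row (0\<^sub>m n n :: complex mat)" "j < dim_col (0\<^sub>m n n :: complex mat)"
    then have ij: "i < n" "j < n" by auto
    have "x $$ (i, j) = 0"
    proof (cases "i < m")
      case i: True
      show ?thesis
      proof (cases "j < m")
        case False
        then show ?thesis using upper[of i j] i ij by (intro supp) auto
      qed (use c c0 i in simp)
    next
      case i: False
      then have \<tau>i: "?\<tau> (?\<tau> i) = i" "?\<tau> i < m" using \<tau>'[of i] ij by auto
      show ?thesis
      proof (cases "j < m")
        case True
        then show ?thesis using corner'[OF True \<tau>i(2)] unfolding \<tau>i(1) by simp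
      next
        case False
        then have \<tau>j: "?\<tau> (?\<tau> j) = j" "?\<tau> j < m" using \<tau>'[of j] ij by auto
        show ?thesis using reflect[OF \<tau>i(2) \<tau>j(2)] c[OF \<tau>i(2) \<tau>j(2)] c0 unfolding \<tau>i(1) \<tau>j(1) by simp
      qed
    qed
    then show "x $$ (i, j) = 0\<^sub>m n n $$ (i, j)" using ij by simp
  qed (use xc in auto)
qed

section \<open>Blocks of a composition\<close>

lemma same_block_Cons:
  "block_of (p # ps) i = block_of (p # ps) j \<longleftrightarrow>
    i < p \<and> j < p \<or> p \<le> i \<and> p \<le> j \<and> block_of ps (i - p) = block_of ps (j - p)"
  by auto

lemma same_block_replicate_2:
  "block_of (replicate r 2 @ ps) i = block_of (replicate r 2 @ ps) j \<longleftrightarrow>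
    i < 2 * r \<and> j < 2 * r \<and> i div 2 = j div 2 \<or>
    2 * r \<le> i \<and> 2 * r \<le> j \<and> block_of ps (i - 2 * r) = block_of ps (j - 2 * r)"
proof (induction r arbitrary: i j)
  case (Suc r)
  have "i - 2 - 2 * r = i - 2 * Suc r" "j - 2 - 2 * r = j - 2 * Suc r" by simp_all
  then have eq: "block_of (replicate (Suc r) 2 @ ps) i = block_of (replicate (Suc r) 2 @ ps) j \<longleftrightarrow>
      i < 2 \<and> j < 2 \<or> 2 \<le> i \<and> 2 \<le> j \<and>
      (i - 2 < 2 * r \<and> j - 2 < 2 * r \<and> (i - 2) div 2 = (j - 2) div 2 \<or>
       2 * r \<le> i - 2 \<and> 2 * r \<le> j - 2 \<and> block_of ps (i - 2 * Suc r) = block_of ps (j - 2 * Suc r))"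
    by (simp only: replicate_Suc append_Cons same_block_Cons Suc)
  show ?case
  proof (cases "2 \<le> i \<and> 2 \<le> j")
    case True
    then obtain k l where "i = k + 2" "j = l + 2" by (metis le_add_diff_inverse2)
    then show ?thesis unfolding eq by auto
  next
    case False
    have "x div 2 = 0 \<longleftrightarrow> x < 2" for x :: nat by auto
    then have "i div 2 = j div 2 \<longleftrightarrow> i < 2 \<and> j < 2" using False by (metis not_less)
    then show ?thesis unfolding eq using False by auto
  qed
qed simp

lemma block_of_mono: "i \<le> j \<Longrightarrow> block_of ps i \<le> block_of ps j"
  by (induction ps arbitrary: i j) (auto simp: diff_le_mono)

definition parabolic_positions :: "nat \<Rightarrow> nat list \<Rightarrow> (nat \<times> nat) set" where
  "parabolic_positions n B = {(i, j). i < n \<and> j < n \<and> (j \<le> i \<or> block_of B i = block_of B j)}"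

lemma seaweed_eq_traceless_supported:
  "seaweed n [n] B = traceless n (supported n (parabolic_positions n B))"
  by (auto simp: seaweed_def traceless_def supported_def parabolic_positions_def mat_tr_def)

lemma parabolic_positions_trans:
  assumes "(i, j) \<in> parabolic_positions n B" "(j, k) \<in> parabolic_positions n B"
  shows "(i, k) \<in> parabolic_positions n B"
proof -
  have mono: "block_of B i \<le> block_of B j" if "i \<le> j" for i j using that by (rule block_of_mono)
  consider "k \<le> i" | "i < k" "j \<le> i" | "i < j" "k \<le> j" "i < k" | "i < j" "j < k" by linarith
  then show ?thesis
  proof cases
    case 2
    then have "block_of B j = block_of B k" using assms by (auto simp: parabolic_positions_def)
    moreover have "block_of B j \<le> block_of B i" "block_of B i \<le> block_of B k" using 2 by (auto intro: mono)
    ultimately show ?thesis using assms by (auto simp: parabolic_positions_def)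
  next
    case 3
    then have "block_of B i = block_of B j" using assms by (auto simp: parabolic_positions_def)
    moreover have "block_of B i \<le> block_of B k" "block_of B k \<le> block_of B j" using 3 by (auto intro: mono)
    ultimately show ?thesis using assms by (auto simp: parabolic_positions_def)
  qed (use assms in \<open>auto simp: parabolic_positions_def\<close>)
qed

section \<open>The positions of the parabolic\<close>

lemma div_2_eq_iff: "i < j \<Longrightarrow> i div 2 = j div 2 \<longleftrightarrow> j = i + 1 \<and> even i" for i j :: nat
  by presburger

locale parabolic =
  fixes a b r :: nat
  assumes a: "a \<ge> 2" and b: "b \<ge> 2"
begin

definition K :: nat where "K = a * (b - 1)"
definition N :: nat where "N = a * b"
definition m :: nat where "m = N + 2 * r"
definition n :: nat where "n = 2 * a * b + 4 * r"

definition B :: "nat list" where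
  "B = [a * (b - 1), a - 1] @ replicate r 2 @ [1] @ replicate r 2 @ [a * b]"

definition S :: "(nat \<times> nat) set" where "S = parabolic_positions n B"

definition E :: "(nat \<times> nat) set" where
  "E = seaweed_edges a K N r \<union> (\<lambda>i. (n - 1 - i, i)) ` {..<m}"

text \<open>\<open>half_weight\<close> and \<open>wt\<close> are a potential on the tree of edges, normalised to be zero at the index 0; it drops by one from the row
  to the column of every edge. On the core it is the number of the group plus the place in the group,
  on the tail it alternates, and a mirror image has one more.\<close>

definition half_weight :: "nat \<Rightarrow> int" where
  "half_weight i = (if i < N then int (i div a) + int (i mod a)
     else if even (i - N) then int a + int b - 3 else int a + int b - 2)"

definition wt :: "nat \<Rightarrow> int" where
  "wt i = (if i < m then half_weight i else half_weight (n - 1 - i) + 1)"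

lemma N_eq: "N = K + a" and n_eq: "n = 2 * m" and m_pos: "m > 0" and n_pos: "n > 0"
proof -
  have "a * b = a * (b - 1) + a" using b by (cases b) auto
  then show "N = K + a" by (simp add: N_def K_def)
  then show "m > 0" using a by (simp add: m_def)
  then show "n = 2 * m" "n > 0" by (auto simp: n_def m_def N_def)
qed

lemma same_block_B:
  assumes "i < n" "j < n" "i < j"
  shows "block_of B i = block_of B j \<longleftrightarrow>
    j < K \<or> K \<le> i \<and> j < N - 1 \<or>
    N - 1 \<le> i \<and> (j < m - 1 \<and> j = i + 1 \<and> even (i - (N - 1)) \<or>
      m \<le> i \<and> (j < m + 2 * r \<and> j = i + 1 \<and> even (i - m) \<or> m + 2 * r \<le> i))"
proof -
  define M where "M = N - 1"
  have M: "N = M + 1" "K + (a - 1) = M" "m = M + 1 + 2 * r" "n = M + 1 + 2 * r + 2 * r + N"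
    using a by (simp_all add: M_def N_eq m_def n_eq)
  have sub: "i - K - (a - 1) = i - M" "i - M - 2 * r - 1 = i - m" for i
    using M by simp_all
  have last: "block_of [N] (i - m - 2 * r) = block_of [N] (j - m - 2 * r)" if "2 * r \<le> i - m"
  proof -
    have "i - m - 2 * r < N" "j - m - 2 * r < N" using assms M by linarith+
    then show ?thesis by simp
  qed
  have block: "block_of B i = block_of B j \<longleftrightarrow>
    i < K \<and> j < K \<or> K \<le> i \<and> K \<le> j \<and>
    (i - K < a - 1 \<and> j - K < a - 1 \<or> a - 1 \<le> i - K \<and> a - 1 \<le> j - K \<and>
     (i - M < 2 * r \<and> j - M < 2 * r \<and> (i - M) div 2 = (j - M) div 2 \<or>
      2 * r \<le> i - M \<and> 2 * r \<le> j - M \<and>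
      (i - M - 2 * r < 1 \<and> j - M - 2 * r < 1 \<or> 1 \<le> i - M - 2 * r \<and> 1 \<le> j - M - 2 * r \<and>
       (i - m < 2 * r \<and> j - m < 2 * r \<and> (i - m) div 2 = (j - m) div 2 \<or>
        2 * r \<le> i - m \<and> 2 * r \<le> j - m \<and> block_of [N] (i - m - 2 * r) = block_of [N] (j - m - 2 * r)))))"
    unfolding B_def append_Cons append_Nil same_block_Cons same_block_replicate_2 K_def[symmetric] N_def[symmetric] sub ..
  consider "i < K" | "K \<le> i" "i < M" | "M \<le> i" "i < M + 2 * r" | "i = M + 2 * r"
    | "m \<le> i" "i < m + 2 * r" | "m + 2 * r \<le> i"
    using M by linarith
  then show ?thesis
  proof cases
    case 1
    then show ?thesis unfolding block M_def[symmetric] using assms(3) M by auto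
  next
    case 2
    then have "i - K < a - 1" "\<not> a - 1 \<le> i - K" "j - K < a - 1 \<longleftrightarrow> j < M" using assms(3) M(2) by linarith+
    then show ?thesis unfolding block M_def[symmetric] using 2 assms(3) M by auto
  next
    case 3
    then have i: "i - M < j - M" "\<not> i < K" "K \<le> i" "K \<le> j" "\<not> i - K < a - 1" "a - 1 \<le> i - K" "a - 1 \<le> j - K"
      "i - M < 2 * r" "\<not> 2 * r \<le> i - M" "\<not> m \<le> i" "\<not> j < K" "\<not> j < M"
      using assms(3) M by linarith+
    have j: "j - M = i - M + 1 \<longleftrightarrow> j = i + 1" "j - M < 2 * r \<longleftrightarrow> j < m - 1" using 3 M by linarith+
    show ?thesis unfolding block M_def[symmetric] div_2_eq_iff[OF i(1)] j using i 3 by simp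
  next
    case 4
    then have "\<not> i < K" "\<not> i - K < a - 1" "\<not> i - M < 2 * r" "\<not> j - M - 2 * r < 1" "\<not> 1 \<le> i - M - 2 * r"
      "\<not> j < K" "\<not> j < M" "\<not> j < m - 1" "\<not> m \<le> i"
      using assms(3) M by linarith+
    then show ?thesis unfolding block M_def[symmetric] by simp
  next
    case 5
    then have i: "i - m < j - m" "\<not> i < K" "K \<le> i" "K \<le> j" "\<not> i - K < a - 1" "a - 1 \<le> i - K" "a - 1 \<le> j - K"
      "\<not> i - M < 2 * r" "2 * r \<le> i - M" "2 * r \<le> j - M" "1 \<le> i - M - 2 * r" "1 \<le> j - M - 2 * r"
      "\<not> i - M - 2 * r < 1" "i - m < 2 * r" "\<not> 2 * r \<le> i - m" "\<not> j < K" "\<not> j < M" "\<not> j < m - 1" "M \<le> i" "\<not> m + 2 * r \<le> i"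
      using assms(3) M by linarith+
    have j: "j - m = i - m + 1 \<longleftrightarrow> j = i + 1" "j - m < 2 * r \<longleftrightarrow> j < m + 2 * r" using 5 M by linarith+
    show ?thesis unfolding block M_def[symmetric] div_2_eq_iff[OF i(1)] j using i 5 by simp
  next
    case 6
    then have i: "\<not> i < K" "K \<le> i" "K \<le> j" "a - 1 \<le> i - K" "a - 1 \<le> j - K"
      "2 * r \<le> i - M" "2 * r \<le> j - M" "1 \<le> i - M - 2 * r" "1 \<le> j - M - 2 * r"
      "2 * r \<le> i - m" "2 * r \<le> j - m" "M \<le> i" "m \<le> i"
      using assms(3) M by linarith+
    show ?thesis unfolding block M_def[symmetric] using i 6 last[OF i(10)] by simp
  qed
qed

lemma mem_S_first_half:
  assumes "i < m" "j < m"
  shows "(i, j) \<in> S \<longleftrightarrow> j \<le> i \<or> j < K \<or> K \<le> i \<and> j < N - 1 \<or> j = i + 1 \<and> N \<le> j \<and> even (j - N)"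
proof (cases "i < j")
  case True
  have ij: "i < n" "j < n" using assms n_eq by auto
  have "(i, j) \<in> S \<longleftrightarrow> block_of B i = block_of B j"
    using True ij by (simp add: S_def parabolic_positions_def)
  also have "\<dots> \<longleftrightarrow> j < K \<or> K \<le> i \<and> j < N - 1 \<or> N - 1 \<le> i \<and> j < m - 1 \<and> j = i + 1 \<and> even (i - (N - 1))"
    unfolding same_block_B[OF ij True] using assms by auto
  also have "N - 1 \<le> i \<and> j < m - 1 \<and> j = i + 1 \<and> even (i - (N - 1)) \<longleftrightarrow> j = i + 1 \<and> N \<le> j \<and> even (j - N)"
  proof (cases "j = i + 1 \<and> N \<le> j")
    case True
    then have "i - (N - 1) = j - N" "N - 1 \<le> i" using N_eq a by linarith+
    moreover have "j < m - 1" if "even (j - N)"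
    proof -
      have "j - N \<noteq> 2 * r - 1 \<or> r = 0" using that by presburger
      then show ?thesis using assms(2) True unfolding m_def by linarith
    qed
    ultimately show ?thesis using True by auto
  next
    case False
    then show ?thesis by auto
  qed
  finally show ?thesis using True by auto
next
  case False
  then show ?thesis using assms n_eq by (auto simp: S_def parabolic_positions_def)
qed

lemma mem_S_second_half:
  assumes "i < m" "j < m"
  shows "(n - 1 - i, n - 1 - j) \<in> S \<longleftrightarrow> i \<le> j \<or> i < N \<or> i = j + 1 \<and> N \<le> i \<and> odd (i - N)"
proof (cases "j < i")
  case True
  have ij: "n - 1 - i < n" "n - 1 - j < n" "n - 1 - i < n - 1 - j" using assms True n_eq by auto
  have lin: "\<not> n - 1 - j < K" "\<not> n - 1 - j < N - 1" "N - 1 \<le> n - 1 - i" "\<not> n - 1 - j < m - 1" "m \<le> n - 1 - i"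
    "n - 1 - j = n - 1 - i + 1 \<longleftrightarrow> i = j + 1" "m + 2 * r \<le> n - 1 - i \<longleftrightarrow> i < N"
    "n - 1 - j < m + 2 * r \<longleftrightarrow> N \<le> j" "n - 1 - i - m = m - 1 - i"
  proof -
    obtain I J where IJ: "n - 1 - i = I" "n - 1 - j = J" "I + i + 1 = 2 * m" "J + j + 1 = 2 * m"
    proof
      show "n - 1 - i + i + 1 = 2 * m" "n - 1 - j + j + 1 = 2 * m" using assms n_eq by simp_all
    qed simp_all
    have KN: "K + 2 \<le> N" using N_eq a by simp
    note lin = assms True KN m_def IJ(3,4)
    show "\<not> n - 1 - j < K" "\<not> n - 1 - j < N - 1" "N - 1 \<le> n - 1 - i" "\<not> n - 1 - j < m - 1" "m \<le> n - 1 - i"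
      unfolding IJ(1,2) using lin by linarith+
    show "n - 1 - j = n - 1 - i + 1 \<longleftrightarrow> i = j + 1" unfolding IJ(1,2) using lin by linarith
    show "m + 2 * r \<le> n - 1 - i \<longleftrightarrow> i < N" unfolding IJ(1,2) using lin by linarith
    show "n - 1 - j < m + 2 * r \<longleftrightarrow> N \<le> j" unfolding IJ(1,2) using lin by linarith
    show "n - 1 - i - m = m - 1 - i" unfolding IJ(1,2) using lin by linarith
  qed
  have "(n - 1 - i, n - 1 - j) \<in> S \<longleftrightarrow> block_of B (n - 1 - i) = block_of B (n - 1 - j)"
    using ij by (simp add: S_def parabolic_positions_def)
  also have "\<dots> \<longleftrightarrow> N \<le> j \<and> i = j + 1 \<and> even (m - 1 - i) \<or> i < N"
    unfolding same_block_B[OF ij] by (simp only: lin simp_thms)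
  also have "\<dots> \<longleftrightarrow> i < N \<or> i = j + 1 \<and> N \<le> i \<and> odd (i - N)"
  proof -
    have "even (m - 1 - i) \<longleftrightarrow> odd (i - N)" if "N \<le> i"
    proof -
      have "m - 1 - i + (i - N) + 1 = 2 * r" using that assms(1) unfolding m_def by linarith
      then have "even (m - 1 - i + (i - N) + 1)" by simp
      then show ?thesis by simp
    qed
    moreover have "N \<le> j" if "i = j + 1" "N \<le> i" "odd (i - N)"
    proof -
      have "i \<noteq> N" using that(3) by auto
      then show ?thesis using that by linarith
    qed
    moreover have "N \<le> i" if "N \<le> j" "i = j + 1" using that by simp
    ultimately show ?thesis by blast
  qed
  finally show ?thesis using True by auto
next
  case False
  then show ?thesis using assms n_eq by (auto simp: S_def parabolic_positions_def)
qed

lemma tail_edge_image_iff':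
  "(u, v) \<in> tail_edge N ` {..<2 * r} \<longleftrightarrow>
    u + 1 = v \<and> N \<le> v \<and> v < m \<and> even (v - N) \<or> v + 1 = u \<and> N \<le> u \<and> u < m \<and> odd (u - N)"
  unfolding m_def using N_eq a by (intro tail_edge_image_iff) simp

text \<open>The blocks \<open>ab, 2\<^sup>r\<close> at the end of the composition turn, after reflection to the first half, into
  the lower blocks of the seaweed.\<close>

lemma mem_seaweed_positions_iff:
  "(i, j) \<in> seaweed_positions K N r \<longleftrightarrow> i < m \<and> j < m \<and> (i, j) \<in> S \<and> (n - 1 - i, n - 1 - j) \<in> S"
proof (cases "i < m \<and> j < m")
  case True
  then have ij: "i < m" "j < m" by auto
  have KN: "K + 2 \<le> N" "N \<le> m" using N_eq a by (auto simp: m_def)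
  have tail: "(i, j) \<in> tail_edge N ` {..<2 * r} \<longleftrightarrow>
      i + 1 = j \<and> N \<le> j \<and> even (j - N) \<or> j + 1 = i \<and> N \<le> i \<and> odd (i - N)"
    unfolding tail_edge_image_iff' using ij by auto
  have R: "(i, j) \<in> seaweed_positions K N r \<longleftrightarrow>
      i < N \<and> j < N \<and> (j < K \<or> K \<le> i \<and> (j < N - 1 \<or> i = N - 1)) \<or> i = j \<and> N \<le> i \<or>
      i + 1 = j \<and> N \<le> j \<and> even (j - N) \<or> j + 1 = i \<and> N \<le> i \<and> odd (i - N)"
    unfolding seaweed_positions_def Un_iff tail using ij by (auto simp: core_positions_def m_def)
  define p where "p \<longleftrightarrow> even (j - N)"
  define q where "q \<longleftrightarrow> odd (i - N)"
  have q: "q \<Longrightarrow> i \<noteq> N" by (auto simp: q_def)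
  have "i < N \<and> j < N \<and> (j < K \<or> K \<le> i \<and> (j < N - 1 \<or> i = N - 1)) \<or> i = j \<and> N \<le> i \<or>
        i + 1 = j \<and> N \<le> j \<and> p \<or> j + 1 = i \<and> N \<le> i \<and> q \<longleftrightarrow>
      i < m \<and> j < m \<and> (j \<le> i \<or> j < K \<or> K \<le> i \<and> j < N - 1 \<or> j = i + 1 \<and> N \<le> j \<and> p) \<and>
        (i \<le> j \<or> i < N \<or> i = j + 1 \<and> N \<le> i \<and> q)" (is ?iff)
  proof (cases "i < N"; cases "j < N")
    assume "i < N" "j < N"
    then show ?iff using ij KN by auto
  next
    assume "i < N" "\<not> j < N"
    then show ?iff using ij KN by auto
  next
    assume *: "\<not> i < N" "j < N"
    have "\<not> (j + 1 = i \<and> q)" using * q by auto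
    then show ?iff using * by auto
  next
    assume *: "\<not> i < N" "\<not> j < N"
    then have "\<not> j < K" "\<not> j < N - 1" using KN by auto
    then show ?iff using * ij by auto
  qed
  then show ?thesis
    unfolding R mem_S_first_half[OF ij] mem_S_second_half[OF ij] p_def q_def .
next
  case False
  have "i < m \<and> j < m" if "(i, j) \<in> seaweed_positions K N r"
    using that unfolding seaweed_positions_def Un_iff tail_edge_image_iff'
    by (auto simp: core_positions_def m_def)
  then show ?thesis using False by blast
qed

end

section \<open>Character sums over the core and the tail\<close>

text \<open>The powers \<open>z\<^sup>k\<close> and the constant 1 are characters of the integers, so one computation serves the
  multiplicity polynomial and the dimension.\<close>

locale character =
  fixes X :: "int \<Rightarrow> 'c :: comm_ring_1"
  assumes X_zero: "X 0 = 1" and X_add: "X (k + l) = X k * X l"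
begin

definition geo :: "nat \<Rightarrow> 'c" where "geo c = (\<Sum>i<c. X (int i))"
definition geo_inv :: "nat \<Rightarrow> 'c" where "geo_inv c = (\<Sum>i<c. X (- int i))"

lemma X_diff: "X (k - l) = X k * X (- l)"
  using X_add[of k "- l"] by simp

lemma character_inverse: "character (\<lambda>k. X (- k))"
  by unfold_locales (simp_all add: X_zero X_diff)

text \<open>The ring identity \<open>z\<^sup>c I\<^sub>c(1/z) = z I\<^sub>c(z)\<close>.\<close>

lemma geo_inv_reverse: "X (int c) * geo_inv c = X 1 * geo c"
proof -
  have "X (int c) * geo_inv c = (\<Sum>i<c. X (int c - int i))"
    by (simp add: geo_inv_def sum_distrib_left X_diff)
  also have "\<dots> = (\<Sum>i<c. X (1 + int i))"
    by (rule sum.reindex_bij_witness[where i = "\<lambda>i. c - 1 - i" and j = "\<lambda>i. c - 1 - i"])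
       (auto simp: of_nat_diff algebra_simps)
  also have "\<dots> = X 1 * geo c" by (simp add: geo_def sum_distrib_left X_add)
  finally show ?thesis .
qed

lemma geo_Suc: "geo (Suc c) = geo c + X (int c)"
  by (simp add: geo_def)

lemma geo_block:
  assumes "t \<le> a" "a > 0"
  shows "(\<Sum>i\<in>{q * a..<q * a + t}. X (int (i div a) + int (i mod a))) = X (int q) * geo t"
proof -
  have "(\<Sum>i\<in>{q * a..<q * a + t}. X (int (i div a) + int (i mod a))) =
      (\<Sum>s<t. X (int ((q * a + s) div a) + int ((q * a + s) mod a)))"
    by (rule sum.reindex_bij_witness[where i = "\<lambda>s. q * a + s" and j = "\<lambda>i. i - q * a"]) auto
  also have "\<dots> = (\<Sum>s<t. X (int q + int s))"
    using assms by (intro sum.cong) auto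
  finally have "(\<Sum>i\<in>{q * a..<q * a + t}. X (int (i div a) + int (i mod a))) = (\<Sum>s<t. X (int q + int s))" .
  then show ?thesis by (simp add: X_add geo_def sum_distrib_left)
qed

lemma geo_rectangle:
  assumes "a > 0"
  shows "(\<Sum>i<a * c. X (int (i div a) + int (i mod a))) = geo a * geo c"
proof -
  have "(\<Sum>i<a * c. X (int (i div a) + int (i mod a))) =
      (\<Sum>q<c. \<Sum>i\<in>{q * a..<q * a + a}. X (int (i div a) + int (i mod a)))"
    by (subst sum.nat_group) (simp add: mult.commute)
  also have "\<dots> = (\<Sum>q<c. X (int q) * geo a)"
    using assms by (intro sum.cong refl geo_block) auto
  finally show ?thesis by (simp add: geo_def sum_distrib_left sum_distrib_right mult.commute)
qed

end

locale parabolic_character = parabolic + character X for X :: "int \<Rightarrow> 'c :: comm_ring_1"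
begin

definition D :: int where "D = int a + int b - 2"

lemma half_weight_core: "i < N \<Longrightarrow> half_weight i = int (i div a) + int (i mod a)"
  by (simp add: half_weight_def)

lemma half_weight_tail: "half_weight (N + s) = (if even s then D - 1 else D)"
  by (simp add: half_weight_def D_def)

lemma sum_lessThan_add:
  fixes f :: "nat \<Rightarrow> 'd :: comm_monoid_add"
  shows "(\<Sum>i<k + l. f i) = (\<Sum>i<k. f i) + (\<Sum>i<l. f (k + i))"
  by (induction l) (simp_all add: add.assoc)

lemma sum_half_weight:
  "(\<Sum>i<m. X (half_weight i)) = geo a * geo b + of_nat r * (X (D - 1) + X D)"
proof -
  have "(\<Sum>i<m. X (half_weight i)) = (\<Sum>i<N. X (half_weight i)) + (\<Sum>s<2 * r. X (half_weight (N + s)))"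
    unfolding m_def by (rule sum_lessThan_add)
  also have "(\<Sum>i<N. X (half_weight i)) = (\<Sum>i<a * b. X (int (i div a) + int (i mod a)))"
    unfolding N_def[symmetric] by (intro sum.cong) (auto simp: half_weight_core)
  also have "\<dots> = geo a * geo b" using a by (intro geo_rectangle) simp
  also have "(\<Sum>s<2 * r. X (half_weight (N + s))) = of_nat r * (X (D - 1) + X D)"
    unfolding half_weight_tail by (induction r) (simp_all add: algebra_simps)
  finally show ?thesis .
qed

lemma sum_half_weight_core:
  "(\<Sum>i<K. X (half_weight i)) = geo a * geo (b - 1)"
  "t \<le> a \<Longrightarrow> (\<Sum>i\<in>{K..<K + t}. X (half_weight i)) = X (int b - 1) * geo t"
proof -
  have "(\<Sum>i<K. X (half_weight i)) = (\<Sum>i<a * (b - 1). X (int (i div a) + int (i mod a)))"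
    unfolding K_def[symmetric] using N_eq by (intro sum.cong) (auto simp: half_weight_core)
  then show "(\<Sum>i<K. X (half_weight i)) = geo a * geo (b - 1)" using a by (simp add: geo_rectangle)
  assume t: "t \<le> a"
  have K: "K = (b - 1) * a" by (simp add: K_def mult.commute)
  have "(\<Sum>i\<in>{K..<K + t}. X (half_weight i)) = (\<Sum>i\<in>{K..<K + t}. X (int (i div a) + int (i mod a)))"
    using N_eq t by (intro sum.cong) (auto simp: half_weight_core)
  also have "\<dots> = X (int (b - 1)) * geo t"
    unfolding K using t a by (intro geo_block) auto
  finally show "(\<Sum>i\<in>{K..<K + t}. X (half_weight i)) = X (int b - 1) * geo t" using b by (simp add: of_nat_diff)
qed

end

section \<open>The Frobenius functional of the parabolic\<close>

context parabolic
begin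

lemma half_weight_bounds:
  assumes "i < m" shows "0 \<le> half_weight i" "half_weight i \<le> int a + int b - 2"
proof -
  have "i div a < b" "i mod a < a" if "i < N"
    using that a by (simp_all add: N_def less_mult_imp_div_less mult.commute)
  then have "int (i div a) + int (i mod a) \<le> int a + int b - 2" if "i < N" using that by force
  then show "0 \<le> half_weight i" "half_weight i \<le> int a + int b - 2"
    using a b by (auto simp: half_weight_def)
qed

lemma half_weight_surj:
  assumes "0 \<le> k" "k \<le> int a + int b - 2"
  obtains i where "i < N" "half_weight i = k"
proof -
  define q where "q = min (nat k) (b - 1)"
  define s where "s = nat k - q"
  have s: "s < a" and q: "q \<le> b - 1" and k: "int q + int s = k" using assms a b by (auto simp: q_def s_def)
  have "q * a + s < (q + 1) * a" using s by simp
  also have "\<dots> \<le> b * a" using q b by (intro mult_le_mono1) simp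
  finally have "q * a + s < N" by (simp add: N_def mult.commute)
  then show ?thesis using that[of "q * a + s"] s k a by (simp add: half_weight_def)
qed

lemma E_weight:
  assumes "(u, v) \<in> E" shows "wt u - wt v = 1"
proof -
  have Nm: "N \<le> m" "K + 2 \<le> N" by (use N_eq a in \<open>auto simp: m_def\<close>)
  have a0: "a > 0" using a by simp
  have last_group: "(K + s) div a = b - 1" "(K + s) mod a = s" if "s < a" for s
    using that by (simp_all add: K_def)
  consider "u = v + a" "v < K" | "u = v + 1" "K \<le> v" "v < N - 1" | "(u, v) \<in> tail_edge N ` {..<2 * r}"
    | "v < m" "u = n - 1 - v"
    using assms by (auto simp: E_def seaweed_edges_def core_edges_def)
  then show ?thesis
  proof cases
    case 1
    then have "u < N" "v < N" "u < m" "v < m" using Nm N_eq by auto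
    then show ?thesis using 1 a0 by (simp add: wt_def half_weight_def)
  next
    case 2
    define s where "s = v - K"
    have v: "v = K + s" "s < a" "s + 1 < a" "u = K + (s + 1)" using 2 N_eq by (auto simp: s_def)
    have "v div a = b - 1" "v mod a = s" "u div a = b - 1" "u mod a = s + 1"
      unfolding v(1,4) by (rule last_group[OF v(2)] last_group[OF v(3)])+
    moreover have "u < N" "v < N" "u < m" "v < m" using 2 Nm by auto
    ultimately show ?thesis by (simp add: wt_def half_weight_def)
  next
    case 3
    have last: "half_weight (N - 1) = int a + int b - 2"
    proof -
      have "N - 1 = K + (a - 1)" using N_eq a by simp
      then have "(N - 1) div a = b - 1" "(N - 1) mod a = a - 1"
        using last_group[of "a - 1"] a0 by simp_all
      then show ?thesis using N_eq a b by (simp add: half_weight_def of_nat_diff)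
    qed
    have odd: "half_weight i = int a + int b - 2" if "N \<le> i" "odd (i - N)" for i
      using that by (simp add: half_weight_def)
    have even: "half_weight i = int a + int b - 3" if "N \<le> i" "even (i - N)" for i
      using that by (simp add: half_weight_def)
    from 3 show ?thesis unfolding tail_edge_image_iff'
    proof (elim disjE conjE)
      assume *: "u + 1 = v" "N \<le> v" "v < m" "even (v - N)"
      have "half_weight u = int a + int b - 2"
      proof (cases "u = N - 1")
        case False
        then have "N \<le> u" "v - N = Suc (u - N)" using * by linarith+
        then show ?thesis using * by (intro odd) auto
      next
        case True
        then show ?thesis using last by simp
      qed
      then show ?thesis using * even[of v] by (simp add: wt_def)
    next
      assume *: "v + 1 = u" "N \<le> u" "u < m" "odd (u - N)"
      have "N \<noteq> u" using * by auto
      then have "N \<le> v" "u - N = Suc (v - N)" using * by linarith+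
      then show ?thesis using * odd[of u] even[of v] by (simp add: wt_def)
    qed
  next
    case 4
    then have "\<not> u < m" "n - 1 - u = v" using n_eq by auto
    then show ?thesis using 4 by (simp add: wt_def)
  qed
qed

lemma S_upper: "i < m \<Longrightarrow> m \<le> j \<Longrightarrow> j < n \<Longrightarrow> (i, j) \<notin> S"
  using same_block_B[of i j] N_eq a n_eq by (auto simp: S_def parabolic_positions_def m_def)

lemma S_lower: "j \<le> i \<Longrightarrow> i < n \<Longrightarrow> (i, j) \<in> S"
  by (auto simp: S_def parabolic_positions_def)

lemma seaweed_edges_subset: "seaweed_edges a K N r \<subseteq> seaweed_positions K N r"
proof -
  have "core_edges a K N \<subseteq> core_positions K N"
    using N_eq a by (auto simp: core_edges_def core_positions_def)
  then show ?thesis by (auto simp: seaweed_edges_def seaweed_positions_def)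
qed

lemma E_subset_S: "E \<subseteq> S"
proof
  fix e assume e: "e \<in> E"
  show "e \<in> S"
  proof (cases "e \<in> seaweed_edges a K N r")
    case True
    then show ?thesis using seaweed_edges_subset mem_seaweed_positions_iff by (cases e) blast
  next
    case False
    then obtain i where "i < m" "e = (n - 1 - i, i)" using e by (auto simp: E_def)
    then show ?thesis using n_eq by (auto intro!: S_lower)
  qed
qed

lemma E_radical:
  assumes x: "x \<in> traceless n (supported n S)"
    and rad: "\<And>i j. (i, j) \<in> S \<Longrightarrow> (\<Sum>u | (u, j) \<in> E. x $$ (u, i)) = (\<Sum>v | (i, v) \<in> E. x $$ (j, v))"
  shows "x = 0\<^sub>m n n"
proof (rule folding_radical[OF m_pos n_eq x S_upper _ _ _ E_def rad])
  show "(i, j) \<in> S" if "m \<le> i" "i < n" "j < m" for i j using that by (intro S_lower) auto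
  show "(i, j) \<in> S \<or> (n - 1 - i, n - 1 - j) \<in> S" if "i < m" "j < m" for i j
    unfolding mem_S_first_half[OF that] mem_S_second_half[OF that] by linarith
  show "seaweed_edges a K N r \<subseteq> {..<m} \<times> {..<m}"
    using seaweed_edges_subset mem_seaweed_positions_iff by auto
  fix P :: "nat \<Rightarrow> nat \<Rightarrow> complex"
  assume supp: "\<And>i j. i < m \<Longrightarrow> j < m \<Longrightarrow> (i, j) \<notin> S \<or> (n - 1 - i, n - 1 - j) \<notin> S \<Longrightarrow> P i j = 0"
    and eq: "\<And>i j. i < m \<Longrightarrow> j < m \<Longrightarrow> (i, j) \<in> S \<Longrightarrow> (n - 1 - i, n - 1 - j) \<in> S \<Longrightarrow>
      (\<Sum>u | (u, j) \<in> seaweed_edges a K N r. P u i) = (\<Sum>v | (i, v) \<in> seaweed_edges a K N r. P j v)"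
  have "P i j = (if i = j then P 0 0 else 0)" if "i < m" "j < m" for i j
  proof (rule seaweed_radical_scalar[OF a b, of r P, folded K_def N_def, folded m_def])
    show "P i j = 0" if "i < m" "j < m" "(i, j) \<notin> seaweed_positions K N r" for i j
      using supp[OF that(1,2)] that mem_seaweed_positions_iff by blast
    show "(\<Sum>u | (u, j) \<in> seaweed_edges a K N r. P u i) = (\<Sum>v | (i, v) \<in> seaweed_edges a K N r. P j v)"
      if "(i, j) \<in> seaweed_positions K N r" for i j
      using eq that mem_seaweed_positions_iff by blast
  qed (use that in auto)
  then show "\<exists>c. \<forall>i<m. \<forall>j<m. P i j = (if i = j then c else 0)" by blast
qed

sublocale weighted_edge_functional n S E wt
proof
  show "S \<subseteq> {..<n} \<times> {..<n}" by (auto simp: S_def parabolic_positions_def)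
  show "(i, j) \<in> S \<Longrightarrow> (j, k) \<in> S \<Longrightarrow> (i, k) \<in> S" for i j k
    unfolding S_def by (rule parabolic_positions_trans)
qed (fact n_pos S_lower[OF order_refl] E_subset_S E_weight E_radical)+

text \<open>The positive differences are attained against the column 0, the others in the last row.\<close>

lemma weight_differences: "(\<lambda>(i, j). wt i - wt j) ` (S - {(0, 0)}) = {- (int a + int b - 2)..int a + int b - 1}"
proof (intro equalityI subsetI)
  fix k assume "k \<in> (\<lambda>(i, j). wt i - wt j) ` (S - {(0, 0)})"
  then obtain i j where ij: "(i, j) \<in> S" and k: "k = wt i - wt j" by auto
  have ijn: "i < n" "j < n" using ij by (auto simp: S_def parabolic_positions_def)
  have wt: "wt i \<in> {0..int a + int b - 2}" if "i < m" for i
    using half_weight_bounds[OF that] that by (simp add: wt_def)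
  have wt': "wt i \<in> {1..int a + int b - 1}" if "\<not> i < m" "i < n" for i
  proof -
    have "n - 1 - i < m" using that n_eq by linarith
    from half_weight_bounds[OF this] show ?thesis using that(1) by (simp add: wt_def)
  qed
  show "k \<in> {- (int a + int b - 2)..int a + int b - 1}"
    using S_upper[of i j] ij ijn wt[of i] wt[of j] wt'[of i] wt'[of j] unfolding k
    by (cases "i < m"; cases "j < m") auto
next
  fix k assume k: "k \<in> {- (int a + int b - 2)..int a + int b - 1}"
  have n1: "n - 1 > 0" "n - 1 < n" "\<not> n - 1 < m" using n_eq N_eq a m_pos by (auto simp: m_def)
  have zero: "half_weight 0 = 0" using N_eq a by (simp add: half_weight_def)
  show "k \<in> (\<lambda>(i, j). wt i - wt j) ` (S - {(0, 0)})"
  proof (cases "k \<ge> 1")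
    case True
    then obtain i where i: "i < N" "half_weight i = k - 1" using half_weight_surj[of "k - 1"] k by auto
    then have im: "i < m" by (simp add: m_def)
    have "(n - 1 - i, 0) \<in> S - {(0, 0)}" using im n_eq by (auto intro!: S_lower)
    moreover have "wt (n - 1 - i) - wt 0 = k"
      using i im zero n_eq m_pos by (simp add: wt_def)
    ultimately show ?thesis by force
  next
    case False
    then obtain j where j: "j < N" "half_weight j = - k" using half_weight_surj[of "- k"] k by auto
    then have jm: "j < m" by (simp add: m_def)
    have "(n - 1, n - 1 - j) \<in> S - {(0, 0)}" using n1 by (auto intro!: S_lower)
    moreover have "wt (n - 1) - wt (n - 1 - j) = k"
      using j jm zero n1 n_eq by (simp add: wt_def)
    ultimately show ?thesis by force
  qed
qed

end

section \<open>The generating function of the weight differences\<close>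

context parabolic_character
begin

lemma inv: "parabolic_character a b (\<lambda>k. X (- k))"
  using character_inverse parabolic_axioms by (simp add: parabolic_character_def)

lemma inv_geo: "character.geo (\<lambda>k. X (- k)) c = geo_inv c"
  by (simp add: character.geo_def[OF character_inverse] geo_inv_def)

lemma sum_half_weight_inv:
  "(\<Sum>i<m. X (- half_weight i)) = geo_inv a * geo_inv b + of_nat r * (X (- (D - 1)) + X (- D))"
  "(\<Sum>i<K. X (- half_weight i)) = geo_inv a * geo_inv (b - 1)"
  "t \<le> a \<Longrightarrow> (\<Sum>i\<in>{K..<K + t}. X (- half_weight i)) = X (- (int b - 1)) * geo_inv t"
  using parabolic_character.sum_half_weight[OF inv, of r] parabolic_character.sum_half_weight_core[OF inv]
  unfolding inv_geo parabolic_character.D_def[OF inv] D_def by blast+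

lemma sum_rectangle:
  "(\<Sum>(i, j)\<in>A \<times> C. X (half_weight i - half_weight j)) =
    (\<Sum>i\<in>A. X (half_weight i)) * (\<Sum>j\<in>C. X (- half_weight j))"
  by (simp add: sum.cartesian_product[symmetric] X_diff sum_product)

text \<open>The core splits into the rows of all groups against the columns before the last group, the last
  group against itself without its final column, and the last diagonal position. Each edge of the tail
  contributes \<open>X 1\<close>, because the potential drops by one.\<close>

lemma sum_seaweed_positions:
  "(\<Sum>(i, j)\<in>seaweed_positions K N r. X (half_weight i - half_weight j)) =
    1 + (geo (a - 1) * geo_inv (a - 1) + X 1 * geo (a - 1))
    + geo a * geo_inv a * (geo (b - 1) * geo_inv (b - 1) + X 1 * geo (b - 1))
    + 2 * of_nat r * (1 + X 1)"
proof -
  let ?G = "\<lambda>(i, j). X (half_weight i - half_weight j)"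
  have KN: "K + 2 \<le> N" "N \<le> m" "0 < N" by (use N_eq a in \<open>auto simp: m_def\<close>)
  let ?diag = "{(i, j). i = j \<and> N \<le> i \<and> i < N + 2 * r}" and ?tail = "tail_edge N ` {..<2 * r}"
  have fin: "finite (core_positions K N)" "finite ?diag" "finite ?tail"
  proof -
    show "finite (core_positions K N)"
      by (rule finite_subset[of _ "{..<N} \<times> {..<N}"]) (auto simp: core_positions_def)
    show "finite ?diag" by (rule finite_subset[of _ "{..<N + 2 * r} \<times> {..<N + 2 * r}"]) auto
  qed simp
  have disj: "core_positions K N \<inter> ?diag = {}" "(core_positions K N \<union> ?diag) \<inter> ?tail = {}"
  proof -
    show "core_positions K N \<inter> ?diag = {}" by (auto simp: core_positions_def)
    have "(u, v) \<notin> core_positions K N \<union> ?diag" if "(u, v) \<in> ?tail" for u v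
      using that unfolding tail_edge_image_iff' by (auto simp: core_positions_def)
    then show "(core_positions K N \<union> ?diag) \<inter> ?tail = {}" by auto
  qed
  have "sum ?G (seaweed_positions K N r) = sum ?G (core_positions K N) + sum ?G ?diag + sum ?G ?tail"
    unfolding seaweed_positions_def
    using fin disj by (subst sum.union_disjoint; simp add: sum.union_disjoint)
  moreover have "sum ?G ?diag = 2 * of_nat r"
  proof -
    have "sum ?G ?diag = (\<Sum>i\<in>{N..<N + 2 * r}. 1)"
      by (rule sum.reindex_bij_witness[where i = "\<lambda>i. (i, i)" and j = fst]) (auto simp: X_zero)
    then show ?thesis by simp
  qed
  moreover have "sum ?G ?tail = 2 * of_nat r * X 1"
  proof -
    have "inj_on (tail_edge N) {..<2 * r}"
      by (auto simp: inj_on_def tail_edge_def split: if_splits)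
    then have "sum ?G ?tail = (\<Sum>s<2 * r. ?G (tail_edge N s))"
      by (simp add: sum.reindex)
    also have "\<dots> = (\<Sum>s<2 * r. X 1)"
    proof (rule sum.cong)
      fix s assume s: "s \<in> {..<2 * r}"
      obtain u v where uv: "tail_edge N s = (u, v)" by fastforce
      then have mem: "(u, v) \<in> ?tail" using s by (metis imageI)
      then have "u < m" "v < m" unfolding tail_edge_image_iff' using KN by auto
      moreover have "(u, v) \<in> E" using mem by (simp add: E_def seaweed_edges_def)
      ultimately have "half_weight u - half_weight v = 1" using E_weight[of u v] by (simp add: wt_def)
      then show "?G (tail_edge N s) = X 1" by (simp add: uv)
    qed simp
    finally show ?thesis by simp
  qed
  moreover have "sum ?G (core_positions K N) =
      1 + (geo (a - 1) * geo_inv (a - 1) + X 1 * geo (a - 1))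
      + geo a * geo_inv a * (geo (b - 1) * geo_inv (b - 1) + X 1 * geo (b - 1))"
  proof -
    have split: "core_positions K N = {..<N} \<times> {..<K} \<union> ({K..<K + a} \<times> {K..<K + (a - 1)} \<union> {(N - 1, N - 1)})"
      using N_eq a by (auto simp: core_positions_def)
    have "sum ?G (core_positions K N) = sum ?G ({..<N} \<times> {..<K})
        + (sum ?G ({K..<K + a} \<times> {K..<K + (a - 1)}) + sum ?G {(N - 1, N - 1)})"
      unfolding split
    proof (subst sum.union_disjoint)
      show "({..<N} \<times> {..<K}) \<inter> ({K..<K + a} \<times> {K..<K + (a - 1)} \<union> {(N - 1, N - 1)}) = {}"
        using KN by auto
      have "({K..<K + a} \<times> {K..<K + (a - 1)}) \<inter> {(N - 1, N - 1)} = {}" using N_eq by auto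
      then show "sum ?G ({..<N} \<times> {..<K}) + sum ?G ({K..<K + a} \<times> {K..<K + (a - 1)} \<union> {(N - 1, N - 1)}) =
          sum ?G ({..<N} \<times> {..<K}) + (sum ?G ({K..<K + a} \<times> {K..<K + (a - 1)}) + sum ?G {(N - 1, N - 1)})"
        by (subst sum.union_disjoint) auto
    qed auto
    moreover have "sum ?G ({..<N} \<times> {..<K}) = geo a * geo b * (geo_inv a * geo_inv (b - 1))"
    proof -
      have "(\<Sum>i<N. X (half_weight i)) = (\<Sum>i<a * b. X (int (i div a) + int (i mod a)))"
        unfolding N_def[symmetric] by (intro sum.cong) (auto simp: half_weight_core)
      then show ?thesis using a by (simp only: sum_rectangle sum_half_weight_inv geo_rectangle)
    qed
    moreover have "sum ?G ({K..<K + a} \<times> {K..<K + (a - 1)}) = geo a * geo_inv (a - 1)"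
    proof -
      have "sum ?G ({K..<K + a} \<times> {K..<K + (a - 1)}) =
          X (int b - 1) * geo a * (X (- (int b - 1)) * geo_inv (a - 1))"
        by (simp only: sum_rectangle sum_half_weight_core(2) sum_half_weight_inv(3) order_refl diff_le_self)
      also have "\<dots> = X (int b - 1) * X (- (int b - 1)) * (geo a * geo_inv (a - 1))" by (simp only: ac_simps)
      also have "X (int b - 1) * X (- (int b - 1)) = 1" by (simp only: X_diff[symmetric] diff_self X_zero)
      finally show ?thesis by simp
    qed
    moreover have "sum ?G {(N - 1, N - 1)} = 1" by (simp add: X_zero)
    moreover have geo: "geo c * geo_inv (c - 1) = geo (c - 1) * geo_inv (c - 1) + X 1 * geo (c - 1)" if "c > 0" for c
      using geo_Suc[of "c - 1"] geo_inv_reverse[of "c - 1"] that by (simp add: algebra_simps)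
    moreover have "geo a * geo b * (geo_inv a * geo_inv (b - 1)) = geo a * geo_inv a * (geo b * geo_inv (b - 1))"
      by (simp only: ac_simps)
    ultimately show ?thesis using a b geo[of a] geo[of b] by (simp only:) (simp add: algebra_simps)
  qed
  ultimately show ?thesis by (simp only:) (simp add: algebra_simps)
qed

text \<open>Split the positions into the quadrants and reflect the lower right one to the first half. By
  inclusion and exclusion the two diagonal quadrants give the full square and the seaweed.\<close>

theorem sum_positions:
  "(\<Sum>(i, j)\<in>S. X (wt i - wt j)) =
    1 + (geo (a - 1) * geo_inv (a - 1) + X 1 * geo (a - 1))
    + geo a * geo_inv a * (geo (b - 1) * geo_inv (b - 1) + X 1 * geo (b - 1))
    + 2 * of_nat r * (1 + X 1)
    + (1 + X 1) * (geo a * geo b + of_nat r * (X (D - 1) + X D))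
        * (geo_inv a * geo_inv b + of_nat r * (X (- (D - 1)) + X (- D)))"
proof -
  let ?f = "\<lambda>(i, j). X (wt i - wt j)" and ?G = "\<lambda>(i, j). X (half_weight i - half_weight j)"
  let ?\<tau> = "\<lambda>i. n - 1 - i"
  let ?Q = "{..<m} \<times> {..<m}"
  \<comment> \<open>\<open>S1\<close> is the upper left quadrant, \<open>S2\<close> the reflected lower right one; \<open>L\<close> and \<open>T\<close> are the lower quadrants.\<close>
  define S1 where "S1 = S \<inter> ?Q"
  define S2 where "S2 = {(i, j) \<in> ?Q. (?\<tau> i, ?\<tau> j) \<in> S}"
  define L where "L = (\<lambda>(i, j). (?\<tau> i, j)) ` ?Q"
  define T where "T = (\<lambda>(i, j). (?\<tau> i, ?\<tau> j)) ` S2"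
  have fin: "finite S1" "finite S2" "finite L" "finite T"
  proof -
    show "finite S1" by (simp add: S1_def)
    show S2: "finite S2" unfolding S2_def by (rule finite_subset[of _ ?Q]) auto
    show "finite L" "finite T" using S2 by (simp_all add: L_def T_def)
  qed
  have \<tau>: "?\<tau> (?\<tau> i) = i" "m \<le> ?\<tau> i" "?\<tau> i < n" if "i < m" for i using that n_eq by auto
  have \<tau>': "?\<tau> (?\<tau> i) = i" "?\<tau> i < m" if "m \<le> i" "i < n" for i using that n_eq by auto
  have inj\<tau>: "i = j" if "?\<tau> i = ?\<tau> j" "i < m" "j < m" for i j using that \<tau>(1)[of i] \<tau>(1)[of j] by simp
  have wt: "wt i = half_weight i" "wt (?\<tau> i) = half_weight i + 1" if "i < m" for i
    using that \<tau>[OF that] by (simp_all add: wt_def)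
  have S_eq: "S = S1 \<union> (L \<union> T)"
  proof (intro equalityI subsetI)
    fix e assume e: "e \<in> S"
    then obtain i j where ij: "e = (i, j)" "i < n" "j < n" by (auto simp: S_def parabolic_positions_def)
    show "e \<in> S1 \<union> (L \<union> T)"
    proof (cases "i < m")
      case True
      then have "j < m" using S_upper[of i j] e ij by force
      then show ?thesis using True e ij by (simp add: S1_def)
    next
      case i: False
      note \<tau>i = \<tau>'[OF _ ij(2)]
      show ?thesis
      proof (cases "j < m")
        case True
        then have "e = (\<lambda>(i, j). (?\<tau> i, j)) (?\<tau> i, j)" "(?\<tau> i, j) \<in> ?Q" using \<tau>i i ij by auto
        then show ?thesis unfolding L_def by blast
      next
        case False
        then have "e = (\<lambda>(i, j). (?\<tau> i, ?\<tau> j)) (?\<tau> i, ?\<tau> j)" "(?\<tau> i, ?\<tau> j) \<in> S2"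
          using \<tau>i \<tau>'[OF _ ij(3)] i ij e by (auto simp: S2_def)
        then show ?thesis unfolding T_def by blast
      qed
    qed
  next
    fix e assume "e \<in> S1 \<union> (L \<union> T)"
    moreover have "e \<in> S" if "e \<in> L"
    proof -
      from that obtain i j where ij: "i < m" "j < m" "e = (?\<tau> i, j)" by (auto simp: L_def)
      then show ?thesis using \<tau>[of i] by (auto intro: S_lower)
    qed
    ultimately show "e \<in> S" by (auto simp: S1_def S2_def T_def)
  qed
  have disj: "S1 \<inter> (L \<union> T) = {}" "L \<inter> T = {}"
  proof -
    have "fst e \<ge> m" if "e \<in> L \<union> T" for e using that \<tau>(2) by (fastforce simp: L_def T_def S2_def)
    moreover have "fst e < m" if "e \<in> S1" for e using that by (auto simp: S1_def)
    ultimately show "S1 \<inter> (L \<union> T) = {}" by fastforce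
    have "snd e < m" if "e \<in> L" for e using that by (auto simp: L_def)
    moreover have "snd e \<ge> m" if "e \<in> T" for e using that \<tau>(2) by (fastforce simp: T_def S2_def)
    ultimately show "L \<inter> T = {}" by fastforce
  qed
  have "sum ?f S = sum ?f S1 + (sum ?f L + sum ?f T)"
    unfolding S_eq using fin disj by (simp add: sum.union_disjoint)
  also have "sum ?f S1 = sum ?G S1"
    by (rule sum.cong) (auto simp: S1_def wt)
  also have "sum ?f T = sum ?G S2"
  proof -
    have "inj_on (\<lambda>(i, j). (?\<tau> i, ?\<tau> j)) S2"
      by (rule inj_onI) (use inj\<tau> in \<open>auto simp: S2_def\<close>)
    then have "sum ?f T = (\<Sum>e\<in>S2. ?f (case e of (i, j) \<Rightarrow> (?\<tau> i, ?\<tau> j)))"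
      unfolding T_def by (simp add: sum.reindex)
    also have "\<dots> = sum ?G S2"
    proof (rule sum.cong)
      fix e assume "e \<in> S2"
      then obtain i j where "e = (i, j)" "i < m" "j < m" by (auto simp: S2_def)
      then show "?f (case e of (i, j) \<Rightarrow> (?\<tau> i, ?\<tau> j)) = ?G e" using wt(2)[of i] wt(2)[of j] by simp
    qed simp
    finally show ?thesis .
  qed
  also have "sum ?f L = X 1 * sum ?G ?Q"
  proof -
    have "inj_on (\<lambda>(i, j). (?\<tau> i, j)) ?Q"
      by (rule inj_onI) (use inj\<tau> in auto)
    then have "sum ?f L = (\<Sum>e\<in>?Q. ?f (case e of (i, j) \<Rightarrow> (?\<tau> i, j)))"
      unfolding L_def by (simp add: sum.reindex)
    also have "\<dots> = (\<Sum>e\<in>?Q. X 1 * ?G e)"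
    proof (rule sum.cong)
      fix e assume "e \<in> ?Q"
      then obtain i j where ij: "e = (i, j)" "i < m" "j < m" by auto
      have "wt (?\<tau> i) - wt j = 1 + (half_weight i - half_weight j)" using wt(2)[OF ij(2)] wt(1)[OF ij(3)] by simp
      then show "?f (case e of (i, j) \<Rightarrow> (?\<tau> i, j)) = X 1 * ?G e" using ij(1) by (simp only: prod.case X_add)
    qed simp
    finally show ?thesis by (simp add: sum_distrib_left)
  qed
  also have "sum ?G S1 + (X 1 * sum ?G ?Q + sum ?G S2) = X 1 * sum ?G ?Q + (sum ?G S1 + sum ?G S2)"
    by (simp only: ac_simps)
  also have "sum ?G S1 + sum ?G S2 = sum ?G (S1 \<union> S2) + sum ?G (S1 \<inter> S2)"
    by (rule sum.union_inter[symmetric, OF fin(1,2)])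
  also have "S1 \<union> S2 = ?Q"
  proof -
    have "(i, j) \<in> S \<or> (?\<tau> i, ?\<tau> j) \<in> S" if "i < m" "j < m" for i j
      unfolding mem_S_first_half[OF that] mem_S_second_half[OF that] by linarith
    then show ?thesis by (auto simp: S1_def S2_def)
  qed
  also have "S1 \<inter> S2 = seaweed_positions K N r"
    using mem_seaweed_positions_iff by (auto simp: S1_def S2_def)
  also have "sum ?G ?Q = (geo a * geo b + of_nat r * (X (D - 1) + X D))
        * (geo_inv a * geo_inv b + of_nat r * (X (- (D - 1)) + X (- D)))"
    by (simp only: sum_rectangle sum_half_weight sum_half_weight_inv)
  finally show ?thesis unfolding sum_seaweed_positions by (simp add: algebra_simps)
qed

end

section \<open>The multiplicity polynomial and the dimension\<close>

lemma zpow_character: "character zpow"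
  by unfold_locales (simp_all add: zpow_def mult_single)

lemma lp_vee_add: "lp_vee (P + Q) = lp_vee P + lp_vee Q"
  by (rule poly_mapping_eqI) (simp add: lp_vee_def map_key.rep_eq lookup_add)

lemma lp_vee_zpow: "lp_vee (zpow k) = zpow (- k)"
  by (rule poly_mapping_eqI) (auto simp: lp_vee_def map_key.rep_eq zpow_def lookup_single when_def)

lemma lp_vee_sum_zpow: "lp_vee (\<Sum>i\<in>A. zpow (f i)) = (\<Sum>i\<in>A. zpow (- f i))"
proof (induction A rule: infinite_finite_induct)
  case (insert x A)
  then show ?case by (simp add: lp_vee_add lp_vee_zpow)
qed (auto intro!: poly_mapping_eqI simp: lp_vee_def map_key.rep_eq)

lemma lp_I_geo: "lp_I c = character.geo zpow c" and lp_vee_lp_I_geo: "lp_vee (lp_I c) = character.geo_inv zpow c"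
  by (simp_all add: lp_I_def lp_vee_sum_zpow character.geo_def[OF zpow_character] character.geo_inv_def[OF zpow_character])

context parabolic
begin

lemma sum_zpow_positions:
  defines "D \<equiv> int a + int b - 2"
  defines "V \<equiv> zpow (D - 1) + zpow D"
  shows "(\<Sum>(i, j)\<in>S - {(0, 0)}. zpow (wt i - wt j)) =
    lp_B (a - 1) + lp_C a * lp_B (b - 1) + 2 * of_nat r * (1 + zpow 1)
    + (1 + zpow 1) * (lp_I a * lp_I b + of_nat r * V)
        * (lp_vee (lp_I a) * lp_vee (lp_I b) + of_nat r * lp_vee V)"
proof -
  have pc: "parabolic_character a b zpow"
    using zpow_character parabolic_axioms by (simp add: parabolic_character_def)
  have "(\<Sum>(i, j)\<in>S. zpow (wt i - wt j)) = 1 + (\<Sum>(i, j)\<in>S - {(0, 0)}. zpow (wt i - wt j))"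
    using finite_S S_lower[of 0 0] n_pos
    by (subst sum.remove[of S "(0, 0)"]) (auto simp: character.X_zero[OF zpow_character])
  then show ?thesis
    using parabolic_character.sum_positions[OF pc, of r]
    by (simp add: parabolic_character.D_def[OF pc] D_def V_def lp_B_def lp_C_def lp_I_geo lp_vee_lp_I_geo[unfolded lp_I_geo]
        lp_vee_add lp_vee_zpow add.assoc)
qed

lemma card_positions:
  "int (card (S - {(0, 0)})) = 8 * (int r)\<^sup>2 + (8 * int a * int b + 4) * int r + int a * (int a - 1)
          + (int a)\<^sup>2 * int b * (3 * int b - 1)"
proof -
  \<comment> \<open>The dimension is the value of the generating function at 1.\<close>
  have c: "character (\<lambda>_. 1 :: int)" by unfold_locales simp_all
  then have pc: "parabolic_character a b (\<lambda>_. 1 :: int)"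
    using parabolic_axioms by (simp add: parabolic_character_def)
  have "int (card S) = (\<Sum>(i, j)\<in>S. 1)" by (simp add: case_prod_unfold)
  moreover have "int (card (S - {(0, 0)})) = int (card S) - 1"
  proof -
    have "(0, 0) \<in> S" using n_pos by (intro S_lower) auto
    moreover from this have "card S > 0" using finite_S by (auto simp: card_gt_0_iff)
    ultimately show ?thesis by (simp add: of_nat_diff)
  qed
  ultimately show ?thesis
    using parabolic_character.sum_positions[OF pc, of r] a b
    by (simp add: character.geo_def[OF c] character.geo_inv_def[OF c] of_nat_diff power2_eq_square algebra_simps)
qed

end

theorem corollary4p2:
  fixes a b r :: nat
  assumes "a \<ge> 2" and "b \<ge> 2"
  shows
    "let n = 2 * a * b + 4 * r;
         p = seaweed n [2 * a * b + 4 * r]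
               ([a * (b - 1), a - 1] @ replicate r 2 @ [1] @ replicate r 2 @ [a * b]);
         D = int a + int b - 2;
         V = zpow (D - 1) + zpow D;
         H = lp_B (a - 1) + lp_C a * lp_B (b - 1) + 2 * of_nat r * (1 + zpow 1)
             + (1 + zpow 1) * (lp_I a * lp_I b + of_nat r * V)
                 * (lp_vee (lp_I a) * lp_vee (lp_I b) + of_nat r * lp_vee V)
     in frobenius n p \<and>
        (\<forall>F. frobenius_functional n p F \<longrightarrow>
             ooms_polynomial n p F = H \<and>
             Poly_Mapping.keys (ooms_polynomial n p F) = {- D .. D + 1}) \<and>
        int (mat_subspace_dim n p) =
          8 * (int r)\<^sup>2 + (8 * int a * int b + 4) * int r + int a * (int a - 1)
          + (int a)\<^sup>2 * int b * (3 * int b - 1)"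
proof -
  interpret P: parabolic a b r using assms by unfold_locales
  define q where "q = seaweed P.n [P.n] P.B"
  have q: "P.g = q"
    by (simp only: P.S_def q_def seaweed_eq_traceless_supported)
  have D: "int a + int b - 2 + 1 = int a + int b - 1" by simp
  show ?thesis
    unfolding Let_def P.n_def[symmetric] P.B_def[symmetric] q_def[symmetric] D
  proof (intro conjI allI impI)
    show "frobenius P.n q" using P.frobenius unfolding q .
    show "int (mat_subspace_dim P.n q) = 8 * (int r)\<^sup>2 + (8 * int a * int b + 4) * int r
        + int a * (int a - 1) + (int a)\<^sup>2 * int b * (3 * int b - 1)"
      using P.dim_algebra unfolding q by (simp only: P.card_positions)
    fix F assume F: "frobenius_functional P.n q F"
    show "Poly_Mapping.keys (ooms_polynomial P.n q F) = {- (int a + int b - 2)..int a + int b - 1}"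
      using P.keys_ooms_polynomial[of F] F unfolding q P.weight_differences by simp
    show "ooms_polynomial P.n q F = lp_B (a - 1) + lp_C a * lp_B (b - 1) + 2 * of_nat r * (1 + zpow 1)
        + (1 + zpow 1) * (lp_I a * lp_I b + of_nat r * (zpow (int a + int b - 2 - 1) + zpow (int a + int b - 2)))
          * (lp_vee (lp_I a) * lp_vee (lp_I b)
             + of_nat r * lp_vee (zpow (int a + int b - 2 - 1) + zpow (int a + int b - 2)))"
      using P.ooms_polynomial_eq[of F] F unfolding q P.sum_zpow_positions by simp
  qed
qed

end
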